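(* Let $m\ge2$ be an integer and let $d\ge2$ be an even integer. Let $${\rm SU}C\ell^{\frac1m}_d:=\{U\in C\ell^{\frac1m}_d:\ \overline{U}U=e,\ {\rm Det}(U)=1\}.$$ Then there is an isomorphism of Lie groups $${\rm SU}C\ell^{\frac1m}_d\simeq{\rm SU}(m^{\frac d2}),$$ where ${\rm SU}(n)=\{A\in{\rm Mat}(n,\mathbb{C}):A^{\rm H}A=I,\ \det(A)=1\}$.
   Context: The generalized Clifford algebra $C\ell^{\frac1m}_d$ is the unital associative algebra over $\mathbb{C}$ with identity $e$ and generators $e_1,\dots,e_d$ subject to $e_j^m=e$ for $j=1,\dots,d$ and $e_ke_l=\omega e_le_k$ for $k<l$, where $\omega:=e^{2\pi i/m}$. It has dimension $m^d$ with basis $e_1^{j_1}\cdots e_d^{j_d}$, $0\le j_1,\dots,j_d\le m-1$ (each basis element is invertible), so each element is uniquely $U=\sum u_{j_1\ldots j_d}e_1^{j_1}\cdots e_d^{j_d}$ with $u_{j_1\ldots j_d}\in\mathbb{C}$. Scalars $c\in\mathbb{C}$ are identified with $ce$, and $\langle U\rangle_0:=u_{0\ldots0}\in\mathbb{C}$. Hermitian conjugation: $\overline{U}:=\sum\overline{u_{j_1\ldots j_d}}\,(e_1^{j_1}\cdots e_d^{j_d})^{-1}$, where $\overline{u}$ is complex conjugation for $u\in\mathbb{C}$. Determinant: with $N:=m^{\frac d2}$ ($d$ even), $U_{(1)}:=U$, $C_{(k)}:=\frac Nk\langle U_{(k)}\rangle_0$, $U_{(k+1)}:=U(U_{(k)}-C_{(k)})$,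 one puts ${\rm Det}(U):=(-1)^{N+1}C_{(N)}\in\mathbb{C}$. Equivalently, ${\rm Det}(U)=\det(\gamma(U))$ for any isomorphism of unital complex algebras $\gamma:C\ell^{\frac1m}_d\to{\rm Mat}(m^{\frac d2},\mathbb{C})$. *)

theory Defs
  imports "HOL-Analysis.Analysis" "HOL-Algebra.QuotRing"
begin

section \<open>The generalized Clifford algebra\<close>

text \<open>
  The free unital associative complex algebra on generators \<open>1, \<dots>, d\<close>: finitely supported
  complex functions on words over \<open>{1..d}\<close>; the product of words is concatenation, so a word
  \<open>w\<close> is the product of \<open>u\<close> and \<open>v\<close> exactly when \<open>(u, v)\<close> is one of its splittings.
\<close>

definition free_alg :: "nat \<Rightarrow> (nat list \<Rightarrow> complex) ring" where
  "free_alg d =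
    \<lparr>carrier = {f. finite {w. f w \<noteq> 0} \<and> {w. f w \<noteq> 0} \<subseteq> lists {1..d}},
     mult = (\<lambda>f g w. \<Sum>i\<le>length w. f (take i w) * g (drop i w)),
     one = (\<lambda>w. if w = [] then 1 else 0),
     zero = (\<lambda>w. 0),
     add = (\<lambda>f g w. f w + g w)\<rparr>"

definition free_gen :: "nat \<Rightarrow> nat list \<Rightarrow> complex" where
  "free_gen j = (\<lambda>w. if w = [j] then 1 else 0)"

definition free_scalar :: "complex \<Rightarrow> nat list \<Rightarrow> complex" where
  "free_scalar c = (\<lambda>w. if w = [] then c else 0)"

definition root_omega :: "nat \<Rightarrow> complex" where
  "root_omega m = exp (2 * of_real pi * \<i> / of_nat m)"

definition gca_relations :: "nat \<Rightarrow> nat \<Rightarrow> (nat list \<Rightarrow> complex) set" where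
  "gca_relations m d =
     {free_gen j [^]\<^bsub>free_alg d\<^esub> m \<ominus>\<^bsub>free_alg d\<^esub> \<one>\<^bsub>free_alg d\<^esub> | j. j \<in> {1..d}} \<union>
     {(free_gen k \<otimes>\<^bsub>free_alg d\<^esub> free_gen l) \<ominus>\<^bsub>free_alg d\<^esub>
        (free_scalar (root_omega m) \<otimes>\<^bsub>free_alg d\<^esub> (free_gen l \<otimes>\<^bsub>free_alg d\<^esub> free_gen k))
      | k l. k \<in> {1..d} \<and> l \<in> {1..d} \<and> k < l}"

definition gca_ideal :: "nat \<Rightarrow> nat \<Rightarrow> (nat list \<Rightarrow> complex) set" where
  "gca_ideal m d = Idl\<^bsub>free_alg d\<^esub> (gca_relations m d)"

definition gca :: "nat \<Rightarrow> nat \<Rightarrow> (nat list \<Rightarrow> complex) set ring" where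
  "gca m d = free_alg d Quot gca_ideal m d"

definition gca_gen :: "nat \<Rightarrow> nat \<Rightarrow> nat \<Rightarrow> (nat list \<Rightarrow> complex) set" where
  "gca_gen m d j = gca_ideal m d +>\<^bsub>free_alg d\<^esub> free_gen j"

text \<open>
  The element \<open>c e\<close>; scalar multiplication by \<open>c\<close> is multiplication by this (central) element.
\<close>

definition gca_scalar :: "nat \<Rightarrow> nat \<Rightarrow> complex \<Rightarrow> (nat list \<Rightarrow> complex) set" where
  "gca_scalar m d c = gca_ideal m d +>\<^bsub>free_alg d\<^esub> free_scalar c"

definition gca_indices :: "nat \<Rightarrow> nat \<Rightarrow> (nat \<Rightarrow> nat) set" where
  "gca_indices m d = {1..d} \<rightarrow>\<^sub>E {0..m - 1}"

text \<open>The ordered monomial \<open>e\<^sub>1\<^bsup>j 1\<^esup> \<dots> e\<^sub>d\<^bsup>j d\<^esup>\<close>.\<close>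

definition gca_basis :: "nat \<Rightarrow> nat \<Rightarrow> (nat \<Rightarrow> nat) \<Rightarrow> (nat list \<Rightarrow> complex) set" where
  "gca_basis m d j =
     foldr (\<lambda>k x. (gca_gen m d k [^]\<^bsub>gca m d\<^esub> j k) \<otimes>\<^bsub>gca m d\<^esub> x) [1..<d + 1] \<one>\<^bsub>gca m d\<^esub>"

definition gca_coeff :: "nat \<Rightarrow> nat \<Rightarrow> (nat list \<Rightarrow> complex) set \<Rightarrow> (nat \<Rightarrow> nat) \<Rightarrow> complex" where
  "gca_coeff m d U =
     (THE u. u \<in> extensional (gca_indices m d) \<and>
        U = (\<Oplus>\<^bsub>gca m d\<^esub>j\<in>gca_indices m d. gca_scalar m d (u j) \<otimes>\<^bsub>gca m d\<^esub> gca_basis m d j))"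

definition gca_grade0 :: "nat \<Rightarrow> nat \<Rightarrow> (nat list \<Rightarrow> complex) set \<Rightarrow> complex" where
  "gca_grade0 m d U = gca_coeff m d U (\<lambda>k\<in>{1..d}. 0)"

definition gca_conj :: "nat \<Rightarrow> nat \<Rightarrow> (nat list \<Rightarrow> complex) set \<Rightarrow> (nat list \<Rightarrow> complex) set" where
  "gca_conj m d U =
     (\<Oplus>\<^bsub>gca m d\<^esub>j\<in>gca_indices m d.
        gca_scalar m d (cnj (gca_coeff m d U j)) \<otimes>\<^bsub>gca m d\<^esub> inv\<^bsub>gca m d\<^esub> gca_basis m d j)"

text \<open>
  \<open>gca_C m d k V\<close> is \<open>C\<^sub>(\<^sub>k\<^sub>)\<close> when \<open>V = U\<^sub>(\<^sub>k\<^sub>)\<close>. The sequence \<open>U\<^sub>(\<^sub>k\<^sub>)\<close> starts at \<open>k = 1\<close>; its value at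
  \<open>0\<close> is a dummy.
\<close>

definition gca_C :: "nat \<Rightarrow> nat \<Rightarrow> nat \<Rightarrow> (nat list \<Rightarrow> complex) set \<Rightarrow> complex" where
  "gca_C m d k V = of_nat (m ^ (d div 2)) / of_nat k * gca_grade0 m d V"

fun gca_iter :: "nat \<Rightarrow> nat \<Rightarrow> (nat list \<Rightarrow> complex) set \<Rightarrow> nat \<Rightarrow> (nat list \<Rightarrow> complex) set" where
  "gca_iter m d U 0 = \<one>\<^bsub>gca m d\<^esub>"
| "gca_iter m d U (Suc 0) = U"
| "gca_iter m d U (Suc (Suc k)) =
     U \<otimes>\<^bsub>gca m d\<^esub> (gca_iter m d U (Suc k) \<ominus>\<^bsub>gca m d\<^esub>
       gca_scalar m d (gca_C m d (Suc k) (gca_iter m d U (Suc k))))"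

definition gca_Det :: "nat \<Rightarrow> nat \<Rightarrow> (nat list \<Rightarrow> complex) set \<Rightarrow> complex" where
  "gca_Det m d U = (- 1) ^ (m ^ (d div 2) + 1) *
     gca_C m d (m ^ (d div 2)) (gca_iter m d U (m ^ (d div 2)))"

definition SU_gca :: "nat \<Rightarrow> nat \<Rightarrow> (nat list \<Rightarrow> complex) set monoid" where
  "SU_gca m d =
    \<lparr>carrier = {U \<in> carrier (gca m d).
        gca_conj m d U \<otimes>\<^bsub>gca m d\<^esub> U = \<one>\<^bsub>gca m d\<^esub> \<and> gca_Det m d U = 1},
     mult = mult (gca m d),
     one = one (gca m d)\<rparr>"

text \<open>
  The coordinate vector of an element in the monomial basis. The multi-indices are enumerated by a
  finite type, so that the coordinate space is the Euclidean space \<open>complex ^ 'i\<close>.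
\<close>

definition gca_coords ::
  "nat \<Rightarrow> nat \<Rightarrow> ('i::finite \<Rightarrow> nat \<Rightarrow> nat) \<Rightarrow> (nat list \<Rightarrow> complex) set \<Rightarrow> complex ^ 'i" where
  "gca_coords m d idx U = (\<chi> i. gca_coeff m d U (idx i))"


section \<open>The special unitary group\<close>

definition SU_matrices :: "(complex ^ 'n ^ 'n) monoid" where
  "SU_matrices =
    \<lparr>carrier = {A. map_matrix cnj (transpose A) ** A = mat 1 \<and> det A = 1},
     mult = (**),
     one = mat 1\<rparr>"


section \<open>Lie groups embedded in Euclidean spaces\<close>

text \<open>The derivatives are those of the ambient space, so \<open>S\<close> is meant to be open.\<close>

primrec Ck_on ::
  "nat \<Rightarrow> 'a::euclidean_space set \<Rightarrow> ('a \<Rightarrow> 'b::euclidean_space) \<Rightarrow> bool" where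
  "Ck_on 0 S f \<longleftrightarrow> continuous_on S f"
| "Ck_on (Suc k) S f \<longleftrightarrow>
     (\<forall>x\<in>S. f differentiable (at x)) \<and> (\<forall>v. Ck_on k S (\<lambda>x. frechet_derivative f (at x) v))"

definition smooth_on_open ::
  "'a::euclidean_space set \<Rightarrow> ('a \<Rightarrow> 'b::euclidean_space) \<Rightarrow> bool" where
  "smooth_on_open S f \<longleftrightarrow> (\<forall>k. Ck_on k S f)"

text \<open>
  Smoothness on an arbitrary subset: local extendability to smooth maps of the ambient space. On
  an embedded submanifold this is smoothness in the sense of charts.
\<close>

definition smooth_map_on ::
  "'a::euclidean_space set \<Rightarrow> ('a \<Rightarrow> 'b::euclidean_space) \<Rightarrow> bool" where
  "smooth_map_on S f \<longleftrightarrow>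
     (\<forall>x\<in>S. \<exists>U F. open U \<and> x \<in> U \<and> smooth_on_open U F \<and> (\<forall>y\<in>S \<inter> U. F y = f y))"

definition embedded_submanifold :: "nat \<Rightarrow> 'a::euclidean_space set \<Rightarrow> bool" where
  "embedded_submanifold k S \<longleftrightarrow>
     (\<forall>x\<in>S. \<exists>U V W h g. open U \<and> x \<in> U \<and> open (V :: 'a set) \<and>
        homeomorphism U V h g \<and> smooth_on_open U h \<and> smooth_on_open V g \<and>
        subspace W \<and> dim W = k \<and> h ` (S \<inter> U) = V \<inter> W)"

text \<open>
  A group \<open>G\<close> together with an injection \<open>\<psi>\<close> of its carrier into a Euclidean space is a Lie group
  if the image is an embedded submanifold and the group operations, read through \<open>\<psi>\<close>, are
  smooth; the manifold structure of \<open>G\<close> is the one making \<open>\<psi>\<close> a diffeomorphism onto its image.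
\<close>

definition lie_group :: "'g monoid \<Rightarrow> ('g \<Rightarrow> 'v::euclidean_space) \<Rightarrow> bool" where
  "lie_group G \<psi> \<longleftrightarrow>
     group G \<and> inj_on \<psi> (carrier G) \<and>
     (\<exists>k. embedded_submanifold k (\<psi> ` carrier G)) \<and>
     smooth_map_on (\<psi> ` carrier G \<times> \<psi> ` carrier G)
       (\<lambda>(x, y). \<psi> (inv_into (carrier G) \<psi> x \<otimes>\<^bsub>G\<^esub> inv_into (carrier G) \<psi> y)) \<and>
     smooth_map_on (\<psi> ` carrier G) (\<lambda>x. \<psi> (inv\<^bsub>G\<^esub> (inv_into (carrier G) \<psi> x)))"

definition lie_group_iso ::
  "'g monoid \<Rightarrow> ('g \<Rightarrow> 'v::euclidean_space) \<Rightarrow> 'h monoid \<Rightarrow> ('h \<Rightarrow> 'w::euclidean_space)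
    \<Rightarrow> ('g \<Rightarrow> 'h) \<Rightarrow> bool" where
  "lie_group_iso G \<psi> H \<theta> \<phi> \<longleftrightarrow>
     lie_group G \<psi> \<and> lie_group H \<theta> \<and> \<phi> \<in> iso G H \<and>
     smooth_map_on (\<psi> ` carrier G) (\<lambda>x. \<theta> (\<phi> (inv_into (carrier G) \<psi> x))) \<and>
     smooth_map_on (\<theta> ` carrier H)
       (\<lambda>y. \<psi> (inv_into (carrier G) \<phi> (inv_into (carrier H) \<theta> y)))"

definition lie_isomorphic ::
  "'g monoid \<Rightarrow> ('g \<Rightarrow> 'v::euclidean_space) \<Rightarrow> 'h monoid \<Rightarrow> ('h \<Rightarrow> 'w::euclidean_space) \<Rightarrow> bool" where
  "lie_isomorphic G \<psi> H \<theta> \<longleftrightarrow> (\<exists>\<phi>. lie_group_iso G \<psi> H \<theta> \<phi>)"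

end

theory Submission
  imports Defs "HOL-Computational_Algebra.Formal_Power_Series"
begin

text \<open>
  Clock-and-shift matrices satisfy the Clifford relations and are unitary; this gives a homomorphism
  from the algebra to matrices of size \<open>m\<^bsup>d/2\<^esup>\<close>. Reordering words shows that the \<open>m\<^sup>d\<close> ordered monomials span
  the algebra. Each generator commutes with each monomial up to a root of unity, and for even \<open>d\<close> these
  roots determine the monomial, so the images of the monomials are orthogonal for the trace form and,
  by dimension, the homomorphism is bijective. It turns Hermitian conjugation into the conjugate
  transpose, \<open>\<langle>U\<rangle>\<^sub>0\<close> into the normalised trace and hence the recursion for the determinant into the
  Faddeev--LeVerrier algorithm. So it restricts to a group isomorphism onto the special unitary group
  that is linear in coordinates, and the Lie structure can be transported. Charts of the special
  unitary group come from the Cayley transform: for skew-Hermitian \<open>X\<close> the transform has determinant 1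
  iff \<open>det (1 + X)\<close> is real, an equation that is affine in any one diagonal entry and can therefore be
  solved explicitly.
\<close>

section \<open>Calculus of smooth maps\<close>

text \<open>Two obstacles shape the proof. The algebra is a quotient that might a priori collapse,
  and its coefficients are given by a definite description, so nothing can be said about
  \<open>gca_coeff\<close> before the monomials are known to be independent. Independence is reached
  only through the matrices: the trace form reads the coefficients of a combination off its image,
  which yields uniqueness of coefficients and injectivity at once. Evenness of d is essential here:
  for odd d the monomial with exponents 1, m - 1, 1, ..., 1 is central, so commutation factors
  cannot separate it from the identity. On the other side, charts must be smooth together with their
  inverses in the ambient space. An explicit chart that is rational in the real and imaginary parts
  of the entries avoids the implicit function theorem and the exponential map; its smoothness
  reduces to sums, products and quotients. The determinant condition would spoil such a chart for
  the whole unitary group, were it not affine in a single real unknown after the Cayley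
  transform.\<close>

lemma Ck_on_cong:
  fixes f g :: "'a::euclidean_space \<Rightarrow> 'b::euclidean_space"
  assumes "open S" "\<And>x. x \<in> S \<Longrightarrow> f x = g x" "Ck_on k S f"
  shows "Ck_on k S g"
  using assms(2,3)
proof (induction k arbitrary: f g)
  case 0
  then show ?case by (simp cong: continuous_on_cong)
next
  case (Suc k)
  have *: "(g has_derivative frechet_derivative f (at x)) (at x)" if "x \<in> S" for x
    using Suc.prems that assms(1)
    by (auto intro: has_derivative_transform_within_open[of f _ x UNIV S g] simp: frechet_derivative_works[symmetric])
  then have "frechet_derivative f (at x) = frechet_derivative g (at x)" if "x \<in> S" for x
    using that by (simp add: frechet_derivative_at)
  with * Suc show ?case
    by (auto simp: differentiable_def)
      (metis (no_types, lifting))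
qed

text \<open>\<open>Ck_on\<close> speaks of \<open>frechet_derivative\<close>; by uniqueness of
  derivatives any explicit derivative may be supplied instead, which is how the closure rules below
  are proved.\<close>

lemma Ck_on_SucI:
  fixes f :: "'a::euclidean_space \<Rightarrow> 'b::euclidean_space"
  assumes "open S" "\<And>x. x \<in> S \<Longrightarrow> (f has_derivative f' x) (at x)"
    and "\<And>v. Ck_on k S (\<lambda>x. f' x v)"
  shows "Ck_on (Suc k) S f"
proof -
  have "frechet_derivative f (at x) = f' x" if "x \<in> S" for x
    using frechet_derivative_at[OF assms(2)[OF that]] by simp
  then have "Ck_on k S (\<lambda>x. frechet_derivative f (at x) v)" for v
    using Ck_on_cong[OF assms(1) _ assms(3)[of v]] by simp
  with assms(2) show ?thesis by (auto simp: differentiable_def)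
qed

lemma Ck_on_SucD:
  assumes "Ck_on (Suc k) S f"
  shows "x \<in> S \<Longrightarrow> (f has_derivative frechet_derivative f (at x)) (at x)"
    "Ck_on k S (\<lambda>x. frechet_derivative f (at x) v)"
  using assms by (auto simp: frechet_derivative_works[symmetric])

text \<open>The product and chain rules combine a derivative of class k with the original function
  of class k + 1, which must therefore be downgraded.\<close>

lemma Ck_on_pred: "Ck_on (Suc k) S f \<Longrightarrow> Ck_on k S f"
proof (induction k arbitrary: f)
  case 0
  then show ?case
    by (auto intro!: differentiable_imp_continuous_on simp: differentiable_on_def differentiable_at_withinI)
next
  case (Suc k)
  show ?case unfolding Ck_on.simps(2)[of k]
  proof (intro conjI ballI allI)
    fix x assume "x \<in> S"
    with Suc.prems show "f differentiable at x" by simp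
  next
    fix v
    show "Ck_on k S (\<lambda>x. frechet_derivative f (at x) v)"
      using Ck_on_SucD(2)[OF Suc.prems] by (rule Suc.IH)
  qed
qed

lemma Ck_on_subset: "Ck_on k S f \<Longrightarrow> T \<subseteq> S \<Longrightarrow> Ck_on k T f"
  by (induction k arbitrary: f) (auto intro: continuous_on_subset)

lemma Ck_on_const: "open S \<Longrightarrow> Ck_on k S (\<lambda>x. c)"
proof (induction k arbitrary: c)
  case (Suc k)
  show ?case by (rule Ck_on_SucI[where f' = "\<lambda>x v. 0"]) (use Suc in auto)
qed simp

lemma Ck_on_bounded_linear:
  assumes "open S" "bounded_linear f"
  shows "Ck_on k S f"
proof (cases k)
  case 0
  then show ?thesis using assms by (simp add: linear_continuous_on)
next
  case (Suc j)
  show ?thesis unfolding Suc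
    by (rule Ck_on_SucI[where f' = "\<lambda>x. f"])
      (use assms in \<open>auto intro: bounded_linear_imp_has_derivative Ck_on_const\<close>)
qed

lemma Ck_on_add:
  assumes "open S"
  shows "Ck_on k S f \<Longrightarrow> Ck_on k S g \<Longrightarrow> Ck_on k S (\<lambda>x. f x + g x)"
proof (induction k arbitrary: f g)
  case 0
  then show ?case by (simp add: continuous_on_add)
next
  case (Suc k)
  show ?case
    by (rule Ck_on_SucI[OF assms has_derivative_add[OF Ck_on_SucD(1) Ck_on_SucD(1)]])
      (use Suc.prems in \<open>auto simp del: Ck_on.simps intro!: Suc.IH intro: Ck_on_SucD(2)\<close>)
qed

lemma Ck_on_bilinear:
  assumes "open S" "bounded_bilinear B"
  shows "Ck_on k S f \<Longrightarrow> Ck_on k S g \<Longrightarrow> Ck_on k S (\<lambda>x. B (f x) (g x))"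
proof (induction k arbitrary: f g)
  case 0
  then show ?case using assms by (simp add: bounded_bilinear.continuous_on)
next
  case (Suc k)
  show ?case
    by (rule Ck_on_SucI[OF assms(1) bounded_bilinear.FDERIV[OF assms(2) Ck_on_SucD(1) Ck_on_SucD(1)]])
      (use Suc.prems in \<open>auto simp del: Ck_on.simps intro!: Suc.IH Ck_on_add[OF assms(1)]
          intro: Ck_on_SucD(2) Ck_on_pred\<close>)
qed

lemma Ck_on_sum:
  assumes "open S" "\<And>i. i \<in> I \<Longrightarrow> Ck_on k S (f i)"
  shows "Ck_on k S (\<lambda>x. \<Sum>i\<in>I. f i x)"
  using assms(2)
proof (induction I rule: infinite_finite_induct)
  case (insert i I)
  then show ?case by (simp add: Ck_on_add[OF assms(1)])
qed (auto intro: Ck_on_const assms)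

text \<open>\<open>Ck_on\<close> controls the derivative of f only in fixed directions, while the
  chain rule evaluates it in the moving direction Dg(x) v. Expanding that direction in the standard
  basis leaves a finite sum of products to which the induction hypothesis and the product rule
  apply.\<close>

lemma Ck_on_compose:
  fixes f :: "'b::euclidean_space \<Rightarrow> 'c::euclidean_space" and g :: "'a::euclidean_space \<Rightarrow> 'b"
  assumes "open S" "open T" "\<And>x. x \<in> S \<Longrightarrow> g x \<in> T"
  shows "Ck_on k T f \<Longrightarrow> Ck_on k S g \<Longrightarrow> Ck_on k S (\<lambda>x. f (g x))"
proof (induction k arbitrary: f)
  case 0
  then show ?case using assms by (auto intro: continuous_on_compose2)
next
  case (Suc k)
  let ?Df = "\<lambda>x. frechet_derivative f (at x)" and ?Dg = "\<lambda>x. frechet_derivative g (at x)"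
  show ?case
  proof (rule Ck_on_SucI[OF assms(1)])
    fix x assume "x \<in> S"
    then show "((\<lambda>x. f (g x)) has_derivative (\<lambda>v. \<Sum>b\<in>Basis. (?Dg x v \<bullet> b) *\<^sub>R ?Df (g x) b)) (at x)"
    proof -
      have f: "(f has_derivative ?Df (g x)) (at (g x))"
        using Ck_on_SucD(1)[OF Suc.prems(1)] assms(3) \<open>x \<in> S\<close> by blast
      have "linear (?Df (g x))" using f by (simp add: has_derivative_linear)
      then have "(\<Sum>b\<in>Basis. (?Dg x v \<bullet> b) *\<^sub>R ?Df (g x) b) = ?Df (g x) (?Dg x v)" for v
        by (subst (4) euclidean_representation[symmetric]) (simp add: linear_sum linear_scale)
      with has_derivative_compose[OF Ck_on_SucD(1)[OF Suc.prems(2) \<open>x \<in> S\<close>] f]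
      show ?thesis by simp
    qed
  next
    fix v
    show "Ck_on k S (\<lambda>x. \<Sum>b\<in>Basis. (?Dg x v \<bullet> b) *\<^sub>R ?Df (g x) b)"
    proof (rule Ck_on_sum[OF assms(1)], rule Ck_on_bilinear[OF assms(1) bounded_bilinear_scaleR])
      fix b :: 'b
      show "Ck_on k S (\<lambda>x. ?Dg x v \<bullet> b)"
        by (rule Ck_on_bilinear[OF assms(1) bounded_bilinear_inner Ck_on_SucD(2)[OF Suc.prems(2)] Ck_on_const[OF assms(1)]])
      show "Ck_on k S (\<lambda>x. ?Df (g x) b)"
        by (rule Suc.IH[OF Ck_on_SucD(2)[OF Suc.prems(1)] Ck_on_pred[OF Suc.prems(2)]])
    qed
  qed
qed

text \<open>The derivative of inversion is again built from inversion and products, so the induction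
  on k closes on itself.\<close>

lemma Ck_on_inverse: "Ck_on k (- {0 :: complex}) inverse"
proof (induction k)
  case 0
  show ?case by (auto intro!: continuous_intros)
next
  case (Suc k)
  have o: "open (- {0 :: complex})" by (simp add: open_Compl)
  show ?case
    by (rule Ck_on_SucI[OF o has_derivative_inverse'])
      (auto intro!: Suc Ck_on_const Ck_on_bilinear[OF o bounded_bilinear_mult]
        Ck_on_compose[OF o open_UNIV _ Ck_on_bounded_linear[OF open_UNIV bounded_linear_minus[OF bounded_linear_ident]]])
qed

lemma smooth_on_open_cong:
  "\<lbrakk>open S; \<And>x. x \<in> S \<Longrightarrow> f x = g x; smooth_on_open S f\<rbrakk> \<Longrightarrow> smooth_on_open S g"
  unfolding smooth_on_open_def using Ck_on_cong by blast

lemma smooth_on_open_subset: "smooth_on_open S f \<Longrightarrow> T \<subseteq> S \<Longrightarrow> smooth_on_open T f"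
  unfolding smooth_on_open_def using Ck_on_subset by blast

lemma smooth_on_open_continuous_on: "smooth_on_open S f \<Longrightarrow> continuous_on S f"
  unfolding smooth_on_open_def using Ck_on.simps(1) by blast

lemma smooth_on_open_const: "open S \<Longrightarrow> smooth_on_open S (\<lambda>x. c)"
  by (simp add: smooth_on_open_def Ck_on_const)

lemma smooth_on_open_linear: "open S \<Longrightarrow> linear f \<Longrightarrow> smooth_on_open S f"
  by (simp add: smooth_on_open_def Ck_on_bounded_linear linear_conv_bounded_linear)

lemma smooth_on_open_ident: "open S \<Longrightarrow> smooth_on_open S (\<lambda>x. x)"
  by (simp add: smooth_on_open_linear linear_iff)

lemma smooth_on_open_add:
  "\<lbrakk>open S; smooth_on_open S f; smooth_on_open S g\<rbrakk> \<Longrightarrow> smooth_on_open S (\<lambda>x. f x + g x)"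
  by (simp add: smooth_on_open_def Ck_on_add)

lemma smooth_on_open_bilinear:
  "\<lbrakk>open S; bounded_bilinear B; smooth_on_open S f; smooth_on_open S g\<rbrakk>
    \<Longrightarrow> smooth_on_open S (\<lambda>x. B (f x) (g x))"
  by (simp add: smooth_on_open_def Ck_on_bilinear)

lemma smooth_on_open_sum:
  "\<lbrakk>open S; \<And>i. i \<in> I \<Longrightarrow> smooth_on_open S (f i)\<rbrakk> \<Longrightarrow> smooth_on_open S (\<lambda>x. \<Sum>i\<in>I. f i x)"
  by (simp add: smooth_on_open_def Ck_on_sum)

lemma smooth_on_open_compose:
  "\<lbrakk>open S; open T; \<And>x. x \<in> S \<Longrightarrow> g x \<in> T; smooth_on_open T f; smooth_on_open S g\<rbrakk>
    \<Longrightarrow> smooth_on_open S (\<lambda>x. f (g x))"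
  unfolding smooth_on_open_def using Ck_on_compose by blast

lemma smooth_on_open_linear_compose:
  "\<lbrakk>open S; linear L; smooth_on_open S g\<rbrakk> \<Longrightarrow> smooth_on_open S (\<lambda>x. L (g x))"
  using smooth_on_open_compose[OF _ open_UNIV _ smooth_on_open_linear[OF open_UNIV]] by blast

lemma smooth_on_open_diff:
  fixes f g :: "'a::euclidean_space \<Rightarrow> 'b::euclidean_space"
  assumes "open S" "smooth_on_open S f" "smooth_on_open S g"
  shows "smooth_on_open S (\<lambda>x. f x - g x)"
  using smooth_on_open_add[OF assms(1,2)
      smooth_on_open_linear_compose[OF assms(1) bounded_linear.linear[OF bounded_linear_minus[OF bounded_linear_ident]] assms(3)]]
  by simp

lemma smooth_on_open_mult:
  fixes f g :: "'a::euclidean_space \<Rightarrow> complex"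
  shows "\<lbrakk>open S; smooth_on_open S f; smooth_on_open S g\<rbrakk> \<Longrightarrow> smooth_on_open S (\<lambda>x. f x * g x)"
  by (rule smooth_on_open_bilinear[OF _ bounded_bilinear_mult])

lemma smooth_on_open_prod:
  fixes f :: "'i \<Rightarrow> 'a::euclidean_space \<Rightarrow> complex"
  assumes "open S" "\<And>i. i \<in> I \<Longrightarrow> smooth_on_open S (f i)"
  shows "smooth_on_open S (\<lambda>x. \<Prod>i\<in>I. f i x)"
  using assms(2)
  by (induction I rule: infinite_finite_induct)
    (auto simp: assms(1) smooth_on_open_const smooth_on_open_mult)

lemma smooth_on_open_divide:
  fixes f g :: "'a::euclidean_space \<Rightarrow> complex"
  assumes "open S" "smooth_on_open S f" "smooth_on_open S g" "\<And>x. x \<in> S \<Longrightarrow> g x \<noteq> 0"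
  shows "smooth_on_open S (\<lambda>x. f x / g x)"
proof -
  have "smooth_on_open S (\<lambda>x. inverse (g x))"
    by (rule smooth_on_open_compose[OF assms(1), of "- {0}"])
      (use assms Ck_on_inverse in \<open>auto simp: smooth_on_open_def\<close>)
  from smooth_on_open_mult[OF assms(1,2) this] show ?thesis by (simp add: divide_inverse)
qed

lemma linear_axis: "linear (axis i :: 'b::euclidean_space \<Rightarrow> 'b ^ 'n::finite)"
  by (rule linearI) (auto simp: vec_eq_iff axis_def)

lemma smooth_on_open_vec:
  fixes f :: "'n::finite \<Rightarrow> 'a::euclidean_space \<Rightarrow> 'b::euclidean_space"
  assumes "open S" "\<And>i. smooth_on_open S (f i)"
  shows "smooth_on_open S (\<lambda>x. \<chi> i. f i x)"
proof -
  have "(\<lambda>x. \<chi> i. f i x) = (\<lambda>x. \<Sum>i\<in>UNIV. axis i (f i x))"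
    by (auto simp: vec_eq_iff axis_def sum.delta if_distrib if_distribR cong: if_cong)
  then show ?thesis
    using assms by (simp add: smooth_on_open_sum smooth_on_open_linear_compose linear_axis)
qed

lemma smooth_on_open_nth:
  fixes f :: "'a::euclidean_space \<Rightarrow> 'b::euclidean_space ^ 'n::finite"
  shows "\<lbrakk>open S; smooth_on_open S f\<rbrakk> \<Longrightarrow> smooth_on_open S (\<lambda>x. f x $ i)"
  by (rule smooth_on_open_linear_compose[OF _ bounded_linear.linear[OF bounded_linear_vec_nth]])

lemma smooth_on_open_matrix_mult:
  fixes f :: "'a::euclidean_space \<Rightarrow> complex ^ 'n::finite ^ 'm::finite"
    and g :: "'a::euclidean_space \<Rightarrow> complex ^ 'k::finite ^ 'n::finite"
  assumes "open S" "smooth_on_open S f" "smooth_on_open S g"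
  shows "smooth_on_open S (\<lambda>x. f x ** g x)"
  unfolding matrix_matrix_mult_def
  by (intro smooth_on_open_vec smooth_on_open_sum smooth_on_open_mult smooth_on_open_nth assms)

lemma smooth_on_open_det:
  fixes f :: "'a::euclidean_space \<Rightarrow> complex ^ 'n::finite ^ 'n"
  assumes "open S" "smooth_on_open S f"
  shows "smooth_on_open S (\<lambda>x. det (f x))"
  unfolding det_def
  by (intro smooth_on_open_sum smooth_on_open_mult smooth_on_open_prod smooth_on_open_nth smooth_on_open_const assms)

section \<open>Smooth dependence of the inverse matrix on its entries\<close>

lemma matrix_inv_left_right:
  fixes A :: "'a::field ^ 'n ^ 'n"
  assumes "det A \<noteq> 0"
  shows "A ** matrix_inv A = mat 1" "matrix_inv A ** A = mat 1"
proof -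
  have "\<exists>B. A ** B = mat 1 \<and> B ** A = mat 1"
    using assms by (simp add: invertible_det_nz[symmetric] invertible_def)
  then have "A ** matrix_inv A = mat 1 \<and> matrix_inv A ** A = mat 1"
    unfolding matrix_inv_def by (rule someI_ex)
  then show "A ** matrix_inv A = mat 1" "matrix_inv A ** A = mat 1" by simp_all
qed

text \<open>Cramer's rule, applied to each column of the equation A B = 1, exhibits the entries of
  the inverse as quotients of determinants; smoothness of inversion is read off from this
  form.\<close>

lemma matrix_inv_eq_cofactors:
  fixes A :: "'a::field ^ 'n::finite ^ 'n"
  assumes "det A \<noteq> 0"
  shows "matrix_inv A = (\<chi> k l. det (\<chi> i j. if j = k then (if i = l then 1 else 0) else A$i$j) / det A)"
proof -
  note inv = matrix_inv_left_right(1)[OF assms]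
  have "A *v column l (matrix_inv A) = (\<chi> i. if i = l then 1 else 0)" for l
    using arg_cong[OF inv, of "column l"]
    by (simp add: vec_eq_iff column_def matrix_vector_mult_def matrix_matrix_mult_def mat_def)
  then have "column l (matrix_inv A) = (\<chi> k. det (\<chi> i j. if j = k then (if i = l then 1 else 0) else A$i$j) / det A)" for l
    using cramer[OF assms] by (simp cong: if_cong)
  then show ?thesis by (simp add: vec_eq_iff column_def)
qed

lemma smooth_on_open_matrix_inv:
  fixes f :: "'a::euclidean_space \<Rightarrow> complex ^ 'n::finite ^ 'n"
  assumes "open S" "smooth_on_open S f" "\<And>x. x \<in> S \<Longrightarrow> det (f x) \<noteq> 0"
  shows "smooth_on_open S (\<lambda>x. matrix_inv (f x))"
proof (rule smooth_on_open_cong[OF assms(1)])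
  show "(\<chi> k l. det (\<chi> i j. if j = k then (if i = l then 1 else 0) else f x$i$j) / det (f x)) = matrix_inv (f x)"
    if "x \<in> S" for x
    using assms(3)[OF that] by (simp add: matrix_inv_eq_cofactors)
  have "smooth_on_open S (\<lambda>x. if j = k then (if i = l then 1 else 0) else f x$i$j)" for i j k l
    using smooth_on_open_nth[OF assms(1) smooth_on_open_nth[OF assms(1,2)], of i j] smooth_on_open_const[OF assms(1)]
    by (cases "j = k"; cases "i = l") simp_all
  then show "smooth_on_open S (\<lambda>x. (\<chi> k l. det (\<chi> i j. if j = k then (if i = l then 1 else 0) else f x$i$j) / det (f x)))"
    by (intro smooth_on_open_vec smooth_on_open_divide smooth_on_open_det assms) auto
qed

section \<open>The Cayley transform\<close>

definition conj_transpose :: "complex ^ 'n ^ 'm \<Rightarrow> complex ^ 'm ^ 'n" where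
  "conj_transpose A = map_matrix cnj (transpose A)"

lemma conj_transpose_nth [simp]: "conj_transpose A $ i $ j = cnj (A $ j $ i)"
  by (simp add: conj_transpose_def transpose_def)

lemma conj_transpose_mult: "conj_transpose (A ** B) = conj_transpose B ** conj_transpose A"
  by (simp add: vec_eq_iff matrix_matrix_mult_def mult.commute)

lemma conj_transpose_mat [simp]: "conj_transpose (mat c) = mat (cnj c)"
  by (auto simp: vec_eq_iff mat_def)

lemma conj_transpose_add: "conj_transpose (A + B) = conj_transpose A + conj_transpose B"
  by (simp add: vec_eq_iff)

lemma conj_transpose_conj_transpose [simp]: "conj_transpose (conj_transpose A) = A"
  by (simp add: vec_eq_iff)

lemma linear_conj_transpose: "linear conj_transpose"
  by (rule linearI) (simp_all add: vec_eq_iff)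

lemma det_conj_transpose:
  fixes A :: "complex ^ 'n ^ 'n"
  shows "det (conj_transpose A) = cnj (det A)"
proof -
  have "det (map_matrix cnj B) = cnj (det B)" for B :: "complex ^ 'n ^ 'n"
    by (simp add: det_def)
  then show ?thesis by (simp add: conj_transpose_def)
qed

lemma mat_nth: "mat c $ i $ j = (if i = j then c else 0)"
  by (simp add: mat_def)

lemma mat_mult_nth: "(mat c ** A) $ i $ j = c * A $ i $ j"
  by (simp add: matrix_matrix_mult_def mat_def if_distrib if_distribR cong: if_cong)

lemma mult_mat_nth: "(A ** mat c) $ i $ j = A $ i $ j * c"
  by (simp add: matrix_matrix_mult_def mat_def if_distrib if_distribR cong: if_cong)

lemma mat_mult_commute:
  fixes A :: "'a::comm_semiring_1 ^ 'n ^ 'm"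
  shows "A ** mat c = mat c ** A"
  by (simp add: vec_eq_iff mat_mult_nth mult_mat_nth ac_simps)

lemma det_mat: "det (mat c :: 'a::comm_ring_1 ^ 'n ^ 'n) = c ^ CARD('n)"
  by (subst det_diagonal) (simp_all add: mat_def)

lemma matrix_add_rdistrib: "(A + B) ** C = A ** C + B ** (C :: 'a::semiring_1 ^ 'n ^ 'm)"
  by (simp add: vec_eq_iff matrix_matrix_mult_def sum.distrib distrib_right)

lemma matrix_diff_ldistrib: "A ** (B - C) = A ** B - A ** (C :: 'a::ring_1 ^ 'n ^ 'm)"
  by (simp add: vec_eq_iff matrix_matrix_mult_def sum_subtractf right_diff_distrib)

lemma matrix_diff_rdistrib: "(A - B) ** C = A ** C - B ** (C :: 'a::ring_1 ^ 'n ^ 'm)"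
  by (simp add: vec_eq_iff matrix_matrix_mult_def sum_subtractf left_diff_distrib)

text \<open>This is (1 - A)(1 + A)^(-1), written so that X = \<open>cayley A\<close> becomes (1 +
  X)(1 + A) = 2. Exchanging A and X only swaps the factors, which makes the transform an
  involution.\<close>

definition cayley :: "complex ^ 'n ^ 'n \<Rightarrow> complex ^ 'n ^ 'n" where
  "cayley A = mat 2 ** matrix_inv (mat 1 + A) - mat 1"

text \<open>Since det 2 is nonzero, the product equation already contains the invertibility of 1 +
  A. The lemmas below take this equation as their hypothesis in place of inverses.\<close>

lemma cayley_iff:
  fixes A X :: "complex ^ 'n ^ 'n"
  shows "det (mat 1 + A) \<noteq> 0 \<and> cayley A = X \<longleftrightarrow> (mat 1 + X) ** (mat 1 + A) = mat 2"
proof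
  assume "det (mat 1 + A) \<noteq> 0 \<and> cayley A = X"
  then have nz: "det (mat 1 + A) \<noteq> 0" and X: "mat 1 + X = mat 2 ** matrix_inv (mat 1 + A)"
    by (auto simp: cayley_def)
  show "(mat 1 + X) ** (mat 1 + A) = mat 2"
    unfolding X matrix_mul_assoc[symmetric] by (simp add: matrix_inv_left_right[OF nz])
next
  assume eq: "(mat 1 + X) ** (mat 1 + A) = mat 2"
  have nz: "det (mat 1 + A) \<noteq> 0"
    using arg_cong[OF eq, of det] by (auto simp: det_mul det_mat)
  have "mat 1 + X = mat 2 ** matrix_inv (mat 1 + A)"
    using arg_cong[OF eq, of "\<lambda>M. M ** matrix_inv (mat 1 + A)"]
    by (simp add: matrix_mul_assoc[symmetric] matrix_inv_left_right[OF nz])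
  then show "det (mat 1 + A) \<noteq> 0 \<and> cayley A = X"
    using nz by (simp add: cayley_def algebra_simps)
qed

text \<open>After scaling by 1/2, a left inverse of a square matrix is also a right inverse.\<close>

lemma cayley_sym:
  fixes A X :: "complex ^ 'n ^ 'n"
  assumes "(mat 1 + X) ** (mat 1 + A) = mat 2"
  shows "(mat 1 + A) ** (mat 1 + X) = mat 2"
proof -
  have half: "mat (1/2) ** (mat 2 :: complex ^ 'n ^ 'n) = mat 1"
    by (auto simp: vec_eq_iff mat_mult_nth mat_nth)
  have "(mat (1/2) ** (mat 1 + X)) ** (mat 1 + A) = mat 1"
    unfolding matrix_mul_assoc[symmetric] assms half ..
  then have "(mat 1 + A) ** (mat (1/2) ** (mat 1 + X)) = mat 1"
    by (simp add: matrix_left_right_inverse)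
  then have "mat 2 ** (mat (1/2) ** ((mat 1 + A) ** (mat 1 + X))) = mat 2"
    unfolding matrix_mul_assoc mat_mult_commute[of "mat 1 + A"] by (simp flip: matrix_mul_assoc)
  moreover have "mat 2 ** (mat (1/2) ** B) = B" for B :: "complex ^ 'n ^ 'n"
    by (simp add: vec_eq_iff mat_mult_nth)
  ultimately show ?thesis by simp
qed

lemma cayley_det_nz: "det (mat 1 + A) \<noteq> 0 \<Longrightarrow> det (mat 1 + cayley A) \<noteq> 0"
  and cayley_cayley: "det (mat 1 + A) \<noteq> 0 \<Longrightarrow> cayley (cayley A) = A"
proof -
  assume "det (mat 1 + A) \<noteq> 0"
  then have "(mat 1 + cayley A) ** (mat 1 + A) = mat 2"
    using cayley_iff[of A "cayley A"] by simp
  from cayley_sym[OF this] show "det (mat 1 + cayley A) \<noteq> 0" "cayley (cayley A) = A"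
    using cayley_iff[of "cayley A" A] by simp_all
qed

lemma smooth_on_open_cayley:
  fixes f :: "'a::euclidean_space \<Rightarrow> complex ^ 'n ^ 'n"
  assumes "open S" "smooth_on_open S f" "\<And>x. x \<in> S \<Longrightarrow> det (mat 1 + f x) \<noteq> 0"
  shows "smooth_on_open S (\<lambda>x. cayley (f x))"
proof -
  note const = smooth_on_open_const[OF assms(1)]
  have "smooth_on_open S (\<lambda>x. matrix_inv (mat 1 + f x))"
    by (rule smooth_on_open_matrix_inv[OF assms(1) smooth_on_open_add[OF assms(1) const assms(2)] assms(3)])
  then show ?thesis
    unfolding cayley_def
    by (rule smooth_on_open_diff[OF assms(1) smooth_on_open_matrix_mult[OF assms(1) const] const])
qed

context
  fixes A X :: "complex ^ 'n ^ 'n"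
  assumes AX: "(mat 1 + X) ** (mat 1 + A) = mat 2"
begin

text \<open>Substitute 1 - X = 2 - (1 + X). Together with \<open>AX\<close> this is A = (1 - X)(1 +
  X)^(-1) with the inverse cleared.\<close>

lemma cayley_diff_mult: "(mat 1 - X) ** (mat 1 + A) = mat 2 ** A"
proof -
  have "(mat 1 - X) ** (mat 1 + A) = (mat 2 - (mat 1 + X)) ** (mat 1 + A)"
    by (rule arg_cong[of _ _ "\<lambda>M. M ** (mat 1 + A)"]) (auto simp: vec_eq_iff mat_def)
  also have "\<dots> = mat 2 ** A"
    by (simp only: matrix_diff_rdistrib AX) (simp add: matrix_add_ldistrib)
  finally show ?thesis .
qed

lemma cayley_cancel_right: "B ** (mat 1 + A) = C ** (mat 1 + A) \<Longrightarrow> B = C"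
proof -
  assume *: "B ** (mat 1 + A) = C ** (mat 1 + A)"
  have "det (mat 1 + A) \<noteq> 0" using AX by (simp add: cayley_iff[symmetric])
  from arg_cong[OF *, of "\<lambda>M. M ** matrix_inv (mat 1 + A)"] matrix_inv_left_right(1)[OF this]
  show ?thesis by (simp add: matrix_mul_assoc[symmetric])
qed

text \<open>Multiplying (1 + A^H)(1 - X) on the right by 1 + A gives 2(A + A^H A), which equals 2(1
  + A) exactly when A is unitary. Cancelling 1 + A and comparing with the adjoint (1 + A^H)(1 + X^H)
  = 2 of \<open>AX\<close> leaves X^H = -X.\<close>

lemma cayley_skew_iff: "conj_transpose A ** A = mat 1 \<longleftrightarrow> conj_transpose X = - X"
proof -
  have H: "(mat 1 + conj_transpose A) ** (mat 1 + conj_transpose X) = mat 2"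
    using arg_cong[OF AX, of conj_transpose] by (simp add: conj_transpose_mult conj_transpose_add)
  have *: "(mat 1 + conj_transpose A) ** (mat 1 - X) ** (mat 1 + A) = mat 2 ** (A + conj_transpose A ** A)"
  proof -
    have "conj_transpose A ** (mat 2 ** A) = mat 2 ** (conj_transpose A ** A)"
      unfolding matrix_mul_assoc mat_mult_commute[of "conj_transpose A"] ..
    then show ?thesis
      unfolding matrix_mul_assoc[symmetric] cayley_diff_mult
      by (simp add: matrix_add_rdistrib matrix_add_ldistrib)
  qed
  have cancel: "mat 2 ** B = mat 2 ** C \<longleftrightarrow> B = C" for B C :: "complex ^ 'n ^ 'n"
    by (simp add: vec_eq_iff mat_mult_nth)
  have "conj_transpose A ** A = mat 1
      \<longleftrightarrow> (mat 1 + conj_transpose A) ** (mat 1 - X) ** (mat 1 + A) = mat 2 ** (mat 1 + A)"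
    unfolding * cancel by (simp add: add.commute)
  also have "\<dots> \<longleftrightarrow> (mat 1 + conj_transpose A) ** (mat 1 - X) = mat 2"
    using cayley_cancel_right[of "(mat 1 + conj_transpose A) ** (mat 1 - X)" "mat 2"] by (rule iffI) (simp_all only:)
  also have "\<dots> \<longleftrightarrow> mat 1 - X = mat 1 + conj_transpose X"
  proof
    assume **: "(mat 1 + conj_transpose A) ** (mat 1 - X) = mat 2"
    have "det (mat 1 + conj_transpose A) \<noteq> 0"
      using arg_cong[OF **, of det] by (auto simp: det_mul det_mat)
    from matrix_inv_left_right(2)[OF this] have "B = C"
      if "(mat 1 + conj_transpose A) ** B = (mat 1 + conj_transpose A) ** C" for B C :: "complex ^ 'n ^ 'n"
      using arg_cong[OF that, of "\<lambda>M. matrix_inv (mat 1 + conj_transpose A) ** M"] by (simp add: matrix_mul_assoc)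
    then show "mat 1 - X = mat 1 + conj_transpose X" using H ** by simp
  qed (simp only: H)
  also have "\<dots> \<longleftrightarrow> conj_transpose X = - X"
    unfolding diff_conv_add_uminus add_left_cancel by auto
  finally show ?thesis .
qed

text \<open>For skew-Hermitian X, det (1 - X) is the complex conjugate of z = det (1 + X). Hence det
  A is the quotient of the conjugate of z by z, which is 1 iff z is real.\<close>

lemma cayley_det_eq_1_iff:
  assumes "conj_transpose X = - X"
  shows "det A = 1 \<longleftrightarrow> Im (det (mat 1 + X)) = 0"
proof -
  have nz: "det (mat 1 + A) \<noteq> 0" "det (mat 1 + X) \<noteq> 0"
    using AX cayley_sym[OF AX] by (simp_all add: cayley_iff[symmetric])
  have X: "det (mat 1 - X) = cnj (det (mat 1 + X))"
    unfolding det_conj_transpose[symmetric] conj_transpose_add assms by simp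
  have "cnj (det (mat 1 + X)) * det (mat 1 + A) = 2 ^ CARD('n) * det A"
    "det (mat 1 + X) * det (mat 1 + A) = 2 ^ CARD('n)"
    using arg_cong[OF cayley_diff_mult, of det] arg_cong[OF AX, of det]
    unfolding X det_mul det_mat .
  then have "(cnj (det (mat 1 + X)) - det (mat 1 + X) * det A) * det (mat 1 + A) = 0"
    by (simp add: left_diff_distrib mult.assoc mult.left_commute[of _ "det A"] mult.commute[of "det A"])
  then have "cnj (det (mat 1 + X)) = det (mat 1 + X) * det A"
    using nz(1) by simp
  then have "det A = 1 \<longleftrightarrow> cnj (det (mat 1 + X)) = det (mat 1 + X)"
    using nz(2) by (metis mult.right_neutral mult_cancel_left)
  also have "\<dots> \<longleftrightarrow> Im (det (mat 1 + X)) = 0"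
    unfolding complex_eq_iff by auto
  finally show ?thesis .
qed

end

text \<open>The determinant of \<open>1 + X\<close> is affine in the entry \<open>X\<^sub>p\<^sub>p\<close>: the two coefficients are
  the following determinants, which do not depend on that entry.\<close>

definition affine_coeff0 :: "'n \<Rightarrow> complex ^ 'n ^ 'n \<Rightarrow> complex" where
  "affine_coeff0 p X = det (\<chi> i j. if i = p \<and> j = p then 1 else (mat 1 + X) $ i $ j)"

definition affine_coeff1 :: "'n \<Rightarrow> complex ^ 'n ^ 'n \<Rightarrow> complex" where
  "affine_coeff1 p X = det (\<chi> i j. if i = p then (if j = p then 1 else 0) else
     if j = p then 0 else (mat 1 + X) $ i $ j)"

text \<open>A permutation contributing to either determinant must fix p, and by injectivity it then
  uses no other entry of column p.\<close>

lemma det_one_row: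
  "det (\<chi> i j. if i = p then (if j = p then 1 else 0) else B i j :: 'a::comm_ring_1 ^ 'n ^ 'n) =
   det (\<chi> i j. if i = p then (if j = p then 1 else 0) else if j = p then 0 else B i j :: 'a ^ 'n ^ 'n)"
  unfolding det_def
proof (rule sum.cong[OF refl])
  fix q assume q: "q \<in> {q. q permutes (UNIV :: 'n set)}"
  show "of_int (sign q) * (\<Prod>i\<in>UNIV. (\<chi> i j. if i = p then (if j = p then 1 else 0) else B i j) $ i $ q i) =
    of_int (sign q) * (\<Prod>i\<in>UNIV. (\<chi> i j. if i = p then (if j = p then 1 else 0)
      else if j = p then 0 else B i j) $ i $ q i)"
  proof (cases "q p = p")
    case True
    moreover have "inj q" using q by (simp add: permutes_inj)
    ultimately have "q i = p \<longleftrightarrow> i = p" for i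
      using inj_eq[of q i p] by simp
    then show ?thesis by (intro arg_cong[of _ _ "\<lambda>x. _ * x"] prod.cong) auto
  next
    case False
    have "(\<Prod>i\<in>UNIV. f i) = 0" if "f p = (0::'a)" for f
      using that by (intro prod_zero) auto
    then show ?thesis using False by simp
  qed
qed

lemma det_affine:
  fixes X :: "complex ^ 'n ^ 'n"
  shows "det (mat 1 + X) = affine_coeff0 p X + X $ p $ p * affine_coeff1 p X"
proof -
  \<comment> \<open>The entry 1 + X_pp of row p is divided: the 1 stays in \<open>r p\<close>, and
    X_pp times the unit row \<open>e\<close> is split off by linearity in that row.\<close>
  define r where "r i = (\<chi> j. if i = p \<and> j = p then 1 else (mat 1 + X) $ i $ j)" for i
  define e :: "complex ^ 'n" where "e = (\<chi> j. if j = p then 1 else 0)"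
  define c where "c = X $ p $ p"
  have "mat 1 + X = (\<chi> i. if i = p then r i + c *s e else (mat 1 + X) $ i)"
    by (simp add: vec_eq_iff mat_nth r_def e_def c_def)
  then have 1: "det (mat 1 + X) = det (\<chi> i. if i = p then r i + c *s e else (mat 1 + X) $ i)"
    by (rule arg_cong[of _ _ det])
  have 2: "det (\<chi> i. if i = p then r i + c *s e else (mat 1 + X) $ i) =
      det (\<chi> i. if i = p then r i else (mat 1 + X) $ i) + det (\<chi> i. if i = p then c *s e else (mat 1 + X) $ i)"
    by (rule det_row_add)
  have 3: "det (\<chi> i. if i = p then c *s e else (mat 1 + X) $ i) =
      c * det (\<chi> i. if i = p then e else (mat 1 + X) $ i)"
    by (rule det_row_mul[of p c "\<lambda>_. e" "\<lambda>i. (mat 1 + X) $ i"])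
  have 4: "det (\<chi> i. if i = p then r i else (mat 1 + X) $ i) = affine_coeff0 p X"
    unfolding affine_coeff0_def by (rule arg_cong[of _ _ det]) (simp add: vec_eq_iff r_def)
  have 5: "det (\<chi> i. if i = p then e else (mat 1 + X) $ i) = affine_coeff1 p X"
    unfolding affine_coeff1_def
    by (rule trans[OF arg_cong[of _ _ det] det_one_row]) (simp add: vec_eq_iff e_def)
  show ?thesis unfolding c_def[symmetric] 1 2 3 4 5 ..
qed

section \<open>Linear transport of Lie group structures\<close>

lemma smooth_map_onI_open:
  "smooth_on_open UNIV F \<Longrightarrow> (\<And>y. y \<in> S \<Longrightarrow> F y = f y) \<Longrightarrow> smooth_map_on S f"
  unfolding smooth_map_on_def using open_UNIV by blast

lemma smooth_map_on_cong:
  "smooth_map_on S f \<Longrightarrow> (\<And>y. y \<in> S \<Longrightarrow> f y = g y) \<Longrightarrow> smooth_map_on S g"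
  unfolding smooth_map_on_def by (metis IntE)

text \<open>A local extension F near P x yields the extension L after F after P on the preimage of
  its domain under P.\<close>

lemma smooth_map_on_linear_transport:
  fixes f :: "'a::euclidean_space \<Rightarrow> 'b::euclidean_space" and P :: "'c::euclidean_space \<Rightarrow> 'a"
    and L :: "'b \<Rightarrow> 'd::euclidean_space"
  assumes f: "smooth_map_on S f" and P: "linear P" "P ` T \<subseteq> S" and L: "linear L"
  shows "smooth_map_on T (\<lambda>x. L (f (P x)))"
  unfolding smooth_map_on_def
proof
  fix x assume x: "x \<in> T"
  then obtain U F where U: "open U" "P x \<in> U" "smooth_on_open U F" "\<forall>y\<in>S \<inter> U. F y = f y"
    using f P(2) unfolding smooth_map_on_def by blast
  have open_U: "open (P -` U)"
    using U(1) P(1) by (simp add: open_vimage linear_continuous_on linear_conv_bounded_linear)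
  have "smooth_on_open (P -` U) (\<lambda>x. L (F (P x)))"
    by (intro smooth_on_open_linear_compose[OF open_U L] smooth_on_open_compose[OF open_U U(1) _ U(3)]
        smooth_on_open_linear open_U P(1)) auto
  with U open_U x P(2) show "\<exists>U F. open U \<and> x \<in> U \<and> smooth_on_open U F \<and> (\<forall>y\<in>T \<inter> U. F y = L (f (P y)))"
    by (intro exI[of _ "P -` U"] exI[of _ "\<lambda>x. L (F (P x))"]) auto
qed

text \<open>The charts are conjugated by L and the model subspace W moves along with them;
  injectivity of L keeps its dimension.\<close>

lemma embedded_submanifold_linear_image:
  fixes L :: "'a::euclidean_space \<Rightarrow> 'b::euclidean_space"
  assumes S: "embedded_submanifold k S" and L: "linear L" "linear L'" "\<And>v. L' (L v) = v" "\<And>w. L (L' w) = w"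
  shows "embedded_submanifold k (L ` S)"
  unfolding embedded_submanifold_def
proof
  fix y assume "y \<in> L ` S"
  then obtain x where x: "x \<in> S" "y = L x" by blast
  obtain U and V :: "'a set" and W h g where h: "open U" "x \<in> U" "open V" "homeomorphism U V h g"
    "smooth_on_open U h" "smooth_on_open V g" "subspace W" "dim W = k" "h ` (S \<inter> U) = V \<inter> W"
    using bspec[OF S[unfolded embedded_submanifold_def] x(1)] by blast
  \<comment> \<open>An image under L is a preimage under the continuous map L', so L maps open sets
    to open sets.\<close>
  have img: "L ` A = L' -` A" for A
    using L(3,4) by (auto simp: image_iff) metis
  have open_img: "open (L ` A)" if "open A" for A
    unfolding img using that L(2) by (simp add: open_vimage linear_continuous_on linear_conv_bounded_linear)
  have smooth: "smooth_on_open (L ` A) (\<lambda>z. L (f (L' z)))" if "open A" "smooth_on_open A f" for A f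
    by (intro smooth_on_open_linear_compose[OF open_img L(1)] smooth_on_open_compose[OF open_img that(1) _ that(2)]
        smooth_on_open_linear L(2) open_img that(1)) (auto simp: L(3))
  have "inj L" by (metis L(3) injI)
  then have dim: "dim (L ` W) = k"
    using dim_image_eq[OF L(1)] h(8) by (metis inj_on_subset subset_UNIV)
  have homeo: "homeomorphism (L ` U) (L ` V) (\<lambda>z. L (h (L' z))) (\<lambda>z. L (g (L' z)))"
  proof (rule homeomorphismI)
    show "continuous_on (L ` U) (\<lambda>z. L (h (L' z)))" "continuous_on (L ` V) (\<lambda>z. L (g (L' z)))"
      using smooth h by (simp_all add: smooth_on_open_continuous_on)
  qed (use h(4) in \<open>auto simp: L(3,4) homeomorphism_def\<close>)
  have image: "(\<lambda>z. L (h (L' z))) ` (L ` S \<inter> L ` U) = L ` V \<inter> L ` W"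
  proof -
    have "L ` S \<inter> L ` U = L ` (S \<inter> U)" "L ` V \<inter> L ` W = L ` (V \<inter> W)"
      using \<open>inj L\<close> by (simp_all add: image_Int)
    then show ?thesis by (simp add: image_image L(3) flip: h(9))
  qed
  show "\<exists>U V W h g. open U \<and> y \<in> U \<and> open (V :: 'b set) \<and> homeomorphism U V h g \<and> smooth_on_open U h \<and>
    smooth_on_open V g \<and> subspace W \<and> dim W = k \<and> h ` (L ` S \<inter> U) = V \<inter> W"
    by (rule exI[of _ "L ` U"], rule exI[of _ "L ` V"], rule exI[of _ "L ` W"],
        rule exI[of _ "\<lambda>z. L (h (L' z))"], rule exI[of _ "\<lambda>z. L (g (L' z))"])
      (use h x homeo image dim open_img smooth linear_subspace_image L(1) in auto)
qed

text \<open>G enters as a bare group and acquires its Lie structure here. On its carrier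
  \<open>\<psi>\<close> is L after \<open>\<theta>\<close> after \<open>\<phi>\<close>, so the
  structure maps of G, read in coordinates, are those of H conjugated by L, and
  \<open>\<phi>\<close> itself reads as the linear map L'.\<close>

lemma lie_group_iso_linear:
  fixes \<theta> :: "'h \<Rightarrow> 'w::euclidean_space" and \<psi> :: "'g \<Rightarrow> 'v::euclidean_space"
  assumes H: "lie_group H \<theta>" and G: "group G" and iso: "\<phi> \<in> iso G H"
    and L: "linear L" "linear L'" "\<And>v. L' (L v) = v" "\<And>w. L (L' w) = w"
    and \<psi>: "\<And>u. u \<in> carrier G \<Longrightarrow> \<psi> u = L (\<theta> (\<phi> u))"
  shows "lie_group_iso G \<psi> H \<theta> \<phi>"
proof -
  interpret G: group G by fact
  interpret H: group H using H by (simp add: lie_group_def)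
  interpret group_hom G H \<phi>
    using iso by unfold_locales (simp add: iso_def)
  have bij: "bij_betw \<phi> (carrier G) (carrier H)" using iso by (simp add: iso_def)
  have inj_\<theta>: "inj_on \<theta> (carrier H)" using H by (simp add: lie_group_def)
  have inj_\<psi>: "inj_on \<psi> (carrier G)"
  proof (rule inj_onI)
    fix u v assume uv: "u \<in> carrier G" "v \<in> carrier G" "\<psi> u = \<psi> v"
    then have "\<theta> (\<phi> u) = \<theta> (\<phi> v)" by (metis \<psi> L(3))
    then show "u = v" using uv inj_\<theta> bij by (metis hom_closed bij_betw_def inj_onD)
  qed
  have image_\<psi>: "\<psi> ` carrier G = L ` \<theta> ` carrier H"
    using bij by (simp add: image_image \<psi> flip: bij_betw_imp_surj_on[OF bij] cong: image_cong)
  have L'_mem: "L' x \<in> \<theta> ` carrier H" if "x \<in> \<psi> ` carrier G" for x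
    using that by (auto simp: image_\<psi> L(3))
  have inv_\<psi>: "inv_into (carrier G) \<psi> x \<in> carrier G" "\<phi> (inv_into (carrier G) \<psi> x) = inv_into (carrier H) \<theta> (L' x)"
    if "x \<in> \<psi> ` carrier G" for x
  proof -
    show mem: "inv_into (carrier G) \<psi> x \<in> carrier G" using that by (rule inv_into_into)
    have "\<theta> (\<phi> (inv_into (carrier G) \<psi> x)) = L' x"
      using f_inv_into_f[OF that] \<psi>[OF mem] by (metis L(3))
    then show "\<phi> (inv_into (carrier G) \<psi> x) = inv_into (carrier H) \<theta> (L' x)"
      using inj_\<theta> mem by (metis hom_closed inv_into_f_f)
  qed
  have LL: "linear (\<lambda>(x, y). (L' x, L' y))"
    using L(2) by (auto simp: linear_iff)
  have mult: "smooth_map_on (\<psi> ` carrier G \<times> \<psi> ` carrier G)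
       (\<lambda>(x, y). \<psi> (inv_into (carrier G) \<psi> x \<otimes>\<^bsub>G\<^esub> inv_into (carrier G) \<psi> y))"
  proof (rule smooth_map_on_cong[OF smooth_map_on_linear_transport[OF _ LL _ L(1)]])
    show "smooth_map_on (\<theta> ` carrier H \<times> \<theta> ` carrier H)
       (\<lambda>(x, y). \<theta> (inv_into (carrier H) \<theta> x \<otimes>\<^bsub>H\<^esub> inv_into (carrier H) \<theta> y))"
      using H by (simp add: lie_group_def)
    show "(\<lambda>(x, y). (L' x, L' y)) ` (\<psi> ` carrier G \<times> \<psi> ` carrier G) \<subseteq> \<theta> ` carrier H \<times> \<theta> ` carrier H"
      using L'_mem by auto
  qed (auto simp: inv_\<psi> \<psi>)
  have inverse: "smooth_map_on (\<psi> ` carrier G) (\<lambda>x. \<psi> (inv\<^bsub>G\<^esub> (inv_into (carrier G) \<psi> x)))"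
  proof (rule smooth_map_on_cong[OF smooth_map_on_linear_transport[OF _ L(2) _ L(1)]])
    show "smooth_map_on (\<theta> ` carrier H) (\<lambda>x. \<theta> (inv\<^bsub>H\<^esub> (inv_into (carrier H) \<theta> x)))"
      using H by (simp add: lie_group_def)
  qed (auto simp: inv_\<psi> \<psi> L'_mem)
  have "lie_group G \<psi>"
    using G inj_\<psi> mult inverse embedded_submanifold_linear_image[OF _ L] H image_\<psi>
    unfolding lie_group_def by metis
  moreover have "smooth_map_on (\<psi> ` carrier G) (\<lambda>x. \<theta> (\<phi> (inv_into (carrier G) \<psi> x)))"
  proof (rule smooth_map_onI_open[OF smooth_on_open_linear[OF open_UNIV L(2)]])
    fix x assume "x \<in> \<psi> ` carrier G"
    then show "L' x = \<theta> (\<phi> (inv_into (carrier G) \<psi> x))"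
      by (metis L'_mem f_inv_into_f inv_\<psi>(2))
  qed
  moreover have "smooth_map_on (\<theta> ` carrier H)
     (\<lambda>y. \<psi> (inv_into (carrier G) \<phi> (inv_into (carrier H) \<theta> y)))"
  proof (rule smooth_map_onI_open[OF smooth_on_open_linear[OF open_UNIV L(1)]])
    fix y assume y: "y \<in> \<theta> ` carrier H"
    let ?v = "inv_into (carrier H) \<theta> y"
    have v: "?v \<in> \<phi> ` carrier G" using inv_into_into[OF y] bij by (simp add: bij_betw_def)
    have "\<psi> (inv_into (carrier G) \<phi> ?v) = L (\<theta> (\<phi> (inv_into (carrier G) \<phi> ?v)))"
      by (rule \<psi>[OF inv_into_into[OF v]])
    also have "\<dots> = L y" using f_inv_into_f[OF v] f_inv_into_f[OF y] by simp
    finally show "L y = \<psi> (inv_into (carrier G) \<phi> ?v)" ..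
  qed
  ultimately show ?thesis
    using H iso by (simp add: lie_group_iso_def)
qed

section \<open>The special unitary group as a Lie group\<close>

text \<open>The shear \<open>X \<mapsto> X \<plusminus> \<i> (Im a / Re b) E\<^sub>p\<^sub>p\<close> straightens the equation \<open>Im (det (1 + X)) = 0\<close>
  on skew-Hermitian \<open>X\<close>, which is \<open>Im X\<^sub>p\<^sub>p = - Im a / Re b\<close>, to \<open>X\<^sub>p\<^sub>p = 0\<close>.\<close>

definition shear :: "real \<Rightarrow> 'n \<Rightarrow> complex ^ 'n ^ 'n \<Rightarrow> complex ^ 'n ^ 'n" where
  "shear s p X = (\<chi> i j. if i = p \<and> j = p
     then X $ p $ p + \<i> * (of_real (s * Im (affine_coeff0 p X)) / of_real (Re (affine_coeff1 p X)))
     else X $ i $ j)"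

lemma shear_nth_off: "\<not> (i = p \<and> j = p) \<Longrightarrow> shear s p X $ i $ j = X $ i $ j"
  by (auto simp: shear_def)

lemma shear_nth_pivot:
  "shear s p X $ p $ p = X $ p $ p + \<i> * of_real (s * Im (affine_coeff0 p X) / Re (affine_coeff1 p X))"
  by (simp add: shear_def)

lemma affine_coeff_cong:
  fixes X Y :: "complex ^ 'n ^ 'n"
  assumes "\<And>i j. \<not> (i = p \<and> j = p) \<Longrightarrow> X $ i $ j = Y $ i $ j"
  shows "affine_coeff0 p X = affine_coeff0 p Y" "affine_coeff1 p X = affine_coeff1 p Y"
  unfolding affine_coeff0_def affine_coeff1_def
  by (rule arg_cong[of _ _ det]; simp add: vec_eq_iff assms)+

lemma affine_coeff_shear [simp]:
  "affine_coeff0 p (shear s p X) = affine_coeff0 p X" "affine_coeff1 p (shear s p X) = affine_coeff1 p X"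
  by (rule affine_coeff_cong, rule shear_nth_off, assumption)+

text \<open>The displacement depends only on entries that the shear leaves alone, so opposite
  displacements cancel. The identity also covers a vanishing denominator, where division gives
  displacement 0.\<close>

lemma shear_shear: "s + t = 0 \<Longrightarrow> shear s p (shear t p X) = X"
proof -
  assume st: "s + t = 0"
  have "shear s p (shear t p X) $ i $ j = X $ i $ j" for i j
  proof (cases "i = p \<and> j = p")
    case True
    have "t = - s" using st by simp
    then show ?thesis using True by (simp add: shear_nth_pivot)
  qed (simp add: shear_nth_off)
  then show ?thesis by (simp add: vec_eq_iff)
qed

text \<open>The displacement of the diagonal entry is purely imaginary, hence itself
  skew-Hermitian.\<close>

lemma conj_transpose_shear:
  "conj_transpose (shear s p X) = - shear s p X \<longleftrightarrow> conj_transpose X = - X"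
proof -
  have "cnj (shear s p X $ j $ i) = - shear s p X $ i $ j \<longleftrightarrow> cnj (X $ j $ i) = - X $ i $ j" for i j
    by (cases "i = p \<and> j = p") (auto simp: shear_nth_off shear_nth_pivot)
  then show ?thesis by (simp add: vec_eq_iff)
qed

text \<open>Re and Im are embedded back into the complex numbers so that the quotient in
  \<open>shear\<close> falls under \<open>smooth_on_open_divide\<close>.\<close>

lemma linear_of_real_Re: "linear (\<lambda>z. of_real (Re z) :: complex)"
  and linear_of_real_Im: "linear (\<lambda>z. of_real (Im z) :: complex)"
  by (rule linearI; simp add: scaleR_conv_of_real)+

lemma smooth_affine_coeff:
  fixes p :: "'n::finite"
  assumes "open S"
  shows "smooth_on_open S (affine_coeff0 p)" "smooth_on_open S (affine_coeff1 p)"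
proof -
  have nth: "smooth_on_open S (\<lambda>X :: complex ^ 'n ^ 'n. (mat 1 + X) $ i $ j)" for i j
    by (intro smooth_on_open_nth smooth_on_open_add smooth_on_open_const smooth_on_open_ident assms)
  have "smooth_on_open S (\<lambda>X :: complex ^ 'n ^ 'n. if i = p \<and> j = p then 1 else (mat 1 + X) $ i $ j)" for i j
    using nth[of i j] smooth_on_open_const[OF assms] by (cases "i = p"; cases "j = p") simp_all
  then show "smooth_on_open S (affine_coeff0 p)"
    unfolding affine_coeff0_def[abs_def] by (intro smooth_on_open_det smooth_on_open_vec assms)
  have "smooth_on_open S (\<lambda>X :: complex ^ 'n ^ 'n. if i = p then (if j = p then 1 else 0) else
     if j = p then 0 else (mat 1 + X) $ i $ j)" for i j
    using nth[of i j] smooth_on_open_const[OF assms] by (cases "i = p"; cases "j = p") simp_all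
  then show "smooth_on_open S (affine_coeff1 p)"
    unfolding affine_coeff1_def[abs_def] by (intro smooth_on_open_det smooth_on_open_vec assms)
qed

lemma smooth_shear:
  fixes p :: "'n::finite" and S :: "(complex ^ 'n ^ 'n) set"
  assumes "open S" "\<And>X. X \<in> S \<Longrightarrow> Re (affine_coeff1 p X) \<noteq> 0"
  shows "smooth_on_open S (shear s p)"
proof -
  note const = smooth_on_open_const[OF assms(1)]
  have nth: "smooth_on_open S (\<lambda>X. X $ i $ j)" for i j
    by (intro smooth_on_open_nth smooth_on_open_ident assms(1))
  have Im: "smooth_on_open S (\<lambda>X. complex_of_real (s * Im (affine_coeff0 p X)))"
    using smooth_on_open_mult[OF assms(1) const[of "of_real s"] smooth_on_open_linear_compose[OF assms(1) linear_of_real_Im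
        smooth_affine_coeff(1)[OF assms(1)]]] by simp
  have Re: "smooth_on_open S (\<lambda>X. complex_of_real (Re (affine_coeff1 p X)))"
    by (rule smooth_on_open_linear_compose[OF assms(1) linear_of_real_Re smooth_affine_coeff(2)[OF assms(1)]])
  have "smooth_on_open S (\<lambda>X. of_real (s * Im (affine_coeff0 p X)) / complex_of_real (Re (affine_coeff1 p X)))"
    by (rule smooth_on_open_divide[OF assms(1) Im Re]) (simp add: assms(2))
  then have pivot: "smooth_on_open S (\<lambda>X. X $ p $ p + \<i> * (of_real (s * Im (affine_coeff0 p X)) / of_real (Re (affine_coeff1 p X))))"
    by (intro smooth_on_open_add[OF assms(1) nth] smooth_on_open_mult[OF assms(1) const])
  have "smooth_on_open S (\<lambda>X. if i = p \<and> j = p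
     then X $ p $ p + \<i> * (of_real (s * Im (affine_coeff0 p X)) / of_real (Re (affine_coeff1 p X)))
     else X $ i $ j)" for i j
    using nth[of i j] pivot by (cases "i = p"; cases "j = p") simp_all
  then show ?thesis
    unfolding shear_def[abs_def] by (intro smooth_on_open_vec assms(1))
qed

text \<open>The diagonal entry of a skew-Hermitian matrix is i y with y real. With a and b the two
  affine coefficients, the imaginary part of \<open>det_affine\<close> is Im a + y Re b, which is Re
  b times the imaginary part of the sheared entry; the real part of that entry is 0.\<close>

lemma skew_det_real_iff:
  assumes "conj_transpose X = - X" "Re (affine_coeff1 p X) \<noteq> 0"
  shows "Im (det (mat 1 + X)) = 0 \<longleftrightarrow> shear 1 p X $ p $ p = 0"
proof -
  have "cnj (X $ p $ p) = - X $ p $ p"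
    using assms(1) by (metis conj_transpose_nth vector_uminus_component)
  then have "Re (X $ p $ p) = 0" by (simp add: complex_eq_iff)
  then show ?thesis
    using assms(2) unfolding det_affine[of X p] shear_nth_pivot
    by (auto simp: complex_eq_iff field_simps)
qed

section \<open>Group operations and charts of the special unitary group\<close>

lemma mem_SU_iff:
  fixes A :: "complex ^ 'n ^ 'n"
  shows "A \<in> carrier SU_matrices \<longleftrightarrow> conj_transpose A ** A = mat 1 \<and> det A = 1"
  by (simp add: SU_matrices_def conj_transpose_def)

lemma SU_conj_transpose:
  assumes "A \<in> carrier SU_matrices"
  shows "A ** conj_transpose A = mat 1" "conj_transpose A ** A = mat 1"
    "conj_transpose A \<in> carrier SU_matrices"
  using assms by (auto simp: mem_SU_iff det_conj_transpose matrix_left_right_inverse)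

lemma SU_mult: "A \<in> carrier SU_matrices \<Longrightarrow> B \<in> carrier SU_matrices \<Longrightarrow> A ** B \<in> carrier SU_matrices"
proof -
  assume A: "A \<in> carrier SU_matrices" and B: "B \<in> carrier SU_matrices"
  have "conj_transpose B ** conj_transpose A ** (A ** B) = conj_transpose B ** (conj_transpose A ** A) ** B"
    by (simp only: matrix_mul_assoc)
  then show ?thesis
    using A B by (simp add: mem_SU_iff det_mul conj_transpose_mult)
qed

lemma group_SU: "group SU_matrices"
proof (rule groupI)
  fix A :: "complex ^ 'n ^ 'n" assume "A \<in> carrier SU_matrices"
  then show "\<exists>B\<in>carrier SU_matrices. B \<otimes>\<^bsub>SU_matrices\<^esub> A = \<one>\<^bsub>SU_matrices\<^esub>"
    using SU_conj_transpose by (intro bexI[of _ "conj_transpose A"]) (auto simp: SU_matrices_def)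
next
  show "\<one>\<^bsub>SU_matrices\<^esub> \<in> carrier (SU_matrices :: (complex ^ 'n ^ 'n) monoid)"
    by (simp add: mem_SU_iff) (simp add: SU_matrices_def)
qed (use SU_mult in \<open>auto simp: SU_matrices_def matrix_mul_assoc\<close>)

lemma inv_SU:
  assumes "A \<in> carrier SU_matrices"
  shows "inv\<^bsub>SU_matrices\<^esub> A = conj_transpose A"
proof -
  interpret group SU_matrices by (rule group_SU)
  show ?thesis
    using SU_conj_transpose[OF assms] assms by (intro inv_equality) (auto simp: SU_matrices_def)
qed

lemma open_det_nz:
  fixes f :: "'a::euclidean_space \<Rightarrow> complex ^ 'n ^ 'n"
  assumes "open S" "smooth_on_open S f"
  shows "open {x \<in> S. det (f x) \<noteq> 0}"
proof -
  have "open (S \<inter> (\<lambda>x. det (f x)) -` (- {0}))"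
    using smooth_on_open_continuous_on[OF smooth_on_open_det[OF assms]] assms(1)
    by (intro continuous_open_preimage) (auto simp: open_Compl)
  then show ?thesis by (simp add: vimage_def Int_def)
qed

lemma open_Re_nz:
  fixes f :: "'a::euclidean_space \<Rightarrow> complex"
  assumes "open S" "smooth_on_open S f"
  shows "open {x \<in> S. Re (f x) \<noteq> 0}"
proof -
  have "continuous_on S (\<lambda>x. Re (f x))"
    using smooth_on_open_continuous_on[OF assms(2)] by (intro continuous_intros)
  then have "open (S \<inter> (\<lambda>x. Re (f x)) -` (- {0}))"
    using assms(1) by (intro continuous_open_preimage) (auto simp: open_Compl)
  then show ?thesis by (simp add: vimage_def Int_def)
qed

lemma cayley_SU_iff:
  assumes "det (mat 1 + X) \<noteq> 0" "Re (affine_coeff1 p X) \<noteq> 0"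
  shows "cayley X \<in> carrier SU_matrices \<longleftrightarrow> conj_transpose X = - X \<and> shear 1 p X $ p $ p = 0"
proof -
  have *: "(mat 1 + X) ** (mat 1 + cayley X) = mat 2"
    by (rule cayley_sym) (use cayley_iff[of X "cayley X"] assms(1) in simp)
  show ?thesis
    unfolding mem_SU_iff cayley_skew_iff[OF *]
    using cayley_det_eq_1_iff[OF *] skew_det_real_iff[OF _ assms(2)] by metis
qed

text \<open>The chart at A0 is left translation to the identity, followed by the Cayley transform
  and the shear. The pivot p and the model space W are the same for every base point, so the
  dimension is constant and may stay in the form dim W.\<close>

lemma embedded_submanifold_SU:
  "\<exists>k. embedded_submanifold k (carrier SU_matrices :: (complex ^ 'n ^ 'n) set)"
proof -
  let ?S = "carrier SU_matrices :: (complex ^ 'n ^ 'n) set"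
  fix p :: 'n
  define W where "W = {X :: complex ^ 'n ^ 'n. conj_transpose X = - X \<and> X $ p $ p = 0}"
  have W: "subspace W"
    by (auto simp: W_def subspace_def conj_transpose_add vec_eq_iff)
  have "\<exists>U V W' h g. open U \<and> A0 \<in> U \<and> open (V :: (complex ^ 'n ^ 'n) set) \<and>
        homeomorphism U V h g \<and> smooth_on_open U h \<and> smooth_on_open V g \<and>
        subspace W' \<and> dim W' = dim W \<and> h ` (?S \<inter> U) = V \<inter> W'" if A0: "A0 \<in> ?S" for A0
  proof -
    define B0 where "B0 = conj_transpose A0"
    have B0: "A0 ** B0 = mat 1" "B0 ** A0 = mat 1" "B0 \<in> ?S"
      using SU_conj_transpose[OF A0] by (simp_all add: B0_def)
    have B0A: "B0 ** (A0 ** C) = C" "A0 ** (B0 ** C) = C" for C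
      by (simp_all add: matrix_mul_assoc B0)
    have B0_mem: "B0 ** C \<in> ?S \<longleftrightarrow> C \<in> ?S" for C
      using SU_mult[OF A0, of "B0 ** C"] SU_mult[OF B0(3), of C] by (auto simp: B0A)
    define h where "h A = shear 1 p (cayley (B0 ** A))" for A
    define g where "g Y = A0 ** cayley (shear (-1) p Y)" for Y
    \<comment> \<open>Openness is proved one condition at a time, because the function in the second
      condition is smooth only where the first one holds. On the target the two conditions come in
      the opposite order; they correspond because a shear preserves
      \<open>affine_coeff1\<close>.\<close>
    define U1 where "U1 = {A \<in> UNIV. det (mat 1 + B0 ** A) \<noteq> 0}"
    define U where "U = {A \<in> U1. Re (affine_coeff1 p (cayley (B0 ** A))) \<noteq> 0}"
    define V1 where "V1 = {Y \<in> UNIV :: (complex ^ 'n ^ 'n) set. Re (affine_coeff1 p Y) \<noteq> 0}"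
    define V where "V = {Y \<in> V1. det (mat 1 + shear (-1) p Y) \<noteq> 0}"
    have smooth_B0: "smooth_on_open T (\<lambda>A. B0 ** A)" if "open T" for T
      by (intro smooth_on_open_matrix_mult smooth_on_open_const smooth_on_open_ident that)
    have U1: "open U1" unfolding U1_def
      by (intro open_det_nz smooth_on_open_add smooth_on_open_const smooth_B0 open_UNIV)
    have smooth_c: "smooth_on_open U1 (\<lambda>A. cayley (B0 ** A))"
      by (rule smooth_on_open_cayley[OF U1 smooth_B0[OF U1]]) (simp add: U1_def)
    have U: "open U" unfolding U_def
      by (rule open_Re_nz[OF U1 smooth_on_open_compose[OF U1 open_UNIV _ smooth_affine_coeff(2)[OF open_UNIV] smooth_c]]) simp
    have V1: "open V1" unfolding V1_def
      by (rule open_Re_nz[OF open_UNIV smooth_affine_coeff(2)[OF open_UNIV]])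
    have smooth_s: "smooth_on_open V1 (shear s p)" for s
      by (rule smooth_shear[OF V1]) (simp add: V1_def)
    have V: "open V" unfolding V_def
      by (rule open_det_nz[OF V1 smooth_on_open_add[OF V1 smooth_on_open_const[OF V1] smooth_s]])
    have smooth_h: "smooth_on_open U h" unfolding h_def[abs_def]
      by (rule smooth_on_open_compose[OF U V1 _ smooth_s smooth_on_open_subset[OF smooth_c]])
        (auto simp: U_def V1_def)
    have "smooth_on_open V (\<lambda>Y. cayley (shear (-1) p Y))"
      by (rule smooth_on_open_cayley[OF V smooth_on_open_subset[OF smooth_s]]) (auto simp: V_def)
    then have smooth_g: "smooth_on_open V g" unfolding g_def[abs_def]
      by (intro smooth_on_open_matrix_mult[OF V smooth_on_open_const[OF V]])
    have hU: "h A \<in> V" "g (h A) = A" if "A \<in> U" for A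
      using that cayley_det_nz[of "B0 ** A"] cayley_cayley[of "B0 ** A"]
      by (auto simp: U_def U1_def V_def V1_def h_def g_def shear_shear B0A)
    have gV: "g Y \<in> U" "h (g Y) = Y" if "Y \<in> V" for Y
      using that cayley_det_nz[of "shear (-1) p Y"] cayley_cayley[of "shear (-1) p Y"]
      by (auto simp: U_def U1_def V_def V1_def h_def g_def shear_shear B0A)
    have homeo: "homeomorphism U V h g"
      using smooth_h smooth_g hU gV by (intro homeomorphismI) (auto intro: smooth_on_open_continuous_on)
    have mem: "A \<in> ?S \<longleftrightarrow> h A \<in> W" if "A \<in> U" for A
    proof -
      let ?X = "cayley (B0 ** A)"
      have X: "det (mat 1 + ?X) \<noteq> 0" "Re (affine_coeff1 p ?X) \<noteq> 0" "cayley ?X = B0 ** A"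
        using that cayley_det_nz cayley_cayley by (auto simp: U_def U1_def)
      have "A \<in> ?S \<longleftrightarrow> cayley ?X \<in> ?S" by (simp add: X(3) B0_mem)
      also have "\<dots> \<longleftrightarrow> h A \<in> W"
        unfolding cayley_SU_iff[OF X(1,2)] by (simp add: W_def h_def conj_transpose_shear)
      finally show ?thesis .
    qed
    have image: "h ` (?S \<inter> U) = V \<inter> W"
    proof
      show "h ` (?S \<inter> U) \<subseteq> V \<inter> W" using hU mem by auto
      show "V \<inter> W \<subseteq> h ` (?S \<inter> U)"
      proof
        fix Y assume "Y \<in> V \<inter> W"
        then show "Y \<in> h ` (?S \<inter> U)"
          using gV[of Y] mem[of "g Y"] by (intro image_eqI[of _ _ "g Y"]) auto
      qed
    qed
    \<comment> \<open>Translation takes the base point to 1, whose Cayley transform is 0, and there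
      the pivot coefficient is det 1 = 1.\<close>
    have "A0 \<in> U"
    proof -
      have II: "mat 1 + mat 1 = (mat 2 :: complex ^ 'n ^ 'n)"
        by (simp add: vec_eq_iff mat_nth)
      have "(mat 1 + 0) ** (mat 1 + mat 1) = (mat 2 :: complex ^ 'n ^ 'n)"
        unfolding II by simp
      then have "det (mat 1 + mat 1 :: complex ^ 'n ^ 'n) \<noteq> 0" "cayley (mat 1 :: complex ^ 'n ^ 'n) = 0"
        unfolding cayley_iff[symmetric] by simp_all
      moreover have "affine_coeff1 p (0 :: complex ^ 'n ^ 'n) = 1"
      proof -
        have "affine_coeff1 p (0 :: complex ^ 'n ^ 'n) = det (mat 1 :: complex ^ 'n ^ 'n)"
          unfolding affine_coeff1_def by (rule arg_cong[of _ _ det]) (simp add: vec_eq_iff mat_nth)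
        then show ?thesis by simp
      qed
      ultimately show ?thesis by (simp add: U_def U1_def B0)
    qed
    then show ?thesis
      by (intro exI[of _ U] exI[of _ V] exI[of _ W] exI[of _ h] exI[of _ g] conjI
          U V homeo smooth_h smooth_g W image refl)
  qed
  then show ?thesis unfolding embedded_submanifold_def by blast
qed

text \<open>Inversion is conjugate transposition, so both operations are restrictions of maps smooth
  on the whole matrix space, one bilinear and one real-linear.\<close>

lemma lie_group_SU: "lie_group (SU_matrices :: (complex ^ 'n ^ 'n) monoid) id"
proof -
  let ?S = "carrier SU_matrices :: (complex ^ 'n ^ 'n) set"
  have inv: "inv_into ?S id A = A" if "A \<in> ?S" for A
    using inv_into_f_f[of id ?S A] that by simp
  have "smooth_on_open UNIV (\<lambda>z :: (complex ^ 'n ^ 'n) \<times> (complex ^ 'n ^ 'n). fst z ** snd z)"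
    by (intro smooth_on_open_matrix_mult open_UNIV smooth_on_open_linear linear_fst linear_snd)
  then have "smooth_map_on (id ` ?S \<times> id ` ?S)
       (\<lambda>(x, y). id (inv_into ?S id x \<otimes>\<^bsub>SU_matrices\<^esub> inv_into ?S id y))"
    by (rule smooth_map_onI_open) (auto simp: inv, simp add: SU_matrices_def)
  moreover have "smooth_map_on (id ` ?S) (\<lambda>x. id (inv\<^bsub>SU_matrices\<^esub> (inv_into ?S id x)))"
    by (rule smooth_map_onI_open[OF smooth_on_open_linear[OF open_UNIV linear_conj_transpose]])
      (simp add: inv inv_SU)
  ultimately show ?thesis
    using group_SU embedded_submanifold_SU unfolding lie_group_def by auto
qed

section \<open>The Faddeev--LeVerrier algorithm\<close>

primrec matrix_pow :: "complex ^ 'n ^ 'n \<Rightarrow> nat \<Rightarrow> complex ^ 'n ^ 'n" where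
  "matrix_pow A 0 = mat 1"
| "matrix_pow A (Suc k) = A ** matrix_pow A k"

lemma matrix_pow_Suc_right: "matrix_pow A (Suc k) = matrix_pow A k ** A"
  by (induction k) (simp_all add: matrix_mul_assoc)

lemma fps_nth_of_int_mult: "fps_nth (of_int z * f) k = of_int z * fps_nth (f :: 'a::comm_ring_1 fps) k"
  by (simp flip: fps_of_int)

lemma fps_deriv_prod:
  fixes f :: "'i \<Rightarrow> 'a::comm_ring_1 fps"
  assumes "finite I"
  shows "fps_deriv (prod f I) = (\<Sum>k\<in>I. \<Prod>i\<in>I. if i = k then fps_deriv (f i) else f i)"
  using assms
proof (induction I)
  case (insert x I)
  have "(\<Prod>i\<in>insert x I. if i = k then fps_deriv (f i) else f i) =
      f x * (\<Prod>i\<in>I. if i = k then fps_deriv (f i) else f i)" if "k \<in> I" for k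
    using insert that by auto
  moreover have "(\<Prod>i\<in>insert x I. if i = x then fps_deriv (f i) else f i) = fps_deriv (f x) * prod f I"
    using insert by (auto intro!: arg_cong[of _ _ "\<lambda>y. _ * y"] prod.cong)
  ultimately show ?case
    using insert by (simp add: sum_distrib_left)
qed simp

lemma fps_deriv_det:
  fixes P :: "'a::comm_ring_1 fps ^ 'n ^ 'n"
  shows "fps_deriv (det P) = (\<Sum>k\<in>UNIV. det (\<chi> i. if i = k then (\<chi> j. fps_deriv (P $ i $ j)) else P $ i))"
proof -
  have "fps_deriv (of_int z * f) = of_int z * fps_deriv f" for z and f :: "'a fps"
    by (simp flip: fps_of_int)
  then have "fps_deriv (det P) = (\<Sum>q\<in>{q. q permutes UNIV}. of_int (sign q) *
      (\<Sum>k\<in>UNIV. \<Prod>i\<in>UNIV. if i = k then fps_deriv (P $ i $ q i) else P $ i $ q i))"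
    by (simp add: det_def fps_deriv_sum fps_deriv_prod)
  also have "\<dots> = (\<Sum>k\<in>UNIV. \<Sum>q\<in>{q. q permutes UNIV}. of_int (sign q) *
      (\<Prod>i\<in>UNIV. if i = k then fps_deriv (P $ i $ q i) else P $ i $ q i))"
    by (subst sum.swap) (simp add: sum_distrib_left)
  also have "\<dots> = (\<Sum>k\<in>UNIV. det (\<chi> i. if i = k then (\<chi> j. fps_deriv (P $ i $ j)) else P $ i))"
    unfolding det_def by (intro sum.cong refl arg_cong[of _ _ "\<lambda>y. _ * y"] prod.cong) auto
  finally show ?thesis .
qed

text \<open>Each permutation contributes such a product to det (1 - sA); the lowest and top
  coefficients assemble to det 1 and det (-A). The degree bound in the third clause is what lets the
  induction isolate the top coefficient.\<close>

lemma fps_nth_prod_linear: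
  fixes a b :: "'i \<Rightarrow> 'a::comm_ring_1"
  assumes "finite I"
  shows "fps_nth (\<Prod>i\<in>I. fps_const (a i) + fps_X * fps_const (b i)) 0 = prod a I \<and>
    fps_nth (\<Prod>i\<in>I. fps_const (a i) + fps_X * fps_const (b i)) (card I) = prod b I \<and>
    (\<forall>k>card I. fps_nth (\<Prod>i\<in>I. fps_const (a i) + fps_X * fps_const (b i)) k = 0)"
  using assms
proof (induction I)
  case (insert x I)
  let ?Q = "\<Prod>i\<in>I. fps_const (a i) + fps_X * fps_const (b i)"
  have "fps_nth ((fps_const (a x) + fps_X * fps_const (b x)) * ?Q) k =
     a x * fps_nth ?Q k + (if k = 0 then 0 else b x * fps_nth ?Q (k - 1))" for k
    by (simp add: distrib_right mult.assoc)
  then show ?case using insert by (auto simp: prod.insert)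
qed simp

text \<open>Comparing coefficients of s^k expresses (k + 1) C_(k+1) through C_0, ..., C_k, and in
  characteristic 0 one may divide by k + 1.\<close>

lemma fps_deriv_eq_unique:
  fixes C D T :: "'a::field_char_0 fps"
  assumes "fps_deriv C = C * T" "fps_deriv D = D * T" "fps_nth C 0 = fps_nth D 0"
  shows "C = D"
proof (rule fps_ext)
  fix n show "fps_nth C n = fps_nth D n"
  proof (induction n rule: less_induct)
    case (less n)
    show ?case
    proof (cases n)
      case (Suc k)
      have "of_nat (Suc k) * fps_nth C (Suc k) = of_nat (Suc k) * fps_nth D (Suc k)"
        using arg_cong[OF assms(1), of "\<lambda>f. fps_nth f k"] arg_cong[OF assms(2), of "\<lambda>f. fps_nth f k"] less Suc
        by (simp add: fps_mult_nth)
      then show ?thesis using Suc by (simp del: of_nat_Suc)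
    qed (use assms in simp)
  qed
qed

text \<open>This is 1 - sA with s the formal variable. Its determinant is the reversed
  characteristic polynomial, whose constant term 1 is the initial value for the differential
  equation below.\<close>

definition char_matrix_fps :: "complex ^ 'n ^ 'n \<Rightarrow> complex fps ^ 'n ^ 'n" where
  "char_matrix_fps A = (\<chi> i j. fps_const (mat 1 $ i $ j) + fps_X * fps_const (- A $ i $ j))"

lemma det_char_matrix_fps_nth:
  fixes A :: "complex ^ 'n ^ 'n"
  shows "fps_nth (det (char_matrix_fps A)) 0 = 1"
    "fps_nth (det (char_matrix_fps A)) CARD('n) = (- 1) ^ CARD('n) * det A"
proof -
  have det_uminus: "det (- A) = (- 1) ^ CARD('n) * det A"
  proof -
    have "- A = mat (- 1) ** A" by (simp add: vec_eq_iff mat_mult_nth)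
    then show ?thesis by (simp add: det_mul det_mat)
  qed
  have "fps_nth (det (char_matrix_fps A)) 0 = det (mat 1 :: complex ^ 'n ^ 'n)"
    using fps_nth_prod_linear[OF finite_class.finite_UNIV, of "\<lambda>i. mat 1 $ i $ p i" "\<lambda>i. - A $ i $ p i" for p]
    unfolding det_def by (simp add: char_matrix_fps_def fps_sum_nth fps_nth_of_int_mult)
  then show "fps_nth (det (char_matrix_fps A)) 0 = 1" by simp
  have "fps_nth (det (char_matrix_fps A)) CARD('n) = det (- A)"
    using fps_nth_prod_linear[OF finite_class.finite_UNIV, of "\<lambda>i. mat 1 $ i $ p i" "\<lambda>i. - A $ i $ p i" for p]
    by (simp add: det_def char_matrix_fps_def fps_sum_nth fps_nth_of_int_mult)
  then show "fps_nth (det (char_matrix_fps A)) CARD('n) = (- 1) ^ CARD('n) * det A"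
    by (simp add: det_uminus)
qed

text \<open>Jacobi's formula: the rows of \<open>-A\<close> are combinations of the rows of \<open>1 - sA\<close>, because
  \<open>-A = -(A + s A\<^sup>2 + \<dots>) (1 - sA)\<close>.\<close>

lemma fps_deriv_det_char_matrix:
  fixes A :: "complex ^ 'n ^ 'n"
  shows "fps_deriv (det (char_matrix_fps A)) =
    det (char_matrix_fps A) * Abs_fps (\<lambda>k. - trace (matrix_pow A (Suc k)))"
proof -
  define P where "P = char_matrix_fps A"
  define G where "G k l = Abs_fps (\<lambda>m. - matrix_pow A (Suc m) $ k $ l)" for k l
  have row: "(\<chi> j. fps_deriv (P $ k $ j)) = (\<Sum>l\<in>UNIV. G k l *s P $ l)" for k
  proof -
    have "fps_deriv (P $ k $ j) = (\<Sum>l\<in>UNIV. G k l * P $ l $ j)" for j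
    proof (rule fps_ext)
      fix m
      have "fps_nth (\<Sum>l\<in>UNIV. G k l * P $ l $ j) m =
          (\<Sum>l\<in>UNIV. fps_nth (G k l) m * mat 1 $ l $ j - (if m = 0 then 0 else fps_nth (G k l) (m - 1) * A $ l $ j))"
        by (simp add: fps_sum_nth P_def char_matrix_fps_def distrib_left mult.assoc[symmetric] mult.commute[of _ fps_X])
          (cases m; simp add: mult.assoc)
      also have "\<dots> = - matrix_pow A (Suc m) $ k $ j + (if m = 0 then 0 else (matrix_pow A m ** A) $ k $ j)"
      proof -
        have "(\<Sum>l\<in>UNIV. x l * mat 1 $ l $ j) = x j" for x :: "'n \<Rightarrow> complex"
          by (simp add: mat_nth if_distrib cong: if_cong)
        then show ?thesis
          by (cases m)
            (simp_all add: G_def sum_subtractf sum_negf matrix_matrix_mult_def[of "matrix_pow _ _"] del: matrix_pow.simps(2))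
      qed
      also have "\<dots> = fps_nth (fps_deriv (P $ k $ j)) m"
      proof (cases m)
        case (Suc l)
        then show ?thesis
          by (simp add: P_def char_matrix_fps_def matrix_pow_Suc_right[of A "Suc l", symmetric] del: matrix_pow.simps(2))
      qed (simp add: P_def char_matrix_fps_def)
      finally show "fps_nth (fps_deriv (P $ k $ j)) m = fps_nth (\<Sum>l\<in>UNIV. G k l * P $ l $ j) m" ..
    qed
    then show ?thesis by (simp add: vec_eq_iff)
  qed
  have "det (\<chi> i. if i = k then (\<chi> j. fps_deriv (P $ i $ j)) else P $ i) = G k k * det P" for k
  proof -
    have "(\<chi> i. if i = k then (\<chi> j. fps_deriv (P $ i $ j)) else P $ i) =
        (\<chi> i. if i = k then (\<Sum>l\<in>UNIV. G k l *s P $ l) else P $ i)"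
      using row[of k] by (simp add: vec_eq_iff)
    then have "det (\<chi> i. if i = k then (\<chi> j. fps_deriv (P $ i $ j)) else P $ i) =
        (\<Sum>l\<in>UNIV. G k l * det (\<chi> i. if i = k then P $ l else P $ i))"
      by (simp add: det_linear_row_sum[of UNIV k "\<lambda>i l. G k l *s P $ l" "\<lambda>i. P $ i"]
          det_row_mul[of k _ "\<lambda>_. P $ _" "\<lambda>i. P $ i"])
    \<comment> \<open>For l other than k, row l of P now occurs twice, so only the term l = k
      survives.\<close>
    also have "\<dots> = (\<Sum>l\<in>UNIV. if l = k then G k k * det P else 0)"
    proof (rule sum.cong[OF refl])
      fix l
      show "G k l * det (\<chi> i. if i = k then P $ l else P $ i) = (if l = k then G k k * det P else 0)"
      proof (cases "l = k")
        case True
        then have "(\<chi> i. if i = k then P $ l else P $ i) = P" by (simp add: vec_eq_iff)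
        with True show ?thesis by simp
      next
        case False
        then have "det (\<chi> i. if i = k then P $ l else P $ i) = 0"
          by (intro det_identical_rows[of k l]) (auto simp: row_def)
        with False show ?thesis by simp
      qed
    qed
    finally show ?thesis by simp
  qed
  then have "fps_deriv (det P) = det P * (\<Sum>k\<in>UNIV. G k k)"
    by (simp add: fps_deriv_det sum_distrib_left mult.commute)
  also have "(\<Sum>k\<in>UNIV. G k k) = Abs_fps (\<lambda>k. - trace (matrix_pow A (Suc k)))"
    by (rule fps_ext) (simp add: fps_sum_nth G_def trace_def sum_negf)
  finally show ?thesis by (simp add: P_def)
qed

lemma trace_mat_mult: "trace (mat c ** A) = c * trace (A :: complex ^ 'n ^ 'n)"
  by (simp add: trace_def mat_mult_nth sum_distrib_left)

lemma matrix_mult_sum_right: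
  fixes A :: "'a::semiring_1 ^ 'n ^ 'm"
  shows "A ** (\<Sum>j\<in>J. F j) = (\<Sum>j\<in>J. A ** F j)"
proof -
  have "A ** 0 = (0 :: 'a ^ 'k ^ 'm)" by (simp add: vec_eq_iff matrix_matrix_mult_def)
  then show ?thesis by (induction J rule: infinite_finite_induct) (simp_all add: matrix_add_ldistrib)
qed

text \<open>Put C(s) = 1 - c_1 s - c_2 s^2 - ... . Traces of the unrolled recursion give Newton's
  identities, which say that C satisfies the same first-order equation as det (1 - sA) does by
  Jacobi's formula. So the two series agree, and the coefficient of s^n is the claim; eigenvalues
  never enter.\<close>

theorem faddeev_leverrier:
  fixes A :: "complex ^ 'n ^ 'n" and M :: "nat \<Rightarrow> complex ^ 'n ^ 'n"
  assumes M1: "M (Suc 0) = A"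
    and M_Suc: "\<And>k. M (Suc (Suc k)) = A ** (M (Suc k) - mat (c (Suc k)))"
    and c: "\<And>k. c (Suc k) = trace (M (Suc k)) / of_nat (Suc k)"
  shows "det A = (- 1) ^ (CARD('n) + 1) * c CARD('n)"
proof -
  \<comment> \<open>The scalar c_j is subtracted at stage j and afterwards multiplied by A another
    Suc k - j times.\<close>
  have M: "M (Suc k) = matrix_pow A (Suc k) - (\<Sum>j\<in>{1..k}. mat (c j) ** matrix_pow A (Suc k - j))" for k
  proof (induction k)
    case (Suc k)
    have "A ** (mat (c j) ** matrix_pow A (Suc k - j)) = mat (c j) ** matrix_pow A (Suc (Suc k) - j)"
      if "j \<in> {1..k}" for j
    proof -
      have "Suc (Suc k) - j = Suc (Suc k - j)" using that by auto
      then show ?thesis by (simp add: matrix_mul_assoc mat_mult_commute[of A])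
    qed
    then have "A ** (\<Sum>j\<in>{1..k}. mat (c j) ** matrix_pow A (Suc k - j)) =
        (\<Sum>j\<in>{1..k}. mat (c j) ** matrix_pow A (Suc (Suc k) - j))"
      by (simp add: matrix_mult_sum_right)
    moreover have "A ** mat (c (Suc k)) = mat (c (Suc k)) ** matrix_pow A (Suc (Suc k) - Suc k)"
      by (simp add: mat_mult_commute[of A])
    ultimately show ?case
      by (simp add: M_Suc Suc matrix_diff_ldistrib)
  qed (simp add: M1)
  have newton: "of_nat (Suc k) * c (Suc k) = trace (matrix_pow A (Suc k)) - (\<Sum>j\<in>{1..k}. c j * trace (matrix_pow A (Suc k - j)))" for k
  proof -
    have tr_sum: "trace (\<Sum>j\<in>J. F j) = (\<Sum>j\<in>J. trace (F j))" for J :: "nat set" and F :: "nat \<Rightarrow> complex ^ 'n ^ 'n"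
      by (simp add: trace_def sum.swap[of _ J])
    have "of_nat (Suc k) * c (Suc k) = trace (M (Suc k))" by (simp add: c del: of_nat_Suc)
    then show ?thesis by (simp only: M trace_sub tr_sum trace_mat_mult)
  qed
  \<comment> \<open>The hypotheses fix c only at positive arguments, so the constant coefficient is
    set to 1 by hand.\<close>
  define C where "C = Abs_fps (\<lambda>k. if k = 0 then 1 else - c k)"
  have "fps_deriv C = C * Abs_fps (\<lambda>k. - trace (matrix_pow A (Suc k)))"
  proof (rule fps_ext)
    fix k
    have "fps_nth (C * Abs_fps (\<lambda>k. - trace (matrix_pow A (Suc k)))) k =
        (\<Sum>j=0..k. fps_nth C j * - trace (matrix_pow A (Suc k - j)))"
      unfolding fps_mult_nth by (intro sum.cong refl) (simp add: Suc_diff_le)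
    also have "\<dots> = - trace (matrix_pow A (Suc k)) + (\<Sum>j\<in>{1..k}. c j * trace (matrix_pow A (Suc k - j)))"
      by (simp add: sum.atLeast_Suc_atMost C_def)
    also have "\<dots> = - (of_nat (Suc k) * c (Suc k))" unfolding newton by simp
    finally show "fps_nth (fps_deriv C) k = fps_nth (C * Abs_fps (\<lambda>k. - trace (matrix_pow A (Suc k)))) k"
      by (simp add: C_def)
  qed
  then have "C = det (char_matrix_fps A)"
    by (rule fps_deriv_eq_unique[OF _ fps_deriv_det_char_matrix]) (simp add: C_def det_char_matrix_fps_nth)
  then have "fps_nth C CARD('n) = (- 1) ^ CARD('n) * det A"
    by (simp add: det_char_matrix_fps_nth)
  then have "- c CARD('n) = (- 1) ^ CARD('n) * det A" by (simp add: C_def)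
  then have "(- 1) ^ CARD('n) * ((- 1) ^ CARD('n) * det A) = (- 1) ^ CARD('n) * - c CARD('n)" by simp
  then show ?thesis by (simp flip: mult.assoc power_add)
qed

section \<open>Unitary matrices satisfying the Clifford relations\<close>

text \<open>It sends basis vector j to \<open>\<phi> j\<close> times basis vector
  \<open>\<pi> j\<close>. Such matrices are closed under products, so identities between them reduce
  to index maps and scalars.\<close>

definition monomial_matrix :: "('n \<Rightarrow> 'n) \<Rightarrow> ('n \<Rightarrow> complex) \<Rightarrow> complex ^ 'n ^ 'n" where
  "monomial_matrix \<pi> \<phi> = (\<chi> i j. if i = \<pi> j then \<phi> j else 0)"

lemma monomial_matrix_mult:
  fixes \<pi> \<pi>' :: "'n::finite \<Rightarrow> 'n"
  shows "monomial_matrix \<pi> \<phi> ** monomial_matrix \<pi>' \<phi>' = monomial_matrix (\<pi> \<circ> \<pi>') (\<lambda>x. \<phi> (\<pi>' x) * \<phi>' x)"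
proof -
  have "(\<Sum>k\<in>UNIV. (if i = \<pi> k then \<phi> k else 0) * (if k = \<pi>' j then \<phi>' j else 0)) =
      (\<Sum>k\<in>UNIV. if k = \<pi>' j then (if i = \<pi> (\<pi>' j) then \<phi> (\<pi>' j) * \<phi>' j else 0) else 0)" for i j
    by (rule sum.cong) auto
  then show ?thesis
    by (simp add: vec_eq_iff matrix_matrix_mult_def monomial_matrix_def)
qed

lemma mat_mult_monomial_matrix:
  "mat c ** monomial_matrix \<pi> \<phi> = monomial_matrix (\<pi> :: 'n::finite \<Rightarrow> 'n) (\<lambda>x. c * \<phi> x)"
  by (simp add: vec_eq_iff mat_mult_nth monomial_matrix_def)

lemma monomial_matrix_unitary:
  fixes \<pi> :: "'n::finite \<Rightarrow> 'n"
  assumes "inj \<pi>" "\<And>x. cmod (\<phi> x) = 1"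
  shows "conj_transpose (monomial_matrix \<pi> \<phi>) ** monomial_matrix \<pi> \<phi> = mat 1"
proof -
  have "(\<Sum>k\<in>UNIV. cnj (if k = \<pi> i then \<phi> i else 0) * (if k = \<pi> j then \<phi> j else 0)) =
      (\<Sum>k\<in>UNIV. if k = \<pi> j then (if i = j then cnj (\<phi> j) * \<phi> j else 0) else 0)" for i j
    using injD[OF assms(1)] by (intro sum.cong) auto
  moreover have "cnj (\<phi> j) * \<phi> j = 1" for j
    using assms(2)[of j] by (simp add: mult.commute complex_norm_square[symmetric])
  ultimately show ?thesis
    by (simp add: vec_eq_iff matrix_matrix_mult_def monomial_matrix_def mat_nth)
qed

lemma root_omega_pow: "m > 0 \<Longrightarrow> root_omega m ^ m = 1"
  by (simp add: root_omega_def exp_of_nat_mult[symmetric] exp_two_pi_i)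

lemma norm_root_omega: "cmod (root_omega m) = 1"
  by (simp add: root_omega_def norm_exp_eq_Re)

lemma root_omega_pow_mod: "m > 0 \<Longrightarrow> root_omega m ^ (n mod m) = root_omega m ^ n"
proof -
  assume "m > 0"
  have "root_omega m ^ n = root_omega m ^ (m * (n div m) + n mod m)" by simp
  also have "\<dots> = root_omega m ^ (n mod m)"
    unfolding power_add power_mult root_omega_pow[OF \<open>m > 0\<close>] by simp
  finally show ?thesis ..
qed

text \<open>The sum is m (m - 1) / 2, so the power of omega is exp (i pi (m - 1)), which is -1 for
  even m. The first factor is the m-th power of a phase chosen to cancel it.\<close>

lemma root_omega_pow_triangle:
  assumes "m > 0"
  shows "exp (- (\<i> * of_real pi * (of_nat m - 1) / of_nat m)) ^ m * root_omega m ^ (\<Sum>l<m. l) = 1"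
proof -
  have "2 * (\<Sum>l<m. l) + m = m * m" for m :: nat
    by (induction m) auto
  then have "of_nat (2 * (\<Sum>l<m. l) + m) = (of_nat (m * m) :: complex)" by simp
  then have sum: "(of_nat (\<Sum>l<m. l) :: complex) = of_nat m * (of_nat m - 1) / 2"
    by (simp add: algebra_simps del: of_nat_sum)
  have "root_omega m ^ (\<Sum>l<m. l) = exp (\<i> * of_real pi * (of_nat m - 1))"
    unfolding root_omega_def exp_of_nat_mult[symmetric] sum
    by (rule arg_cong[of _ _ exp]) (use assms in \<open>simp add: field_simps\<close>)
  then show ?thesis
    using assms by (simp add: exp_of_nat_mult[symmetric] exp_add[symmetric])
qed

text \<open>Clock-and-shift matrices on functions \<open>{0..<r} \<rightarrow> \<int>/m\<close>: \<open>weyl a k z\<close> maps the basis vector at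
  \<open>x\<close> to \<open>z \<omega>\<^bsup>x k\<^esup>\<close> times the one at \<open>x + a\<close>. The basis is indexed by \<open>f\<close>.\<close>

locale clock_shift =
  fixes m r :: nat and f :: "'n::finite \<Rightarrow> nat \<Rightarrow> nat"
  assumes m: "m > 0" and bij: "bij_betw f UNIV ({..<r} \<rightarrow>\<^sub>E {..<m})"
begin

definition shift :: "(nat \<Rightarrow> nat) \<Rightarrow> 'n \<Rightarrow> 'n" where
  "shift a x = inv_into UNIV f (\<lambda>k\<in>{..<r}. (f x k + a k) mod m)"

definition weyl :: "(nat \<Rightarrow> nat) \<Rightarrow> nat \<Rightarrow> complex \<Rightarrow> complex ^ 'n ^ 'n" where
  "weyl a k z = monomial_matrix (shift a) (\<lambda>x. z * root_omega m ^ f x k)"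

lemma f_shift: "k < r \<Longrightarrow> f (shift a x) k = (f x k + a k) mod m"
proof -
  have "(\<lambda>k\<in>{..<r}. (f x k + a k) mod m) \<in> f ` UNIV"
    using bij m by (simp add: bij_betw_def PiE_iff)
  then show "k < r \<Longrightarrow> f (shift a x) k = (f x k + a k) mod m"
    by (simp add: shift_def f_inv_into_f)
qed

lemma f_less: "k < r \<Longrightarrow> f x k < m"
  using bij_betw_apply[OF bij, of x] by (auto simp: PiE_iff)

lemma f_ext: "(\<And>k. k < r \<Longrightarrow> f x k = f y k) \<Longrightarrow> x = y"
proof -
  assume *: "\<And>k. k < r \<Longrightarrow> f x k = f y k"
  have "f x = f y"
    by (rule PiE_ext[OF bij_betw_apply[OF bij] bij_betw_apply[OF bij]]) (simp_all add: *)
  then show "x = y" using bij by (simp add: bij_betw_def inj_eq)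
qed

lemma shift_shift: "shift a \<circ> shift b = shift (\<lambda>k. a k + b k)"
proof
  fix x show "(shift a \<circ> shift b) x = shift (\<lambda>k. a k + b k) x"
    by (rule f_ext) (simp add: f_shift mod_simps ac_simps)
qed

lemma shift_multiple: "shift (\<lambda>k. m * a k) = id"
proof
  fix x show "shift (\<lambda>k. m * a k) x = id x"
    by (rule f_ext) (simp add: f_shift f_less)
qed

lemma inj_shift: "inj (shift a)"
proof (rule inj_on_inverseI)
  fix x
  have "(shift (\<lambda>k. (m - 1) * a k) \<circ> shift a) x = x"
  proof -
    \<comment> \<open>Translation by (m - 1) a undoes translation by a without negative
      displacements.\<close>
    have "(m - 1) * a k + a k = m * a k" for k using m by (cases m) auto
    then show ?thesis by (simp only: shift_shift shift_multiple id_apply)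
  qed
  then show "shift (\<lambda>k. (m - 1) * a k) (shift a x) = x" by simp
qed

lemma omega_f_shift: "k < r \<Longrightarrow> root_omega m ^ f (shift a x) k = root_omega m ^ (f x k + a k)"
  by (simp add: f_shift root_omega_pow_mod m)

lemma weyl_unitary: "cmod z = 1 \<Longrightarrow> conj_transpose (weyl a k z) ** weyl a k z = mat 1"
  unfolding weyl_def
  by (rule monomial_matrix_unitary[OF inj_shift]) (simp add: norm_mult norm_power norm_root_omega)

text \<open>The factor applied second sees an already translated index: one order collects an extra
  omega^(a' k), the other an extra omega^(a k'). The hypotheses make the quotient omega.\<close>

lemma weyl_commute:
  assumes "k < r" "k' < r" "a' k = 1" "a k' = 0"
  shows "weyl a k z ** weyl a' k' z' = mat (root_omega m) ** (weyl a' k' z' ** weyl a k z)"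
  unfolding weyl_def monomial_matrix_mult mat_mult_monomial_matrix shift_shift
  using assms by (simp add: omega_f_shift power_add ac_simps)

text \<open>After l applications the clock coordinate has advanced by l * a k; summing these
  advances gives the triangular exponent.\<close>

lemma weyl_pow:
  assumes "k < r"
  shows "matrix_pow (weyl a k z) p = monomial_matrix (shift (\<lambda>i. p * a i))
    (\<lambda>x. z ^ p * root_omega m ^ (p * f x k + a k * (\<Sum>l<p. l)))"
proof (induction p)
  case 0
  have "shift (\<lambda>i. 0 * a i) = id" using shift_multiple[of "\<lambda>_. 0"] by simp
  then show ?case by (simp add: monomial_matrix_def vec_eq_iff mat_nth)
next
  case (Suc p)
  have "(\<lambda>i. a i + p * a i) = (\<lambda>i. Suc p * a i)" by simp
  then show ?case
    unfolding matrix_pow.simps Suc unfolding weyl_def monomial_matrix_mult shift_shift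
    using assms by (simp add: omega_f_shift power_add algebra_simps)
qed

lemma weyl_pow_m:
  assumes "k < r" "z ^ m * root_omega m ^ (a k * (\<Sum>l<m. l)) = 1"
  shows "matrix_pow (weyl a k z) m = mat 1"
proof -
  have "root_omega m ^ (m * n) = 1" for n by (simp add: power_mult root_omega_pow m)
  then have "matrix_pow (weyl a k z) m = monomial_matrix id (\<lambda>x. 1)"
    unfolding weyl_pow[OF assms(1)] shift_multiple by (simp add: power_add assms(2))
  also have "\<dots> = mat 1" by (simp add: monomial_matrix_def vec_eq_iff mat_nth)
  finally show ?thesis .
qed

text \<open>A generator that both reads and shifts the same coordinate would, without this factor,
  have m-th power (-1)^(m - 1); see \<open>root_omega_pow_triangle\<close>.\<close>

definition phase :: complex where
  "phase = exp (- (\<i> * of_real pi * (of_nat m - 1) / of_nat m))"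

text \<open>Generators 2k + 1 and 2k + 2 share the clock of coordinate k and shift all coordinates
  below k; the second also shifts k itself. As in the Jordan-Wigner construction, a later generator
  shifts the clock coordinate of every earlier one and never conversely, which is what
  \<open>weyl_commute\<close> asks for.\<close>

definition gen :: "nat \<Rightarrow> complex ^ 'n ^ 'n" where
  "gen j = (let k = (j - 1) div 2 in
     if odd j then weyl (\<lambda>i. if i < k then 1 else 0) k 1 else weyl (\<lambda>i. if i \<le> k then 1 else 0) k phase)"

lemma norm_phase: "cmod phase = 1"
  by (simp add: phase_def norm_exp_eq_Re Re_divide)

lemma gen_unitary: "conj_transpose (gen j) ** gen j = mat 1"
  by (simp add: gen_def Let_def weyl_unitary norm_phase)

lemma gen_pow_m:
  assumes "j \<in> {1..2 * r}"
  shows "matrix_pow (gen j) m = mat 1"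
proof -
  have "(j - 1) div 2 < r" using assms by auto
  then show ?thesis
    using root_omega_pow_triangle[OF m]
    by (auto simp: gen_def Let_def phase_def intro!: weyl_pow_m)
qed

lemma gen_commute:
  assumes "j \<in> {1..2 * r}" "l \<in> {1..2 * r}" "j < l"
  shows "gen j ** gen l = mat (root_omega m) ** (gen l ** gen j)"
proof -
  have "(j - 1) div 2 < r" "(l - 1) div 2 < r" using assms by auto
  moreover have "odd l \<Longrightarrow> (j - 1) div 2 < (l - 1) div 2" "even j \<Longrightarrow> (j - 1) div 2 < (l - 1) div 2"
    "(j - 1) div 2 \<le> (l - 1) div 2"
  proof -
    have "1 \<le> j" using assms by simp
    with assms(3) show "odd l \<Longrightarrow> (j - 1) div 2 < (l - 1) div 2"
      "even j \<Longrightarrow> (j - 1) div 2 < (l - 1) div 2" "(j - 1) div 2 \<le> (l - 1) div 2"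
      by presburger+
  qed
  ultimately show ?thesis
    by (auto simp: gen_def Let_def intro!: weyl_commute)
qed

end

lemma clifford_matrices_exist:
  assumes "m > 0" "CARD('n::finite) = m ^ r"
  obtains e :: "nat \<Rightarrow> complex ^ 'n ^ 'n"
  where "\<And>j. conj_transpose (e j) ** e j = mat 1"
    and "\<And>j. j \<in> {1..2 * r} \<Longrightarrow> matrix_pow (e j) m = mat 1"
    and "\<And>j l. \<lbrakk>j \<in> {1..2 * r}; l \<in> {1..2 * r}; j < l\<rbrakk>
      \<Longrightarrow> e j ** e l = mat (root_omega m) ** (e l ** e j)"
proof -
  have "card ({..<r} \<rightarrow>\<^sub>E {..<m}) = CARD('n)" by (simp add: card_PiE assms)
  then obtain f :: "'n \<Rightarrow> nat \<Rightarrow> nat" where "bij_betw f UNIV ({..<r} \<rightarrow>\<^sub>E {..<m})"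
    using finite_same_card_bij[of "UNIV :: 'n set" "{..<r} \<rightarrow>\<^sub>E {..<m}"] by (auto simp: finite_PiE)
  then interpret clock_shift m r f using assms by unfold_locales
  show thesis by (rule that[of gen]) (fact gen_unitary gen_pow_m gen_commute)+
qed

section \<open>The free algebra and its evaluation in matrices\<close>

lemma free_alg_simps:
  "f \<in> carrier (free_alg d) \<longleftrightarrow> finite {w. f w \<noteq> 0} \<and> {w. f w \<noteq> 0} \<subseteq> lists {1..d}"
  "f \<otimes>\<^bsub>free_alg d\<^esub> g = (\<lambda>w. \<Sum>i\<le>length w. f (take i w) * g (drop i w))"
  "\<one>\<^bsub>free_alg d\<^esub> = (\<lambda>w. if w = [] then 1 else 0)"
  "\<zero>\<^bsub>free_alg d\<^esub> = (\<lambda>w. 0)"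
  "f \<oplus>\<^bsub>free_alg d\<^esub> g = (\<lambda>w. f w + g w)"
  by (simp_all add: free_alg_def)

lemma free_mult_support:
  assumes "(\<Sum>i\<le>length w. f (take i w) * g (drop i w)) \<noteq> (0 :: complex)"
  shows "\<exists>u v. w = u @ v \<and> f u \<noteq> 0 \<and> g v \<noteq> 0"
proof -
  obtain i where "f (take i w) * g (drop i w) \<noteq> 0"
    using assms by (rule sum.not_neutral_contains_not_neutral)
  then show ?thesis by (intro exI[of _ "take i w"] exI[of _ "drop i w"]) auto
qed

lemma free_mult_support_subset:
  "{w. (\<Sum>i\<le>length w. f (take i w) * g (drop i w)) \<noteq> (0 :: complex)} \<subseteq>
    (\<lambda>(u, v). u @ v) ` ({w. f w \<noteq> 0} \<times> {w. g w \<noteq> 0})"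
proof
  fix w assume "w \<in> {w. (\<Sum>i\<le>length w. f (take i w) * g (drop i w)) \<noteq> (0 :: complex)}"
  then obtain u v where "w = u @ v" "f u \<noteq> 0" "g v \<noteq> 0"
    using free_mult_support[of f w g] by auto
  then show "w \<in> (\<lambda>(u, v). u @ v) ` ({w. f w \<noteq> 0} \<times> {w. g w \<noteq> 0})"
    by (intro image_eqI[of _ _ "(u, v)"]) auto
qed

lemma free_mult_closed:
  assumes "f \<in> carrier (free_alg d)" "g \<in> carrier (free_alg d)"
  shows "f \<otimes>\<^bsub>free_alg d\<^esub> g \<in> carrier (free_alg d)"
proof -
  let ?h = "\<lambda>w. \<Sum>i\<le>length w. f (take i w) * g (drop i w)"
  note sub = free_mult_support_subset[of f g]
  moreover have "finite ((\<lambda>(u, v). u @ v) ` ({w. f w \<noteq> 0} \<times> {w. g w \<noteq> 0}))"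
    using assms by (simp add: free_alg_simps)
  ultimately have "finite {w. ?h w \<noteq> 0}" by (rule finite_subset)
  moreover have "{w. ?h w \<noteq> 0} \<subseteq> lists {1..d}"
    using sub assms by (fastforce simp: free_alg_simps)
  ultimately show ?thesis by (simp add: free_alg_simps)
qed

text \<open>Both sides sum over the ways to cut w into three consecutive pieces, where j and i are
  the lengths of the first two.\<close>

lemma free_mult_assoc:
  "(f \<otimes>\<^bsub>free_alg d\<^esub> g) \<otimes>\<^bsub>free_alg d\<^esub> h = f \<otimes>\<^bsub>free_alg d\<^esub> (g \<otimes>\<^bsub>free_alg d\<^esub> h)"
proof
  fix w :: "nat list"
  let ?n = "length w"
  let ?F = "\<lambda>j i. f (take j w) * g (take i (drop j w)) * h (drop (j + i) w)"
  have "(\<Sum>j\<le>length (take k w). f (take j (take k w)) * g (drop j (take k w))) * h (drop k w) =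
      (\<Sum>j\<le>k. ?F j (k - j))" if "k \<le> ?n" for k
  proof -
    have "length (take k w) = k" using that by simp
    then show ?thesis
      unfolding sum_distrib_right by (intro sum.cong) (auto simp: drop_take min_def)
  qed
  then have "((f \<otimes>\<^bsub>free_alg d\<^esub> g) \<otimes>\<^bsub>free_alg d\<^esub> h) w = (\<Sum>k\<le>?n. \<Sum>j\<le>k. ?F j (k - j))"
    unfolding free_alg_simps by (intro sum.cong) auto
  also have "\<dots> = (\<Sum>(j, i)\<in>{(j, i). j + i \<le> ?n}. ?F j i)"
    by (rule sum.triangle_reindex_eq[symmetric])
  also have "{(j, i). j + i \<le> ?n} = Sigma {..?n} (\<lambda>j. {..?n - j})" by auto
  also have "(\<Sum>(j, i)\<in>Sigma {..?n} (\<lambda>j. {..?n - j}). ?F j i) = (\<Sum>j\<le>?n. \<Sum>i\<le>?n - j. ?F j i)"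
    by (rule sum.Sigma[symmetric]) auto
  also have "\<dots> = (f \<otimes>\<^bsub>free_alg d\<^esub> (g \<otimes>\<^bsub>free_alg d\<^esub> h)) w"
    by (simp add: free_alg_simps sum_distrib_left mult.assoc add.commute)
  finally show "((f \<otimes>\<^bsub>free_alg d\<^esub> g) \<otimes>\<^bsub>free_alg d\<^esub> h) w = (f \<otimes>\<^bsub>free_alg d\<^esub> (g \<otimes>\<^bsub>free_alg d\<^esub> h)) w" .
qed

lemma free_scalar_mult: "free_scalar c \<otimes>\<^bsub>free_alg d\<^esub> f = (\<lambda>w. c * f w)"
proof
  fix w
  have "(\<Sum>i\<le>length w. free_scalar c (take i w) * f (drop i w)) = (\<Sum>i\<le>length w. if i = 0 then c * f w else 0)"
    by (rule sum.cong) (auto simp: free_scalar_def)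
  then show "(free_scalar c \<otimes>\<^bsub>free_alg d\<^esub> f) w = c * f w" by (simp add: free_alg_simps)
qed

lemma free_mult_scalar: "f \<otimes>\<^bsub>free_alg d\<^esub> free_scalar c = (\<lambda>w. f w * c)"
proof
  fix w
  have "(\<Sum>i\<le>length w. f (take i w) * free_scalar c (drop i w)) = (\<Sum>i\<le>length w. if i = length w then f w * c else 0)"
    by (rule sum.cong) (auto simp: free_scalar_def)
  then show "(f \<otimes>\<^bsub>free_alg d\<^esub> free_scalar c) w = f w * c" by (simp add: free_alg_simps)
qed

lemma free_one_eq_scalar: "\<one>\<^bsub>free_alg d\<^esub> = free_scalar 1"
  by (simp add: free_alg_simps free_scalar_def)

lemma free_scalar_closed: "free_scalar c \<in> carrier (free_alg d)"
proof -
  have "{w. free_scalar c w \<noteq> 0} \<subseteq> {[]}" by (auto simp: free_scalar_def)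
  then show ?thesis using finite_subset by (auto simp: free_alg_simps)
qed

lemma free_gen_closed: "k \<in> {1..d} \<Longrightarrow> free_gen k \<in> carrier (free_alg d)"
  by (auto simp: free_alg_simps free_gen_def)

lemma free_add_closed:
  assumes "f \<in> carrier (free_alg d)" "g \<in> carrier (free_alg d)"
  shows "f \<oplus>\<^bsub>free_alg d\<^esub> g \<in> carrier (free_alg d)"
proof -
  have "{w. f w + g w \<noteq> 0} \<subseteq> {w. f w \<noteq> 0} \<union> {w. g w \<noteq> 0}" by auto
  then show ?thesis using assms finite_subset by (fastforce simp: free_alg_simps)
qed

lemma ring_free_alg: "ring (free_alg d)"
proof (rule ringI)
  show "abelian_group (free_alg d)"
  proof (rule abelian_groupI)
    fix f assume "f \<in> carrier (free_alg d)"
    then show "\<exists>g\<in>carrier (free_alg d). g \<oplus>\<^bsub>free_alg d\<^esub> f = \<zero>\<^bsub>free_alg d\<^esub>"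
      by (intro bexI[of _ "\<lambda>w. - f w"]) (auto simp: free_alg_simps)
  next
    fix f g :: "nat list \<Rightarrow> complex"
    assume "f \<in> carrier (free_alg d)" "g \<in> carrier (free_alg d)"
    then show "f \<oplus>\<^bsub>free_alg d\<^esub> g \<in> carrier (free_alg d)" by (rule free_add_closed)
  qed (simp_all add: free_alg_simps add_ac)
  show "monoid (free_alg d)"
    by (rule monoidI)
      (simp_all add: free_mult_closed free_mult_assoc free_one_eq_scalar free_scalar_closed
        free_scalar_mult free_mult_scalar)
qed (auto simp: free_alg_simps sum.distrib distrib_left distrib_right)

definition matrix_ring :: "(complex ^ 'n ^ 'n) ring" where
  "matrix_ring = \<lparr>carrier = UNIV, mult = (**), one = mat 1, zero = 0, add = (+)\<rparr>"

lemma matrix_ring_simps [simp]: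
  "carrier matrix_ring = UNIV" "x \<otimes>\<^bsub>matrix_ring\<^esub> y = x ** y" "\<one>\<^bsub>matrix_ring\<^esub> = mat 1"
  "\<zero>\<^bsub>matrix_ring\<^esub> = 0" "x \<oplus>\<^bsub>matrix_ring\<^esub> y = x + y"
  by (simp_all add: matrix_ring_def)

lemma ring_matrix_ring: "ring (matrix_ring :: (complex ^ 'n ^ 'n) ring)"
proof (rule ringI)
  show "abelian_group (matrix_ring :: (complex ^ 'n ^ 'n) ring)"
  proof (rule abelian_groupI)
    fix x :: "complex ^ 'n ^ 'n"
    show "\<exists>y\<in>carrier matrix_ring. y \<oplus>\<^bsub>matrix_ring\<^esub> x = \<zero>\<^bsub>matrix_ring\<^esub>"
      by (rule bexI[of _ "- x"]) simp_all
  qed (simp_all add: add_ac)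
  show "monoid (matrix_ring :: (complex ^ 'n ^ 'n) ring)"
    by (rule monoidI) (auto simp: matrix_mul_assoc)
qed (auto simp: matrix_add_ldistrib matrix_add_rdistrib)

lemma matrix_ring_minus: "x \<ominus>\<^bsub>matrix_ring\<^esub> y = x - (y :: complex ^ 'n ^ 'n)"
proof -
  interpret ring "matrix_ring :: (complex ^ 'n ^ 'n) ring" by (rule ring_matrix_ring)
  have "\<ominus>\<^bsub>matrix_ring\<^esub> y = - y" by (rule minus_equality) auto
  then show ?thesis by (simp add: a_minus_def)
qed

lemma matrix_ring_pow: "x [^]\<^bsub>matrix_ring\<^esub> k = matrix_pow (x :: complex ^ 'n ^ 'n) k"
proof -
  interpret ring "matrix_ring :: (complex ^ 'n ^ 'n) ring" by (rule ring_matrix_ring)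
  show ?thesis
    by (induction k) (simp_all add: matrix_pow_Suc_right del: matrix_pow.simps(2))
qed

lemma matrix_ring_finsum:
  assumes "finite J"
  shows "finsum matrix_ring f J = (\<Sum>j\<in>J. f j :: complex ^ 'n ^ 'n)"
proof -
  interpret ring "matrix_ring :: (complex ^ 'n ^ 'n) ring" by (rule ring_matrix_ring)
  show ?thesis using assms by (induction J) auto
qed

definition word_prod :: "(nat \<Rightarrow> complex ^ 'n ^ 'n) \<Rightarrow> nat list \<Rightarrow> complex ^ 'n ^ 'n" where
  "word_prod X w = foldr (\<lambda>k M. X k ** M) w (mat 1)"

definition free_eval :: "(nat \<Rightarrow> complex ^ 'n ^ 'n) \<Rightarrow> (nat list \<Rightarrow> complex) \<Rightarrow> complex ^ 'n ^ 'n" where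
  "free_eval X f = (\<Sum>w | f w \<noteq> 0. mat (f w) ** word_prod X w)"

lemma word_prod_append: "word_prod X (u @ v) = word_prod X u ** word_prod X v"
  by (induction u) (simp_all add: word_prod_def matrix_mul_assoc)

lemma mat_add: "mat (a + b) = mat a + mat (b :: 'a::monoid_add)"
  by (simp add: vec_eq_iff mat_nth)

lemma mat_mult: "mat (a * b) = mat a ** mat (b :: 'a::comm_semiring_1)"
  by (simp add: vec_eq_iff mat_mult_nth) (simp add: mat_nth)

lemma mat_sum: "mat (\<Sum>i\<in>I. g i) = (\<Sum>i\<in>I. mat (g i :: complex))"
  by (induction I rule: infinite_finite_induct) (simp_all add: mat_add)

lemma matrix_mult_sum_left:
  fixes A :: "'a::semiring_1 ^ 'n ^ 'm"
  shows "(\<Sum>j\<in>J. F j) ** A = (\<Sum>j\<in>J. F j ** A)"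
proof -
  have "0 ** A = (0 :: 'a ^ 'n ^ 'k)" by (simp add: vec_eq_iff matrix_matrix_mult_def)
  then show ?thesis by (induction J rule: infinite_finite_induct) (simp_all add: matrix_add_rdistrib)
qed

text \<open>Summing over a finite superset of the support allows several elements to be evaluated
  over one common index set.\<close>

lemma free_eval_superset:
  assumes "finite S" "{w. f w \<noteq> 0} \<subseteq> S"
  shows "free_eval X f = (\<Sum>w\<in>S. mat (f w) ** word_prod X w)"
proof -
  have "mat 0 ** B = 0" for B :: "complex ^ 'n ^ 'n" by (simp add: vec_eq_iff matrix_matrix_mult_def)
  then show ?thesis
    unfolding free_eval_def using assms by (intro sum.mono_neutral_left) auto
qed

lemma free_eval_add:
  assumes "f \<in> carrier (free_alg d)" "g \<in> carrier (free_alg d)"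
  shows "free_eval X (\<lambda>w. f w + g w) = free_eval X f + free_eval X g"
proof -
  let ?S = "{w. f w \<noteq> 0} \<union> {w. g w \<noteq> 0}"
  have S: "finite ?S" using assms by (simp add: free_alg_simps)
  show ?thesis
    by (subst (1 2 3) free_eval_superset[OF S]) (auto simp: mat_add matrix_add_rdistrib sum.distrib)
qed

text \<open>A pair (u, v) of support words is encoded injectively as the word u @ v with cut
  position length u. All other cuts of such words contribute zero, so the double sum over cuts
  becomes a sum over pairs.\<close>

lemma free_eval_mult:
  assumes "f \<in> carrier (free_alg d)" "g \<in> carrier (free_alg d)"
  shows "free_eval X (f \<otimes>\<^bsub>free_alg d\<^esub> g) = free_eval X f ** free_eval X g"
proof -
  let ?A = "{w. f w \<noteq> 0}" and ?B = "{w. g w \<noteq> 0}"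
  let ?S = "(\<lambda>(u, v). u @ v) ` (?A \<times> ?B)"
  let ?H = "\<lambda>u v. (mat (f u) ** word_prod X u) ** (mat (g v) ** word_prod X v)"
  let ?k = "\<lambda>(u, v :: nat list). (u @ v, length u)"
  have fin: "finite ?A" "finite ?B" using assms by (simp_all add: free_alg_simps)
  then have S: "finite ?S" by simp
  have H: "mat (f u * g v) ** word_prod X (u @ v) = ?H u v" for u v
  proof -
    have "mat (f u * g v) ** word_prod X (u @ v) = mat (f u) ** (mat (g v) ** word_prod X u) ** word_prod X v"
      by (simp only: mat_mult word_prod_append matrix_mul_assoc)
    also have "\<dots> = ?H u v"
      unfolding mat_mult_commute[of "word_prod X u" "g v", symmetric] by (simp only: matrix_mul_assoc)
    finally show ?thesis .
  qed
  have H0: "?H u v = 0" if "f u = 0 \<or> g v = 0" for u v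
    using that by (auto simp: vec_eq_iff matrix_matrix_mult_def)
  have "free_eval X (f \<otimes>\<^bsub>free_alg d\<^esub> g) =
      (\<Sum>w\<in>?S. mat (\<Sum>i\<le>length w. f (take i w) * g (drop i w)) ** word_prod X w)"
    unfolding free_alg_simps
    by (rule free_eval_superset[OF S free_mult_support_subset])
  also have "\<dots> = (\<Sum>w\<in>?S. \<Sum>i\<le>length w. ?H (take i w) (drop i w))"
    unfolding mat_sum matrix_mult_sum_left H[symmetric] by simp
  also have "\<dots> = (\<Sum>(w, i)\<in>Sigma ?S (\<lambda>w. {..length w}). ?H (take i w) (drop i w))"
    using S by (intro sum.Sigma) auto
  also have "\<dots> = (\<Sum>(w, i)\<in>?k ` (?A \<times> ?B). ?H (take i w) (drop i w))"
  proof (rule sum.mono_neutral_right)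
    show "\<forall>p\<in>Sigma ?S (\<lambda>w. {..length w}) - ?k ` (?A \<times> ?B). (case p of (w, i) \<Rightarrow> ?H (take i w) (drop i w)) = 0"
    proof (clarify, rule ccontr)
      fix w i u v assume *: "i \<le> length (u @ v)" "(u @ v, i) \<notin> ?k ` (?A \<times> ?B)" "?H (take i (u @ v)) (drop i (u @ v)) \<noteq> 0"
      have nz: "f (take i (u @ v)) \<noteq> 0 \<and> g (drop i (u @ v)) \<noteq> 0"
      proof (rule ccontr)
        assume "\<not> (f (take i (u @ v)) \<noteq> 0 \<and> g (drop i (u @ v)) \<noteq> 0)"
        then have "f (take i (u @ v)) = 0 \<or> g (drop i (u @ v)) = 0" by simp
        from *(3) H0[OF this] show False by (rule notE)
      qed
      have "length (take i (u @ v)) = i"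
        using *(1) unfolding length_take by simp
      then have "(u @ v, i) = ?k (take i (u @ v), drop i (u @ v))"
        by (simp del: take_append drop_append)
      then have "(u @ v, i) \<in> ?k ` (?A \<times> ?B)"
        by (rule image_eqI) (use nz in \<open>simp del: take_append drop_append\<close>)
      with *(2) show False by (rule notE)
    qed
    show "finite (Sigma ?S (\<lambda>w. {..length w}))"
      by (rule finite_SigmaI[OF S]) simp
    show "?k ` (?A \<times> ?B) \<subseteq> Sigma ?S (\<lambda>w. {..length w})"
    proof
      fix p assume "p \<in> ?k ` (?A \<times> ?B)"
      then obtain u v where uv: "(u, v) \<in> ?A \<times> ?B" "p = (u @ v, length u)" by auto
      have "u @ v \<in> ?S" by (rule image_eqI[OF _ uv(1)]) simp
      then show "p \<in> Sigma ?S (\<lambda>w. {..length w})" unfolding uv(2) by (rule SigmaI) simp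
    qed
  qed
  also have "\<dots> = (\<Sum>(u, v)\<in>?A \<times> ?B. ?H u v)"
  proof (subst sum.reindex)
    show "inj_on ?k (?A \<times> ?B)" by (rule inj_onI) auto
  qed (rule sum.cong[OF refl], clarsimp)
  also have "\<dots> = (\<Sum>u\<in>?A. \<Sum>v\<in>?B. ?H u v)"
    using fin by (intro sum.Sigma[symmetric]) auto
  also have "\<dots> = free_eval X f ** free_eval X g"
    unfolding free_eval_def matrix_mult_sum_left unfolding matrix_mult_sum_right ..
  finally show ?thesis .
qed

lemma free_eval_scalar: "free_eval X (free_scalar c) = mat c"
  by (subst free_eval_superset[of "{[]}"]) (auto simp: free_scalar_def word_prod_def)

lemma free_eval_gen: "free_eval X (free_gen k) = X k"
  by (subst free_eval_superset[of "{[k]}"]) (auto simp: free_gen_def word_prod_def)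

lemma free_eval_ring_hom: "free_eval X \<in> ring_hom (free_alg d) matrix_ring"
proof (rule ring_hom_memI)
  show "free_eval X (f \<oplus>\<^bsub>free_alg d\<^esub> g) = free_eval X f \<oplus>\<^bsub>matrix_ring\<^esub> free_eval X g"
    if "f \<in> carrier (free_alg d)" "g \<in> carrier (free_alg d)" for f g
    using free_eval_add[OF that] by (simp add: free_alg_simps)
qed (simp_all add: free_eval_mult free_one_eq_scalar free_eval_scalar)

section \<open>Ordered monomials\<close>

text \<open>The scalar t with e_k e_l = t e_l e_k, extending the defining relation from k < l to all
  pairs.\<close>

definition clifford_twist :: "nat \<Rightarrow> nat \<Rightarrow> nat \<Rightarrow> complex" where
  "clifford_twist m k l = (if k < l then root_omega m else if l < k then inverse (root_omega m) else 1)"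

text \<open>Instantiated twice, by the abstract algebra and by matrices: monomials are reordered
  once for both, and the representation carries one family of monomials to the other.
  \<open>\<sigma>\<close> embeds the scalars as central elements.\<close>

locale clifford_relations = ring R for R (structure) +
  fixes \<sigma> :: "complex \<Rightarrow> 'a" and e :: "nat \<Rightarrow> 'a" and m d :: nat
  assumes m_pos: "m > 0"
    and \<sigma>_closed [simp]: "\<sigma> c \<in> carrier R"
    and \<sigma>_one: "\<sigma> 1 = \<one>"
    and \<sigma>_mult: "\<sigma> (a * b) = \<sigma> a \<otimes> \<sigma> b"
    and \<sigma>_add: "\<sigma> (a + b) = \<sigma> a \<oplus> \<sigma> b"
    and \<sigma>_central: "x \<in> carrier R \<Longrightarrow> x \<otimes> \<sigma> c = \<sigma> c \<otimes> x"
    and e_closed: "k \<in> {1..d} \<Longrightarrow> e k \<in> carrier R"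
    and e_pow: "k \<in> {1..d} \<Longrightarrow> e k [^] m = \<one>"
    and e_commute: "\<lbrakk>k \<in> {1..d}; l \<in> {1..d}; k < l\<rbrakk>
      \<Longrightarrow> e k \<otimes> e l = \<sigma> (root_omega m) \<otimes> (e l \<otimes> e k)"
begin

lemma \<sigma>_zero: "\<sigma> 0 = \<zero>"
proof -
  have "\<sigma> 0 \<oplus> \<sigma> 0 = \<sigma> 0" using \<sigma>_add[of 0 0] by simp
  then show ?thesis by simp
qed

lemma \<sigma>_\<sigma>: "x \<in> carrier R \<Longrightarrow> \<sigma> a \<otimes> (\<sigma> b \<otimes> x) = \<sigma> (a * b) \<otimes> x"
  by (simp add: \<sigma>_mult m_assoc)

lemma mult_\<sigma>: "x \<in> carrier R \<Longrightarrow> y \<in> carrier R \<Longrightarrow> x \<otimes> (\<sigma> c \<otimes> y) = \<sigma> c \<otimes> (x \<otimes> y)"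
  by (simp add: m_assoc[symmetric] \<sigma>_central)

lemma twist_commute:
  assumes "k \<in> {1..d}" "l \<in> {1..d}"
  shows "e k \<otimes> e l = \<sigma> (clifford_twist m k l) \<otimes> (e l \<otimes> e k)"
proof (cases k l rule: linorder_cases)
  case greater
  have "root_omega m \<noteq> 0" using norm_root_omega[of m] by auto
  then show ?thesis
    using greater e_commute[OF assms(2,1)] assms
    by (simp add: clifford_twist_def \<sigma>_\<sigma> e_closed \<sigma>_one)
qed (use e_commute assms in \<open>simp_all add: clifford_twist_def \<sigma>_one e_closed\<close>)

text \<open>Commutation factors multiply. Besides ordered products, this serves the product of a
  monomial with the adjoint of another in the trace form.\<close>

lemma twist_mult:
  assumes "x \<in> carrier R" "y \<in> carrier R" "z \<in> carrier R"
    and xy: "x \<otimes> y = \<sigma> a \<otimes> (y \<otimes> x)" and xz: "x \<otimes> z = \<sigma> b \<otimes> (z \<otimes> x)"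
  shows "x \<otimes> (y \<otimes> z) = \<sigma> (a * b) \<otimes> ((y \<otimes> z) \<otimes> x)"
proof -
  have "x \<otimes> (y \<otimes> z) = (x \<otimes> y) \<otimes> z" using assms(1-3) by (simp add: m_assoc)
  also have "\<dots> = \<sigma> a \<otimes> (y \<otimes> (x \<otimes> z))" unfolding xy using assms(1-3) by (simp add: m_assoc)
  also have "\<dots> = \<sigma> a \<otimes> (\<sigma> b \<otimes> (y \<otimes> (z \<otimes> x)))" unfolding xz using assms(1-3) by (simp add: mult_\<sigma>[of y])
  also have "\<dots> = \<sigma> (a * b) \<otimes> ((y \<otimes> z) \<otimes> x)" using assms(1-3) by (simp add: \<sigma>_\<sigma> m_assoc)
  finally show ?thesis .
qed

lemma twist_pow:
  fixes n :: nat
  assumes "x \<in> carrier R" "y \<in> carrier R" "x \<otimes> y = \<sigma> c \<otimes> (y \<otimes> x)"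
  shows "x \<otimes> y [^] n = \<sigma> (c ^ n) \<otimes> (y [^] n \<otimes> x)"
proof (induction n)
  case (Suc n)
  from twist_mult[OF assms(1) _ assms(2) this assms(3)] assms show ?case
    by (simp add: mult.commute)
qed (use assms in \<open>simp add: \<sigma>_one\<close>)

definition ordered_prod :: "(nat \<Rightarrow> nat) \<Rightarrow> nat list \<Rightarrow> 'a" where
  "ordered_prod j ks = foldr (\<lambda>k x. (e k [^] j k) \<otimes> x) ks \<one>"

definition basis :: "(nat \<Rightarrow> nat) \<Rightarrow> 'a" where
  "basis j = ordered_prod j [1..<d + 1]"

lemma ordered_prod_simps:
  "ordered_prod j [] = \<one>" "ordered_prod j (k # ks) = (e k [^] j k) \<otimes> ordered_prod j ks"
  by (simp_all add: ordered_prod_def)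

lemma ordered_prod_closed: "set ks \<subseteq> {1..d} \<Longrightarrow> ordered_prod j ks \<in> carrier R"
  by (induction ks) (simp_all add: ordered_prod_simps e_closed)

lemma ordered_prod_cong: "(\<And>k. k \<in> set ks \<Longrightarrow> j k = j' k) \<Longrightarrow> ordered_prod j ks = ordered_prod j' ks"
  by (induction ks) (simp_all add: ordered_prod_simps)

lemma basis_closed: "basis j \<in> carrier R"
  unfolding basis_def by (rule ordered_prod_closed) auto

lemma basis_zero: "basis (\<lambda>k\<in>{1..d}. 0) = \<one>"
proof -
  have *: "set ks \<subseteq> {1..d} \<Longrightarrow> ordered_prod (\<lambda>k\<in>{1..d}. 0) ks = \<one>" for ks
    by (induction ks) (simp_all add: ordered_prod_simps)
  show ?thesis unfolding basis_def by (rule *) auto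
qed

lemma twist_ordered_prod:
  assumes "k \<in> {1..d}" "set ls \<subseteq> {1..d}"
  shows "e k \<otimes> ordered_prod j ls = \<sigma> (\<Prod>l\<leftarrow>ls. clifford_twist m k l ^ j l) \<otimes> (ordered_prod j ls \<otimes> e k)"
  using assms(2)
proof (induction ls)
  case (Cons l ls)
  have "e k \<otimes> e l [^] j l = \<sigma> (clifford_twist m k l ^ j l) \<otimes> (e l [^] j l \<otimes> e k)"
    using Cons.prems assms by (intro twist_pow twist_commute) (simp_all add: e_closed)
  from twist_mult[OF _ _ _ this Cons.IH] show ?case
    using Cons.prems assms by (simp add: ordered_prod_simps e_closed ordered_prod_closed)
qed (use assms in \<open>simp add: ordered_prod_simps \<sigma>_one e_closed\<close>)

lemma e_pow_mod: "k \<in> {1..d} \<Longrightarrow> e k [^] (n mod m) = e k [^] n"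
proof -
  assume k: "k \<in> {1..d}"
  have "e k [^] n = e k [^] (m * (n div m) + n mod m)" by simp
  also have "\<dots> = (e k [^] m) [^] (n div m) \<otimes> e k [^] (n mod m)"
    using k by (simp only: nat_pow_mult[symmetric] nat_pow_pow e_closed)
  finally show ?thesis using k by (simp add: e_pow e_closed nat_pow_one)
qed

text \<open>The generator passes the factors in front of its own power at the cost of scalars and is
  absorbed there, the exponent being reduced by \<open>e_pow\<close>. The scalar stays existential
  because only membership in the span matters.\<close>

lemma e_mult_ordered_prod:
  assumes j': "j' k = Suc (j k) mod m" "\<And>i. i \<noteq> k \<Longrightarrow> j' i = j i"
    and "k \<in> set ls" "set ls \<subseteq> {1..d}" "distinct ls"
  shows "\<exists>c. e k \<otimes> ordered_prod j ls = \<sigma> c \<otimes> ordered_prod j' ls"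
  using assms(3-5)
proof (induction ls)
  case (Cons i ls)
  have ls: "set ls \<subseteq> {1..d}" "distinct ls" "i \<in> {1..d}" "k \<in> {1..d}" "i \<notin> set ls"
    using Cons.prems by auto
  have k: "e k \<in> carrier R" and i: "e i \<in> carrier R"
    using ls by (simp_all add: e_closed)
  have P: "ordered_prod j ls \<in> carrier R" for j
    by (rule ordered_prod_closed[OF ls(1)])
  show ?case
  proof (cases "i = k")
    case True
    then have "ordered_prod j ls = ordered_prod j' ls"
      using ls j'(2) by (intro ordered_prod_cong) metis
    moreover have "e k \<otimes> (e k [^] j k \<otimes> ordered_prod j ls) = e k [^] Suc (j k) \<otimes> ordered_prod j ls"
      unfolding nat_pow_Suc2[OF k] using k P by (simp only: m_assoc nat_pow_closed)
    moreover have "e k [^] j' k = e k [^] Suc (j k)"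
      unfolding j'(1) by (rule e_pow_mod[OF ls(4)])
    ultimately have "e k \<otimes> ordered_prod j (i # ls) = \<sigma> 1 \<otimes> ordered_prod j' (i # ls)"
      using True k P by (simp add: ordered_prod_simps \<sigma>_one del: nat_pow_Suc)
    then show ?thesis by blast
  next
    case False
    then obtain c where c: "e k \<otimes> ordered_prod j ls = \<sigma> c \<otimes> ordered_prod j' ls"
      using Cons.IH[OF _ ls(1,2)] Cons.prems(1) by auto
    let ?t = "clifford_twist m k i ^ j i"
    have t: "e k \<otimes> e i [^] j i = \<sigma> ?t \<otimes> (e i [^] j i \<otimes> e k)"
      using ls by (intro twist_pow twist_commute i k)
    have "e k \<otimes> (e i [^] j i \<otimes> ordered_prod j ls) = (e k \<otimes> e i [^] j i) \<otimes> ordered_prod j ls"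
      using k i P by (simp add: m_assoc)
    also have "\<dots> = \<sigma> ?t \<otimes> (e i [^] j i \<otimes> (e k \<otimes> ordered_prod j ls))"
      unfolding t using k i P by (simp add: m_assoc)
    also have "\<dots> = \<sigma> (?t * c) \<otimes> (e i [^] j i \<otimes> ordered_prod j' ls)"
      unfolding c using k i P by (simp add: mult_\<sigma>[of "e i [^] j i"] \<sigma>_\<sigma>)
    finally have "e k \<otimes> ordered_prod j (i # ls) = \<sigma> (?t * c) \<otimes> ordered_prod j' (i # ls)"
      using False by (simp add: ordered_prod_simps j'(2))
    then show ?thesis by blast
  qed
qed simp

abbreviation lin_comb :: "((nat \<Rightarrow> nat) \<Rightarrow> complex) \<Rightarrow> 'a" where
  "lin_comb u \<equiv> \<Oplus>j\<in>gca_indices m d. \<sigma> (u j) \<otimes> basis j"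

lemma finite_gca_indices: "finite (gca_indices m d)"
  by (simp add: gca_indices_def finite_PiE)

text \<open>The inductive form lets stability under scalars and generators be checked on scaled
  monomials and sums; \<open>span_lin_comb\<close> recovers a coefficient function.\<close>

inductive_set span :: "'a set" where
  span_basis: "j \<in> gca_indices m d \<Longrightarrow> \<sigma> c \<otimes> basis j \<in> span"
| span_add: "x \<in> span \<Longrightarrow> y \<in> span \<Longrightarrow> x \<oplus> y \<in> span"

lemma span_closed: "x \<in> span \<Longrightarrow> x \<in> carrier R"
  by (induction rule: span.induct) (simp_all add: basis_closed)

lemma span_lin_comb: "x \<in> span \<Longrightarrow> \<exists>u. x = lin_comb u"
proof (induction rule: span.induct)
  case (span_basis j c)
  let ?u = "\<lambda>i. if i = j then c else 0" and ?J = "gca_indices m d"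
  have "(\<Oplus>i\<in>?J - {j}. \<sigma> (?u i) \<otimes> basis i) = (\<Oplus>i\<in>?J - {j}. \<zero>)"
    by (rule finsum_cong') (auto simp: \<sigma>_zero basis_closed)
  then have "(\<Oplus>i\<in>insert j (?J - {j}). \<sigma> (?u i) \<otimes> basis i) = \<sigma> c \<otimes> basis j"
    using finite_gca_indices by (subst finsum_insert) (simp_all add: basis_closed finsum_zero)
  moreover have "insert j (?J - {j}) = ?J" using span_basis by auto
  ultimately show ?case by (intro exI[of _ ?u]) simp
next
  case (span_add x y)
  then obtain u v where uv: "x = lin_comb u" "y = lin_comb v" by blast
  have "\<sigma> (u j + v j) \<otimes> basis j = \<sigma> (u j) \<otimes> basis j \<oplus> \<sigma> (v j) \<otimes> basis j" for j
    by (simp add: \<sigma>_add l_distr basis_closed)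
  then have "lin_comb (\<lambda>j. u j + v j) = lin_comb u \<oplus> lin_comb v"
    by (simp add: finsum_addf basis_closed)
  then show ?case unfolding uv by (intro exI[of _ "\<lambda>j. u j + v j"]) simp
qed

lemma span_\<sigma>: "x \<in> span \<Longrightarrow> \<sigma> c \<otimes> x \<in> span"
proof (induction rule: span.induct)
  case (span_basis j a)
  then show ?case using span.span_basis[of j "c * a"] by (simp add: \<sigma>_\<sigma> basis_closed)
next
  case (span_add x y)
  then show ?case using span.span_add[of "\<sigma> c \<otimes> x" "\<sigma> c \<otimes> y"] by (simp add: r_distr span_closed)
qed

lemma span_e: "x \<in> span \<Longrightarrow> k \<in> {1..d} \<Longrightarrow> e k \<otimes> x \<in> span"
proof (induction rule: span.induct)
  case (span_basis j a)
  define j' where "j' = j(k := Suc (j k) mod m)"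
  have "\<exists>c. e k \<otimes> basis j = \<sigma> c \<otimes> basis j'"
    unfolding basis_def using span_basis(2) by (intro e_mult_ordered_prod) (auto simp: j'_def)
  then obtain c where c: "e k \<otimes> basis j = \<sigma> c \<otimes> basis j'" ..
  have "Suc (j k) mod m \<le> m - 1"
    using mod_less_divisor[OF m_pos, of "Suc (j k)"] by linarith
  then have "j' \<in> gca_indices m d"
    using span_basis by (auto simp: gca_indices_def PiE_iff extensional_def j'_def)
  from span.span_basis[OF this, of "a * c"] show ?case
    using span_basis(2) by (simp add: mult_\<sigma>[of "e k"] e_closed basis_closed c \<sigma>_\<sigma>)
next
  case (span_add x y)
  then show ?case using span.span_add[of "e k \<otimes> x" "e k \<otimes> y"] by (simp add: r_distr span_closed e_closed)
qed

lemma zero_index: "(\<lambda>k\<in>{1..d}. 0) \<in> gca_indices m d"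
  by (simp add: gca_indices_def)

lemma span_one: "\<one> \<in> span"
  using span_basis[OF zero_index, of 1] unfolding basis_zero \<sigma>_one by simp

end

section \<open>Passage to the quotient by the Clifford relations\<close>

lemma ring_hom_pow:
  assumes "ring R" "ring S" "h \<in> ring_hom R S" "x \<in> carrier R"
  shows "h (x [^]\<^bsub>R\<^esub> n) = h x [^]\<^bsub>S\<^esub> (n :: nat)"
proof -
  interpret R: ring R by fact
  interpret S: ring S by fact
  show ?thesis using assms(3,4)
    by (induction n) (simp_all add: ring_hom_one ring_hom_mult)
qed

lemma ring_hom_minus:
  assumes "ring R" "ring S" "h \<in> ring_hom R S" "x \<in> carrier R" "y \<in> carrier R"
  shows "h (x \<ominus>\<^bsub>R\<^esub> y) = h x \<ominus>\<^bsub>S\<^esub> h y"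
proof -
  interpret ring_hom_ring R S h
    using assms by (intro ring_hom_ringI2)
  show ?thesis using assms by (simp add: a_minus_def)
qed

lemma ring_hom_finsum:
  assumes "ring R" "ring S" "h \<in> ring_hom R S" "finite J" "\<And>j. j \<in> J \<Longrightarrow> f j \<in> carrier R"
  shows "h (finsum R f J) = finsum S (\<lambda>j. h (f j)) J"
proof -
  interpret ring_hom_ring R S h
    using assms by (intro ring_hom_ringI2)
  show ?thesis using assms(4,5)
  proof (induction J)
    case (insert x J)
    then have "f \<in> J \<rightarrow> carrier R" "(\<lambda>j. h (f j)) \<in> J \<rightarrow> carrier S" by auto
    with insert show ?case by (simp add: R.finsum_insert S.finsum_insert)
  qed simp
qed

lemma gca_relations_closed: "gca_relations m d \<subseteq> carrier (free_alg d)"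
proof -
  interpret ring "free_alg d" by (rule ring_free_alg)
  show ?thesis
    by (auto simp: gca_relations_def free_gen_closed free_scalar_closed)
qed

lemma ideal_gca_ideal: "ideal (gca_ideal m d) (free_alg d)"
  unfolding gca_ideal_def by (rule ring.genideal_ideal[OF ring_free_alg gca_relations_closed])

lemma ring_gca: "ring (gca m d)"
  unfolding gca_def by (rule ideal.quotient_is_ring[OF ideal_gca_ideal])

abbreviation gca_proj :: "nat \<Rightarrow> nat \<Rightarrow> (nat list \<Rightarrow> complex) \<Rightarrow> (nat list \<Rightarrow> complex) set" where
  "gca_proj m d f \<equiv> gca_ideal m d +>\<^bsub>free_alg d\<^esub> f"

lemma gca_proj_hom: "gca_proj m d \<in> ring_hom (free_alg d) (gca m d)"
  unfolding gca_def by (rule ideal.rcos_ring_hom[OF ideal_gca_ideal])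

lemma carrier_gca: "carrier (gca m d) = gca_proj m d ` carrier (free_alg d)"
  unfolding gca_def FactRing_def A_RCOSETS_defs a_r_coset_def by auto

lemma gca_proj_eq_iff:
  assumes "f \<in> carrier (free_alg d)" "g \<in> carrier (free_alg d)"
  shows "gca_proj m d f = gca_proj m d g \<longleftrightarrow> f \<ominus>\<^bsub>free_alg d\<^esub> g \<in> gca_ideal m d"
  using ring.quotient_eq_iff_same_a_r_cos[OF ring_free_alg ideal_gca_ideal assms] by simp

lemma gca_proj_relation:
  assumes "f \<ominus>\<^bsub>free_alg d\<^esub> g \<in> gca_relations m d" "f \<in> carrier (free_alg d)" "g \<in> carrier (free_alg d)"
  shows "gca_proj m d f = gca_proj m d g"
proof (rule iffD2[OF gca_proj_eq_iff[OF assms(2,3)]])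
  show "f \<ominus>\<^bsub>free_alg d\<^esub> g \<in> gca_ideal m d"
    unfolding gca_ideal_def
    by (rule subsetD[OF ring.genideal_self[OF ring_free_alg gca_relations_closed] assms(1)])
qed

lemma clifford_relations_gca:
  assumes "m > 0"
  shows "clifford_relations (gca m d) (gca_scalar m d) (gca_gen m d) m d"
proof -
  interpret F: ring "free_alg d" by (rule ring_free_alg)
  interpret ring_hom_ring "free_alg d" "gca m d" "gca_proj m d"
    by (rule ring_hom_ringI2[OF ring_free_alg ring_gca gca_proj_hom])
  show ?thesis
  proof (unfold_locales, unfold gca_scalar_def gca_gen_def)
    show "gca_proj m d (free_scalar c) \<in> carrier (gca m d)" for c
      by (simp add: free_scalar_closed)
    show "gca_proj m d (free_scalar 1) = \<one>\<^bsub>gca m d\<^esub>"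
      by (simp flip: free_one_eq_scalar[of d])
    have "free_scalar (a * b) = free_scalar a \<otimes>\<^bsub>free_alg d\<^esub> free_scalar b" for a b
      by (simp add: free_scalar_mult) (simp add: free_scalar_def if_distrib fun_eq_iff)
    then show "gca_proj m d (free_scalar (a * b)) = gca_proj m d (free_scalar a) \<otimes>\<^bsub>gca m d\<^esub> gca_proj m d (free_scalar b)" for a b
      by (simp add: free_scalar_closed)
    have "free_scalar (a + b) = free_scalar a \<oplus>\<^bsub>free_alg d\<^esub> free_scalar b" for a b
      by (simp add: free_alg_simps free_scalar_def fun_eq_iff)
    then show "gca_proj m d (free_scalar (a + b)) = gca_proj m d (free_scalar a) \<oplus>\<^bsub>gca m d\<^esub> gca_proj m d (free_scalar b)" for a b
      by (simp add: free_scalar_closed)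
    show "x \<otimes>\<^bsub>gca m d\<^esub> gca_proj m d (free_scalar c) = gca_proj m d (free_scalar c) \<otimes>\<^bsub>gca m d\<^esub> x"
      if x: "x \<in> carrier (gca m d)" for x c
    proof -
      obtain f where f: "f \<in> carrier (free_alg d)" "x = gca_proj m d f"
        using x by (auto simp: carrier_gca)
      have "f \<otimes>\<^bsub>free_alg d\<^esub> free_scalar c = free_scalar c \<otimes>\<^bsub>free_alg d\<^esub> f"
        by (simp add: free_scalar_mult free_mult_scalar mult.commute)
      with f show ?thesis
        using hom_mult[OF f(1) free_scalar_closed, of c] hom_mult[OF free_scalar_closed f(1), of c] by simp
    qed
    show "gca_proj m d (free_gen k) \<in> carrier (gca m d)" if "k \<in> {1..d}" for k
      using that by (simp add: free_gen_closed)
    show "gca_proj m d (free_gen k) [^]\<^bsub>gca m d\<^esub> m = \<one>\<^bsub>gca m d\<^esub>" if k: "k \<in> {1..d}" for k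
    proof -
      have "gca_proj m d (free_gen k [^]\<^bsub>free_alg d\<^esub> m) = gca_proj m d \<one>\<^bsub>free_alg d\<^esub>"
        using k by (intro gca_proj_relation) (auto simp: gca_relations_def free_gen_closed)
      then show ?thesis
        using k ring_hom_pow[OF ring_free_alg ring_gca gca_proj_hom free_gen_closed[OF k]] by simp
    qed
    show "gca_proj m d (free_gen k) \<otimes>\<^bsub>gca m d\<^esub> gca_proj m d (free_gen l) =
        gca_proj m d (free_scalar (root_omega m)) \<otimes>\<^bsub>gca m d\<^esub>
          (gca_proj m d (free_gen l) \<otimes>\<^bsub>gca m d\<^esub> gca_proj m d (free_gen k))"
      if kl: "k \<in> {1..d}" "l \<in> {1..d}" "k < l" for k l
    proof -
      have "gca_proj m d (free_gen k \<otimes>\<^bsub>free_alg d\<^esub> free_gen l) =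
          gca_proj m d (free_scalar (root_omega m) \<otimes>\<^bsub>free_alg d\<^esub> (free_gen l \<otimes>\<^bsub>free_alg d\<^esub> free_gen k))"
      proof (rule gca_proj_relation)
        show "free_gen k \<otimes>\<^bsub>free_alg d\<^esub> free_gen l \<ominus>\<^bsub>free_alg d\<^esub>
          free_scalar (root_omega m) \<otimes>\<^bsub>free_alg d\<^esub> (free_gen l \<otimes>\<^bsub>free_alg d\<^esub> free_gen k) \<in> gca_relations m d"
          unfolding gca_relations_def using kl
          by (intro UnI2 CollectI exI[of _ k] exI[of _ l] conjI refl)
      qed (use kl in \<open>simp_all add: free_gen_closed free_scalar_closed\<close>)
      then show ?thesis using kl by (simp add: free_gen_closed free_scalar_closed)
    qed
  qed (fact assms)
qed

definition free_word :: "nat list \<Rightarrow> nat list \<Rightarrow> complex" where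
  "free_word w = (\<lambda>v. if v = w then 1 else 0)"

lemma free_word_closed: "w \<in> lists {1..d} \<Longrightarrow> free_word w \<in> carrier (free_alg d)"
  by (auto simp: free_alg_simps free_word_def)

lemma free_word_Cons: "free_word (k # w) = free_gen k \<otimes>\<^bsub>free_alg d\<^esub> free_word w"
proof
  fix v
  have "(\<Sum>i\<le>length v. free_gen k (take i v) * free_word w (drop i v)) = free_word (k # w) v"
  proof (cases v)
    case (Cons a v')
    have "(\<Sum>i\<le>length v. free_gen k (take i v) * free_word w (drop i v)) =
        (\<Sum>i\<le>length v. if i = 1 then free_word (k # w) v else 0)"
    proof (rule sum.cong[OF refl])
      fix i assume "i \<in> {..length v}"
      then show "free_gen k (take i v) * free_word w (drop i v) = (if i = 1 then free_word (k # w) v else 0)"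
        using \<open>i \<in> {..length v}\<close> by (cases i; cases v') (auto simp: Cons free_gen_def free_word_def)
    qed
    also have "\<dots> = free_word (k # w) v"
    proof -
      have "1 \<in> {..length v}" using Cons by simp
      then show ?thesis by (simp only: sum.delta[OF finite_atMost] if_True)
    qed
    finally show ?thesis .
  qed (simp add: free_gen_def free_word_def)
  then show "free_word (k # w) v = (free_gen k \<otimes>\<^bsub>free_alg d\<^esub> free_word w) v"
    by (simp add: free_alg_simps)
qed

text \<open>The span contains 1 and is stable under left multiplication by generators, hence
  contains every word; a general element is a finite combination of words.\<close>

lemma gca_span:
  assumes "m > 0" "x \<in> carrier (gca m d)"
  shows "x \<in> clifford_relations.span (gca m d) (gca_scalar m d) (gca_gen m d) m d"
proof -
  interpret clifford_relations "gca m d" "gca_scalar m d" "gca_gen m d" m d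
    by (rule clifford_relations_gca[OF assms(1)])
  interpret h: ring_hom_ring "free_alg d" "gca m d" "gca_proj m d"
    by (rule ring_hom_ringI2[OF ring_free_alg ring_gca gca_proj_hom])
  have word: "w \<in> lists {1..d} \<Longrightarrow> gca_proj m d (free_word w) \<in> span" for w
  proof (induction w)
    case Nil
    have "free_word [] = \<one>\<^bsub>free_alg d\<^esub>" by (simp add: free_word_def free_alg_simps)
    then show ?case using span_one by simp
  next
    case (Cons k w)
    then have "gca_gen m d k \<otimes>\<^bsub>gca m d\<^esub> gca_proj m d (free_word w) \<in> span"
      by (intro span_e) auto
    moreover have "gca_proj m d (free_word (k # w)) = gca_gen m d k \<otimes>\<^bsub>gca m d\<^esub> gca_proj m d (free_word w)"
      using Cons by (simp add: free_word_Cons[of k w d] gca_gen_def free_gen_closed free_word_closed)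
    ultimately show ?case by (simp only:)
  qed
  \<comment> \<open>Induction on the support, removing one word at a time. For empty support the
    element is 0, which lies in the span as 0 times 1.\<close>
  have "finite S \<Longrightarrow> {w. f w \<noteq> 0} = S \<Longrightarrow> S \<subseteq> lists {1..d} \<Longrightarrow> gca_proj m d f \<in> span" for S f
  proof (induction S arbitrary: f rule: finite_induct)
    case empty
    then have "f = free_scalar 0" by (auto simp: free_scalar_def)
    then have "gca_proj m d f = gca_scalar m d 0 \<otimes>\<^bsub>gca m d\<^esub> \<one>\<^bsub>gca m d\<^esub>"
      by (simp add: gca_scalar_def free_scalar_closed)
    then show ?case using span_\<sigma>[OF span_one, of 0] by (simp only:)
  next
    case (insert w S)
    define f' where "f' = f(w := 0)"
    let ?g = "free_scalar (f w) \<otimes>\<^bsub>free_alg d\<^esub> free_word w"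
    have supp: "{v. f' v \<noteq> 0} = S" using insert by (auto simp: f'_def)
    have f: "f' \<in> carrier (free_alg d)" using supp insert by (simp add: free_alg_simps)
    have w: "free_word w \<in> carrier (free_alg d)" using insert by (intro free_word_closed) simp
    have "f = f' \<oplus>\<^bsub>free_alg d\<^esub> ?g"
      unfolding free_scalar_mult unfolding free_alg_simps(5)
      by (rule ext) (simp add: free_word_def f'_def)
    then have "gca_proj m d f = gca_proj m d (f' \<oplus>\<^bsub>free_alg d\<^esub> ?g)" by (rule arg_cong)
    also have "\<dots> = gca_proj m d f' \<oplus>\<^bsub>gca m d\<^esub> gca_proj m d ?g"
      using f w by (intro h.hom_add) (simp_all add: free_scalar_closed)
    finally have "gca_proj m d f = gca_proj m d f' \<oplus>\<^bsub>gca m d\<^esub> gca_proj m d ?g" .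
    moreover have "gca_proj m d ?g = gca_scalar m d (f w) \<otimes>\<^bsub>gca m d\<^esub> gca_proj m d (free_word w)"
      using w by (simp add: gca_scalar_def free_scalar_closed)
    ultimately show ?case
      using insert.IH[OF supp] insert.prems(2) word[of w] by (simp add: span_add span_\<sigma>)
  qed
  then show ?thesis using assms(2) by (auto simp: carrier_gca free_alg_simps)
qed

section \<open>The matrix representation\<close>

lemma root_omega_pow_eq_iff:
  assumes "m > 0"
  shows "root_omega m ^ a = root_omega m ^ b \<longleftrightarrow> int m dvd int a - int b"
proof -
  have one: "root_omega m ^ n = 1 \<longleftrightarrow> m dvd n" for n
    using complex_root_unity_eq_1[of m n] assms
    by (simp add: root_omega_def exp_of_nat_mult[symmetric] mult_ac)
  have nz: "root_omega m \<noteq> 0" using norm_root_omega[of m] by auto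
  have *: "root_omega m ^ (a + n) = root_omega m ^ a \<longleftrightarrow> int m dvd int n" for a n
    using nz one[of n] by (simp add: power_add)
  show ?thesis
  proof (cases "a \<le> b")
    case True
    then obtain n where "b = a + n" using le_Suc_ex by blast
    then show ?thesis using *[of a n] by (simp add: eq_commute)
  next
    case False
    then obtain n where "a = b + n" using le_Suc_ex[of b a] by auto
    then show ?thesis using *[of b n] by simp
  qed
qed

text \<open>Indices beyond k contribute powers of omega, those before k powers of its inverse, and k
  itself contributes 1.\<close>

lemma twist_product:
  assumes "k \<in> {1..d}"
  shows "(\<Prod>l\<leftarrow>[1..<d + 1]. clifford_twist m k l ^ j l) =
    root_omega m ^ (\<Sum>l\<in>{k<..d}. j l) * inverse (root_omega m) ^ (\<Sum>l\<in>{1..<k}. j l)"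
proof -
  let ?g = "\<lambda>l. clifford_twist m k l ^ j l"
  have "(\<Prod>l\<leftarrow>[1..<d + 1]. ?g l) = (\<Prod>l\<in>{1..<d + 1}. ?g l)"
    by (simp only: prod.distinct_set_conv_list[OF distinct_upt, symmetric] set_upt)
  also have "{1..<d + 1} = insert k ({k<..d} \<union> {1..<k})" using assms by auto
  also have "prod ?g (insert k ({k<..d} \<union> {1..<k})) = ?g k * (prod ?g {k<..d} * prod ?g {1..<k})"
    by (subst prod.insert) (auto intro: prod.union_disjoint)
  also have "prod ?g {k<..d} = root_omega m ^ (\<Sum>l\<in>{k<..d}. j l)"
    unfolding power_sum by (rule prod.cong) (auto simp: clifford_twist_def)
  also have "prod ?g {1..<k} = inverse (root_omega m) ^ (\<Sum>l\<in>{1..<k}. j l)"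
    unfolding power_sum by (rule prod.cong) (auto simp: clifford_twist_def)
  finally show ?thesis by (simp add: clifford_twist_def)
qed

text \<open>Consecutive twists differ by \<open>j\<^sub>k + j\<^sub>k\<^sub>+\<^sub>1\<close>, so they determine \<open>j\<close> up to an alternating shift; for
  even \<open>d\<close> the first twist kills the shift.\<close>

lemma twist_product_inj:
  assumes m: "m > 0" and d: "even d" and ij: "i \<in> gca_indices m d" "j \<in> gca_indices m d"
    and eq: "\<And>k. k \<in> {1..d} \<Longrightarrow> (\<Prod>l\<leftarrow>[1..<d + 1]. clifford_twist m k l ^ i l) =
      (\<Prod>l\<leftarrow>[1..<d + 1]. clifford_twist m k l ^ j l)"
  shows "i = j"
proof -
  define \<delta> where "\<delta> l = int (i l) - int (j l)" for l
  define D where "D k = (\<Sum>l\<in>{k<..d}. \<delta> l) - (\<Sum>l\<in>{1..<k}. \<delta> l)" for k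
  have D: "int m dvd D k" if k: "k \<in> {1..d}" for k
  proof -
    let ?w = "root_omega m"
    have nz: "?w \<noteq> 0" using norm_root_omega[of m] by auto
    have "?w ^ (\<Sum>l\<in>{k<..d}. i l) * inverse ?w ^ (\<Sum>l\<in>{1..<k}. i l) =
        ?w ^ (\<Sum>l\<in>{k<..d}. j l) * inverse ?w ^ (\<Sum>l\<in>{1..<k}. j l)"
      using eq[OF k] unfolding twist_product[OF k] .
    \<comment> \<open>Moving the inverse powers across leaves natural exponents on both sides, as
      \<open>root_omega_pow_eq_iff\<close> requires.\<close>
    then have "?w ^ ((\<Sum>l\<in>{k<..d}. i l) + (\<Sum>l\<in>{1..<k}. j l)) = ?w ^ ((\<Sum>l\<in>{k<..d}. j l) + (\<Sum>l\<in>{1..<k}. i l))"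
      using nz by (simp add: power_add power_inverse field_simps)
    then show ?thesis
      unfolding root_omega_pow_eq_iff[OF m] D_def \<delta>_def by (simp add: sum_subtractf algebra_simps)
  qed
  have step_dvd: "int m dvd \<delta> k + \<delta> (Suc k)" if "1 \<le> k" "k < d" for k
  proof -
    have "{k<..d} = insert (Suc k) {Suc k<..d}" "{1..<Suc k} = insert k {1..<k}" using that by auto
    then have "D k - D (Suc k) = \<delta> k + \<delta> (Suc k)" by (simp add: D_def)
    moreover have "int m dvd D k - D (Suc k)" using that by (intro dvd_diff D) auto
    ultimately show ?thesis by simp
  qed
  \<comment> \<open>Evenness of d enters through this claim: the sum over 1..d splits into
    consecutive pairs, each divisible by m.\<close>
  have pairs: "2 * r \<le> d \<Longrightarrow> int m dvd (\<Sum>l\<in>{1..2 * r}. \<delta> l)" for r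
  proof (induction r)
    case (Suc r)
    have "{1..2 * Suc r} = insert (Suc (Suc (2 * r))) (insert (Suc (2 * r)) {1..2 * r})" by auto
    then have "(\<Sum>l\<in>{1..2 * Suc r}. \<delta> l) = (\<delta> (Suc (2 * r)) + \<delta> (Suc (Suc (2 * r)))) + (\<Sum>l\<in>{1..2 * r}. \<delta> l)"
      by simp
    moreover have "int m dvd (\<Sum>l\<in>{1..2 * r}. \<delta> l)" using Suc by simp
    moreover have "int m dvd \<delta> (Suc (2 * r)) + \<delta> (Suc (Suc (2 * r)))" using Suc.prems by (intro step_dvd) auto
    ultimately show ?case by (simp only: dvd_add)
  qed simp
  have \<delta>1: "int m dvd \<delta> 1" if "1 \<le> d"
  proof -
    have "int m dvd (\<Sum>l\<in>{1..d}. \<delta> l)" using pairs[of "d div 2"] d by simp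
    moreover have "int m dvd D 1" using that by (intro D) simp
    \<comment> \<open>D 1 is the total without its first term, so the difference isolates
      \<open>\<delta> 1\<close>.\<close>
    ultimately have "int m dvd (\<Sum>l\<in>{1..d}. \<delta> l) - D 1" by (rule dvd_diff)
    moreover have "{1..d} = insert 1 {1<..d}" using that by auto
    then have "(\<Sum>l\<in>{1..d}. \<delta> l) - D 1 = \<delta> 1" by (simp add: D_def)
    ultimately show ?thesis by simp
  qed
  have \<delta>: "1 \<le> k \<Longrightarrow> k \<le> d \<Longrightarrow> int m dvd \<delta> k" for k
  proof (induction k rule: dec_induct)
    case base
    then show ?case by (rule \<delta>1)
  next
    case (step k)
    have "int m dvd (\<delta> k + \<delta> (Suc k)) - \<delta> k"
      using step by (intro dvd_diff step_dvd) auto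
    then show ?case by simp
  qed
  show ?thesis
  proof (rule PiE_ext[OF ij[unfolded gca_indices_def]])
    fix k assume k: "k \<in> {1..d}"
    then have "i k \<in> {0..m - 1}" "j k \<in> {0..m - 1}"
      using ij by (auto simp: gca_indices_def PiE_iff)
    then have "i k < m" "j k < m" using m by auto
    moreover have "int (i k) mod int m = int (j k) mod int m"
      using \<delta>[of k] k by (simp add: mod_eq_dvd_iff \<delta>_def)
    ultimately show "i k = j k" by simp
  qed
qed

section \<open>Unitary monomials and the trace form\<close>

locale clifford_matrices =
  fixes X :: "nat \<Rightarrow> complex ^ 'n ^ 'n" and m d :: nat
  assumes m: "m > 0" and d_even: "even d" and card_n: "CARD('n) = m ^ (d div 2)"
    and X_unitary: "\<And>k. conj_transpose (X k) ** X k = mat 1"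
    and X_pow: "\<And>k. k \<in> {1..d} \<Longrightarrow> matrix_pow (X k) m = mat 1"
    and X_commute: "\<And>k l. \<lbrakk>k \<in> {1..d}; l \<in> {1..d}; k < l\<rbrakk>
      \<Longrightarrow> X k ** X l = mat (root_omega m) ** (X l ** X k)"
begin

sublocale M: clifford_relations "matrix_ring :: (complex ^ 'n ^ 'n) ring" mat X m d
proof -
  interpret ring "matrix_ring :: (complex ^ 'n ^ 'n) ring" by (rule ring_matrix_ring)
  show "clifford_relations (matrix_ring :: (complex ^ 'n ^ 'n) ring) mat X m d"
  proof unfold_locales
    show "x \<otimes>\<^bsub>matrix_ring\<^esub> mat c = mat c \<otimes>\<^bsub>matrix_ring\<^esub> x" for x :: "complex ^ 'n ^ 'n" and c
      unfolding matrix_ring_simps by (rule mat_mult_commute)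
  qed (simp_all add: m mat_mult mat_add matrix_ring_pow X_pow X_commute)
qed

lemma X_unitary': "X k ** conj_transpose (X k) = mat 1"
  by (rule iffD1[OF matrix_left_right_inverse X_unitary])

lemma unitary_mult:
  "conj_transpose A ** A = mat 1 \<Longrightarrow> conj_transpose B ** B = mat 1 \<Longrightarrow>
    conj_transpose (A ** B) ** (A ** B) = mat (1 :: complex)"
proof -
  assume A: "conj_transpose A ** A = mat 1" and B: "conj_transpose B ** B = mat 1"
  have "conj_transpose (A ** B) ** (A ** B) = conj_transpose B ** (conj_transpose A ** A) ** B"
    by (simp only: conj_transpose_mult matrix_mul_assoc)
  then show ?thesis by (simp add: A B)
qed

lemma basis_unitary: "conj_transpose (M.basis j) ** M.basis j = mat 1"
proof -
  have pow: "conj_transpose (matrix_pow (X k) n) ** matrix_pow (X k) n = mat 1" for k n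
    by (induction n) (simp_all add: unitary_mult X_unitary)
  have "conj_transpose (M.ordered_prod j ks) ** M.ordered_prod j ks = mat 1" for ks
    by (induction ks) (simp_all add: M.ordered_prod_simps matrix_ring_pow unitary_mult pow)
  then show ?thesis by (simp add: M.basis_def)
qed

text \<open>Conjugation by X k preserves the trace but multiplies Y by c.\<close>

lemma trace_twisted:
  assumes "X k ** Y = mat c ** (Y ** X k)" "c \<noteq> 1"
  shows "trace Y = 0"
proof -
  have "trace Y = trace (conj_transpose (X k) ** (X k ** Y))"
    by (simp add: matrix_mul_assoc X_unitary)
  also have "\<dots> = trace ((X k ** Y) ** conj_transpose (X k))" by (rule trace_mul_sym)
  also have "(X k ** Y) ** conj_transpose (X k) = mat c ** Y"
    unfolding assms(1) by (simp add: X_unitary' flip: matrix_mul_assoc)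
  finally have "trace Y = c * trace Y" by (simp only: trace_mat_mult)
  with assms(2) show ?thesis by simp
qed

abbreviation twist :: "nat \<Rightarrow> (nat \<Rightarrow> nat) \<Rightarrow> complex" where
  "twist k j \<equiv> \<Prod>l\<leftarrow>[1..<d + 1]. clifford_twist m k l ^ j l"

lemma norm_twist: "cmod (twist k j) = 1"
proof -
  have "cmod (clifford_twist m k l) = 1" for l
    by (simp add: clifford_twist_def norm_root_omega norm_inverse)
  then have "cmod (\<Prod>l\<leftarrow>ls. clifford_twist m k l ^ j l) = 1" for ls
    by (induction ls) (simp_all add: norm_mult norm_power)
  then show ?thesis .
qed

lemma X_basis:
  assumes "k \<in> {1..d}"
  shows "X k ** M.basis j = mat (twist k j) ** (M.basis j ** X k)"
proof -
  have "set [1..<d + 1] \<subseteq> {1..d}" by auto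
  from M.twist_ordered_prod[OF assms this] show ?thesis
    unfolding M.basis_def matrix_ring_simps .
qed

text \<open>Adjoints in \<open>X_basis\<close> give a relation for the adjoint of X k. Since X k is
  unitary, multiplying by X k on both sides turns it into a relation for X k.\<close>

lemma X_conj_basis:
  assumes "k \<in> {1..d}"
  shows "X k ** conj_transpose (M.basis j) = mat (cnj (twist k j)) ** (conj_transpose (M.basis j) ** X k)"
proof -
  let ?E = "conj_transpose (M.basis j)" and ?H = "conj_transpose (X k)" and ?c = "cnj (twist k j)"
  have "conj_transpose (X k ** M.basis j) = conj_transpose (mat (twist k j) ** (M.basis j ** X k))"
    by (simp only: X_basis[OF assms])
  then have "?E ** ?H = ?H ** ?E ** mat ?c"
    by (simp only: conj_transpose_mult conj_transpose_mat)
  then have "X k ** (?E ** ?H) ** X k = X k ** (?H ** ?E ** mat ?c) ** X k" by (simp only:)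
  moreover have "X k ** (?E ** ?H) ** X k = X k ** ?E ** (?H ** X k)" by (simp only: matrix_mul_assoc)
  moreover have "X k ** (?H ** ?E ** mat ?c) ** X k = (X k ** ?H) ** ?E ** mat ?c ** X k" by (simp only: matrix_mul_assoc)
  ultimately have "X k ** ?E = ?E ** mat ?c ** X k"
    by (simp only: X_unitary X_unitary' matrix_mul_lid matrix_mul_rid)
  then show ?thesis by (simp only: mat_mult_commute[of ?E] matrix_mul_assoc)
qed

text \<open>The product has commutation factor \<open>cnj (twist k i) * twist k j\<close>. For
  numbers of modulus 1 this is 1 only if the twists agree, and \<open>twist_product_inj\<close>
  supplies a generator for which they differ.\<close>

lemma trace_basis_orthogonal:
  assumes "i \<in> gca_indices m d" "j \<in> gca_indices m d" "i \<noteq> j"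
  shows "trace (conj_transpose (M.basis i) ** M.basis j) = 0"
proof -
  obtain k where k: "k \<in> {1..d}" "twist k i \<noteq> twist k j"
    using twist_product_inj[OF m d_even assms(1,2)] assms(3) by auto
  have "X k ** (conj_transpose (M.basis i) ** M.basis j) =
      mat (cnj (twist k i) * twist k j) ** ((conj_transpose (M.basis i) ** M.basis j) ** X k)"
    using M.twist_mult[of "X k" "conj_transpose (M.basis i)" "M.basis j"] X_conj_basis[OF k(1), of i] X_basis[OF k(1), of j]
    by (simp only: matrix_ring_simps UNIV_I)
  moreover have "cnj (twist k i) * twist k j \<noteq> 1"
  proof
    assume *: "cnj (twist k i) * twist k j = 1"
    have "twist k i * cnj (twist k i) = 1"
      using norm_twist[of k i] by (simp only: complex_norm_square[symmetric]) simp
    then have "twist k i * (cnj (twist k i) * twist k j) = twist k j" by (simp only: mult.assoc[symmetric] mult_1_left)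
    with * k(2) show False by (simp only: mult_1_right) 
  qed
  ultimately show ?thesis by (rule trace_twisted)
qed

text \<open>Only the i-th term survives, and there unitarity leaves the trace of the
  identity.\<close>

lemma coeff_trace:
  assumes "i \<in> gca_indices m d"
  shows "trace (conj_transpose (M.basis i) ** (\<Sum>j\<in>gca_indices m d. mat (u j) ** M.basis j)) = u i * of_nat CARD('n)"
proof -
  let ?E = "conj_transpose (M.basis i)"
  have tr_sum: "trace (\<Sum>j\<in>J. F j) = (\<Sum>j\<in>J. trace (F j))" for J :: "(nat \<Rightarrow> nat) set" and F :: "(nat \<Rightarrow> nat) \<Rightarrow> complex ^ 'n ^ 'n"
    by (simp add: trace_def sum.swap[of _ J])
  have "?E ** (mat (u j) ** M.basis j) = mat (u j) ** (?E ** M.basis j)" for j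
    by (simp only: matrix_mul_assoc mat_mult_commute[of ?E])
  then have "trace (?E ** (\<Sum>j\<in>gca_indices m d. mat (u j) ** M.basis j)) =
      (\<Sum>j\<in>gca_indices m d. u j * trace (?E ** M.basis j))"
    by (simp only: matrix_mult_sum_right tr_sum trace_mat_mult)
  also have "\<dots> = (\<Sum>j\<in>gca_indices m d. if j = i then u i * of_nat CARD('n) else 0)"
  proof (rule sum.cong[OF refl])
    fix j assume "j \<in> gca_indices m d"
    then show "u j * trace (?E ** M.basis j) = (if j = i then u i * of_nat CARD('n) else 0)"
      using trace_basis_orthogonal[OF assms, of j] by (auto simp: basis_unitary trace_I)
  qed
  also have "\<dots> = u i * of_nat CARD('n)"
    using assms M.finite_gca_indices by simp
  finally show ?thesis .
qed

sublocale G: clifford_relations "gca m d" "gca_scalar m d" "gca_gen m d" m d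
  by (rule clifford_relations_gca[OF m])

text \<open>The kernel of evaluation is an ideal containing the relations, hence the ideal they
  generate.\<close>

lemma free_eval_gca_ideal:
  assumes "f \<in> gca_ideal m d"
  shows "free_eval X f = 0"
proof -
  interpret F: ring "free_alg d" by (rule ring_free_alg)
  interpret h: ring_hom_ring "free_alg d" "matrix_ring :: (complex ^ 'n ^ 'n) ring" "free_eval X"
    by (rule ring_hom_ringI2[OF ring_free_alg ring_matrix_ring free_eval_ring_hom])
  note hom_minus = ring_hom_minus[OF ring_free_alg ring_matrix_ring free_eval_ring_hom, unfolded matrix_ring_minus]
  have pow: "free_eval X (free_gen k [^]\<^bsub>free_alg d\<^esub> m \<ominus>\<^bsub>free_alg d\<^esub> \<one>\<^bsub>free_alg d\<^esub>) = 0" if k: "k \<in> {1..d}" for k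
  proof -
    note gen = free_gen_closed[OF k]
    have "free_eval X (free_gen k [^]\<^bsub>free_alg d\<^esub> m) = mat 1"
      using ring_hom_pow[OF ring_free_alg ring_matrix_ring free_eval_ring_hom gen, of X m]
      unfolding matrix_ring_pow free_eval_gen X_pow[OF k] .
    moreover have "free_eval X \<one>\<^bsub>free_alg d\<^esub> = mat 1"
      unfolding free_one_eq_scalar by (rule free_eval_scalar)
    ultimately show ?thesis
      unfolding hom_minus[OF F.nat_pow_closed[OF gen] F.one_closed] by simp
  qed
  have comm: "free_eval X (free_gen k \<otimes>\<^bsub>free_alg d\<^esub> free_gen l \<ominus>\<^bsub>free_alg d\<^esub>
        (free_scalar (root_omega m) \<otimes>\<^bsub>free_alg d\<^esub> (free_gen l \<otimes>\<^bsub>free_alg d\<^esub> free_gen k))) = 0"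
    if kl: "k \<in> {1..d}" "l \<in> {1..d}" "k < l" for k l
  proof -
    note gen = free_gen_closed[OF kl(1)] free_gen_closed[OF kl(2)]
    note closed = F.m_closed[OF gen] F.m_closed[OF gen(2,1)]
    have "free_eval X (free_gen k \<otimes>\<^bsub>free_alg d\<^esub> free_gen l) = X k ** X l"
      by (rule trans[OF free_eval_mult[OF gen]]) (simp only: free_eval_gen)
    also have "\<dots> = mat (root_omega m) ** (X l ** X k)" by (rule X_commute[OF kl])
    finally have lhs: "free_eval X (free_gen k \<otimes>\<^bsub>free_alg d\<^esub> free_gen l) = mat (root_omega m) ** (X l ** X k)" .
    have "free_eval X (free_gen l \<otimes>\<^bsub>free_alg d\<^esub> free_gen k) = X l ** X k"
      by (rule trans[OF free_eval_mult[OF gen(2,1)]]) (simp only: free_eval_gen)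
    then have rhs: "free_eval X (free_scalar (root_omega m) \<otimes>\<^bsub>free_alg d\<^esub> (free_gen l \<otimes>\<^bsub>free_alg d\<^esub> free_gen k)) =
        mat (root_omega m) ** (X l ** X k)"
      unfolding free_eval_mult[OF free_scalar_closed closed(2)] free_eval_scalar by (rule arg_cong)
    show ?thesis
      unfolding hom_minus[OF closed(1) F.m_closed[OF free_scalar_closed closed(2)]] lhs rhs by (rule diff_self)
  qed
  have "gca_ideal m d \<subseteq> a_kernel (free_alg d) matrix_ring (free_eval X)"
    unfolding gca_ideal_def
  proof (rule F.genideal_minimal[OF h.kernel_is_ideal])
    show "gca_relations m d \<subseteq> a_kernel (free_alg d) matrix_ring (free_eval X)"
    proof
      fix f assume f: "f \<in> gca_relations m d"
      then have "free_eval X f = 0"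
        unfolding gca_relations_def by (elim UnE CollectE exE conjE) (simp_all only: pow comm)
      then show "f \<in> a_kernel (free_alg d) matrix_ring (free_eval X)"
        unfolding a_kernel_def' matrix_ring_simps
        using subsetD[OF gca_relations_closed f] by (intro CollectI conjI)
    qed
  qed
  from subsetD[OF this assms] show ?thesis
    unfolding a_kernel_def' matrix_ring_simps by (elim CollectE conjE)
qed

section \<open>The representation induced on the quotient\<close>

definition rep :: "(nat list \<Rightarrow> complex) set \<Rightarrow> complex ^ 'n ^ 'n" where
  "rep U = free_eval X (SOME f. f \<in> carrier (free_alg d) \<and> gca_proj m d f = U)"

lemma rep_proj:
  assumes f: "f \<in> carrier (free_alg d)"
  shows "rep (gca_proj m d f) = free_eval X f"
proof -
  define g where "g = (SOME g. g \<in> carrier (free_alg d) \<and> gca_proj m d g = gca_proj m d f)"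
  have g: "g \<in> carrier (free_alg d) \<and> gca_proj m d g = gca_proj m d f"
    unfolding g_def by (rule someI[of _ f]) (simp add: f)
  then have "g \<ominus>\<^bsub>free_alg d\<^esub> f \<in> gca_ideal m d"
    using gca_proj_eq_iff[of g d f m] f by simp
  then have "free_eval X (g \<ominus>\<^bsub>free_alg d\<^esub> f) = 0" by (rule free_eval_gca_ideal)
  then have "free_eval X g = free_eval X f"
    using ring_hom_minus[OF ring_free_alg ring_matrix_ring free_eval_ring_hom, of g d f X] g f
    by (simp add: matrix_ring_minus)
  then show ?thesis by (simp add: rep_def g_def)
qed

lemma rep_hom: "rep \<in> ring_hom (gca m d) matrix_ring"
proof -
  interpret h: ring_hom_ring "free_alg d" "gca m d" "gca_proj m d"
    by (rule ring_hom_ringI2[OF ring_free_alg ring_gca gca_proj_hom])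
  have mult: "rep (x \<otimes>\<^bsub>gca m d\<^esub> y) = rep x ** rep y" and add: "rep (x \<oplus>\<^bsub>gca m d\<^esub> y) = rep x + rep y"
    if xy: "x \<in> carrier (gca m d)" "y \<in> carrier (gca m d)" for x y
  proof -
    obtain f g where fg: "f \<in> carrier (free_alg d)" "x = gca_proj m d f" "g \<in> carrier (free_alg d)" "y = gca_proj m d g"
      using xy by (auto simp: carrier_gca)
    have "rep (gca_proj m d (f \<otimes>\<^bsub>free_alg d\<^esub> g)) = free_eval X f ** free_eval X g"
      using fg by (subst rep_proj) (simp_all add: free_eval_mult[where d = d])
    then show "rep (x \<otimes>\<^bsub>gca m d\<^esub> y) = rep x ** rep y" using fg by (simp add: rep_proj)
    have "rep (gca_proj m d (f \<oplus>\<^bsub>free_alg d\<^esub> g)) = free_eval X f + free_eval X g"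
      using fg ring_hom_add[OF free_eval_ring_hom, of f d g X] by (subst rep_proj) simp_all
    then show "rep (x \<oplus>\<^bsub>gca m d\<^esub> y) = rep x + rep y" using fg by (simp add: rep_proj)
  qed
  have "rep \<one>\<^bsub>gca m d\<^esub> = mat 1"
    using rep_proj[OF h.R.one_closed] ring_hom_one[OF free_eval_ring_hom[of X d]] by simp
  with mult add show ?thesis by (intro ring_hom_memI) simp_all
qed

lemma rep_simps:
  "x \<in> carrier (gca m d) \<Longrightarrow> y \<in> carrier (gca m d) \<Longrightarrow> rep (x \<otimes>\<^bsub>gca m d\<^esub> y) = rep x ** rep y"
  "x \<in> carrier (gca m d) \<Longrightarrow> y \<in> carrier (gca m d) \<Longrightarrow> rep (x \<ominus>\<^bsub>gca m d\<^esub> y) = rep x - rep y"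
  "rep \<one>\<^bsub>gca m d\<^esub> = mat 1" "rep (gca_scalar m d c) = mat c" "k \<in> {1..d} \<Longrightarrow> rep (gca_gen m d k) = X k"
  using ring_hom_mult[OF rep_hom] ring_hom_one[OF rep_hom] ring_hom_minus[OF ring_gca ring_matrix_ring rep_hom]
  by (simp_all add: gca_scalar_def gca_gen_def rep_proj free_scalar_closed free_gen_closed free_eval_scalar
      free_eval_gen matrix_ring_minus)

lemma gca_basis_eq: "gca_basis m d j = G.basis j"
  unfolding gca_basis_def G.basis_def G.ordered_prod_def ..

lemma rep_basis: "rep (G.basis j) = M.basis j"
proof -
  have *: "set ks \<subseteq> {1..d} \<Longrightarrow> rep (G.ordered_prod j ks) = M.ordered_prod j ks" for ks
  proof (induction ks)
    case (Cons k ks)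
    then have "rep (gca_gen m d k [^]\<^bsub>gca m d\<^esub> j k) = X k [^]\<^bsub>matrix_ring\<^esub> j k"
      using ring_hom_pow[OF ring_gca ring_matrix_ring rep_hom G.e_closed[of k]] by (simp add: rep_simps)
    then show ?case
      using Cons by (simp add: G.ordered_prod_simps M.ordered_prod_simps rep_simps G.e_closed G.ordered_prod_closed)
  qed (simp add: G.ordered_prod_simps M.ordered_prod_simps rep_simps)
  show ?thesis unfolding G.basis_def M.basis_def by (rule *) auto
qed

lemma rep_lin_comb: "rep (G.lin_comb u) = (\<Sum>j\<in>gca_indices m d. mat (u j) ** M.basis j)"
  using ring_hom_finsum[OF ring_gca ring_matrix_ring rep_hom G.finite_gca_indices, of "\<lambda>j. gca_scalar m d (u j) \<otimes>\<^bsub>gca m d\<^esub> G.basis j"]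
  by (simp add: G.basis_closed rep_simps rep_basis matrix_ring_finsum G.finite_gca_indices)

lemma rep_lin_comb_coeff:
  "i \<in> gca_indices m d \<Longrightarrow> u i = trace (conj_transpose (M.basis i) ** rep (G.lin_comb u)) / of_nat CARD('n)"
  by (simp add: rep_lin_comb coeff_trace)

lemma lin_comb_cong: "(\<And>j. j \<in> gca_indices m d \<Longrightarrow> u j = v j) \<Longrightarrow> G.lin_comb u = G.lin_comb v"
  by (rule G.finsum_cong') (auto simp: G.basis_closed)

lemma lin_comb_closed: "G.lin_comb u \<in> carrier (gca m d)"
  by (intro G.finsum_closed) (auto simp: G.basis_closed)

text \<open>\<open>gca_coeff\<close> is a definite description: existence comes from spanning,
  uniqueness from the trace formula for the image. The values off the index set are fixed by
  \<open>extensional\<close>, hence the restriction of u.\<close>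

lemma gca_coeff_lin_comb:
  assumes U: "U \<in> carrier (gca m d)"
  shows "U = G.lin_comb (gca_coeff m d U)"
    and "i \<in> gca_indices m d \<Longrightarrow> gca_coeff m d U i = trace (conj_transpose (M.basis i) ** rep U) / of_nat CARD('n)"
proof -
  obtain u where u: "U = G.lin_comb u" using G.span_lin_comb[OF gca_span[OF m U]] ..
  let ?u = "restrict u (gca_indices m d)"
  have U': "U = G.lin_comb ?u" unfolding u by (rule lin_comb_cong) simp
  have coeff: "gca_coeff m d U = ?u"
    unfolding gca_coeff_def gca_basis_eq
  proof (rule the_equality)
    show "?u \<in> extensional (gca_indices m d) \<and> U = G.lin_comb ?u"
      by (rule conjI[OF restrict_extensional U'])
    fix v assume v: "v \<in> extensional (gca_indices m d) \<and> U = G.lin_comb v"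
    show "v = ?u"
    proof (rule extensionalityI[of _ "gca_indices m d"])
      fix i assume i: "i \<in> gca_indices m d"
      have eq: "G.lin_comb v = G.lin_comb ?u" by (rule trans[OF sym[OF conjunct2[OF v]] U'])
      show "v i = ?u i"
        by (rule trans[OF rep_lin_comb_coeff[OF i, of v, unfolded eq] sym[OF rep_lin_comb_coeff[OF i, of ?u]]])
    qed (rule conjunct1[OF v], rule restrict_extensional)
  qed
  show *: "U = G.lin_comb (gca_coeff m d U)" unfolding coeff by (rule U')
  show "gca_coeff m d U i = trace (conj_transpose (M.basis i) ** rep U) / of_nat CARD('n)" if "i \<in> gca_indices m d"
    using rep_lin_comb_coeff[OF that, of "gca_coeff m d U", folded *] .
qed

lemma rep_inj: "inj_on rep (carrier (gca m d))"
proof (rule inj_onI)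
  fix U V assume UV: "U \<in> carrier (gca m d)" "V \<in> carrier (gca m d)" "rep U = rep V"
  have eq: "G.lin_comb (gca_coeff m d U) = G.lin_comb (gca_coeff m d V)"
    using UV by (intro lin_comb_cong) (simp add: gca_coeff_lin_comb(2))
  show "U = V"
    by (rule trans[OF trans[OF gca_coeff_lin_comb(1)[OF UV(1)] eq] sym[OF gca_coeff_lin_comb(1)[OF UV(2)]]])
qed

lemma grade0_trace:
  assumes "U \<in> carrier (gca m d)"
  shows "gca_grade0 m d U = trace (rep U) / of_nat CARD('n)"
proof -
  have "M.basis (\<lambda>k\<in>{1..d}. 0) = mat 1" using M.basis_zero by (simp only: matrix_ring_simps)
  then show ?thesis
    using gca_coeff_lin_comb(2)[OF assms G.zero_index] by (simp only: gca_grade0_def conj_transpose_mat complex_cnj_one matrix_mul_lid)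
qed

text \<open>The factor N / k in \<open>gca_C\<close> cancels the 1 / N of the normalised trace and
  leaves trace / k, the coefficient in \<open>faddeev_leverrier\<close>.\<close>

lemma Det_rep:
  assumes U: "U \<in> carrier (gca m d)"
  shows "gca_Det m d U = det (rep U)"
proof -
  have closed: "gca_iter m d U k \<in> carrier (gca m d)" for k
  proof (induction k rule: induct_nat_012)
    case (ge2 k)
    then show ?case using U by simp
  qed (use U in simp_all)
  define c where "c k = gca_C m d k (gca_iter m d U k)" for k
  have c: "c k = trace (rep (gca_iter m d U k)) / of_nat k" for k
    using m by (simp add: c_def gca_C_def grade0_trace[OF closed] card_n)
  have "det (rep U) = (- 1) ^ (CARD('n) + 1) * c CARD('n)"
  proof (rule faddeev_leverrier)
    show "rep (gca_iter m d U (Suc 0)) = rep U" by simp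
    show "rep (gca_iter m d U (Suc (Suc k))) = rep U ** (rep (gca_iter m d U (Suc k)) - mat (c (Suc k)))" for k
      using U closed[of "Suc k"] by (simp add: rep_simps c_def)
  qed (rule c)
  then show ?thesis by (simp only: gca_Det_def c_def card_n)
qed

section \<open>Coordinates, surjectivity and the group isomorphism\<close>

definition coord_map :: "('i \<Rightarrow> nat \<Rightarrow> nat) \<Rightarrow> complex ^ 'n ^ 'n \<Rightarrow> complex ^ 'i" where
  "coord_map idx A = (\<chi> i. trace (conj_transpose (M.basis (idx i)) ** A) / of_nat CARD('n))"

definition coord_inv :: "('i::finite \<Rightarrow> nat \<Rightarrow> nat) \<Rightarrow> complex ^ 'i \<Rightarrow> complex ^ 'n ^ 'n" where
  "coord_inv idx v = (\<Sum>i\<in>UNIV. mat (v $ i) ** M.basis (idx i))"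

lemma linear_coord_map: "linear (coord_map idx)"
proof (rule linearI)
  show "coord_map idx (A + B) = coord_map idx A + coord_map idx B" for A B
    by (simp add: coord_map_def vec_eq_iff matrix_add_ldistrib trace_add add_divide_distrib)
  show "coord_map idx (c *\<^sub>R A) = c *\<^sub>R coord_map idx A" for c A
  proof -
    have "c *\<^sub>R A = mat (of_real c) ** A"
      by (simp add: vec_eq_iff mat_mult_nth scaleR_conv_of_real[where 'a = complex])
    moreover have "B ** (mat (of_real c) ** A) = mat (of_real c) ** (B ** A)" for B :: "complex ^ 'n ^ 'n"
      by (simp only: matrix_mul_assoc mat_mult_commute[of B])
    ultimately have "trace (B ** (c *\<^sub>R A)) = of_real c * trace (B ** A)" for B :: "complex ^ 'n ^ 'n"
      by (simp only: trace_mat_mult)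
    then show ?thesis
      by (simp add: coord_map_def vec_eq_iff scaleR_conv_of_real[where 'a = complex])
  qed
qed

lemma linear_coord_inv: "linear (coord_inv idx)"
proof (rule linearI)
  show "coord_inv idx (v + w) = coord_inv idx v + coord_inv idx w" for v w
    by (simp add: coord_inv_def mat_add matrix_add_rdistrib sum.distrib)
  show "coord_inv idx (c *\<^sub>R v) = c *\<^sub>R coord_inv idx v" for c v
  proof -
    have "mat ((c *\<^sub>R v) $ i) ** A = c *\<^sub>R (mat (v $ i) ** A)" for i and A :: "complex ^ 'n ^ 'n"
      by (simp add: vec_eq_iff mat_mult_nth)
    then show ?thesis by (simp only: coord_inv_def scaleR_sum_right)
  qed
qed

context
  fixes idx :: "'i::finite \<Rightarrow> nat \<Rightarrow> nat"
  assumes idx: "bij_betw idx UNIV (gca_indices m d)"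
begin

lemma coord_inv_eq:
  assumes "\<And>i. v $ i = u (idx i)"
  shows "coord_inv idx v = (\<Sum>j\<in>gca_indices m d. mat (u j) ** M.basis j)"
  unfolding coord_inv_def assms by (rule sum.reindex_bij_betw[OF idx])

lemma coord_map_coord_inv: "coord_map idx (coord_inv idx v) = v"
proof -
  define u where "u j = v $ inv_into UNIV idx j" for j
  have u: "v $ i = u (idx i)" for i
    using idx by (simp add: u_def bij_betw_def inv_into_f_f)
  have mem: "idx i \<in> gca_indices m d" for i using bij_betw_apply[OF idx] by simp
  have "trace (conj_transpose (M.basis (idx i)) ** coord_inv idx v) / of_nat CARD('n) = v $ i" for i
    unfolding coord_inv_eq[OF u] coeff_trace[OF mem] u by simp
  then show ?thesis by (simp add: coord_map_def vec_eq_iff)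
qed

text \<open>Evenness of d again: the square of m^(d div 2) is m^d, the number of monomials.\<close>

lemma dim_eq: "DIM(complex ^ 'n ^ 'n) = DIM(complex ^ 'i)"
proof -
  have "CARD('i) = card (gca_indices m d)" by (rule bij_betw_same_card[OF idx])
  also have "\<dots> = m ^ d" using m by (simp add: gca_indices_def card_PiE)
  also have "\<dots> = CARD('n) * CARD('n)"
  proof -
    have "d div 2 + d div 2 = d" using d_even by presburger
    then show ?thesis unfolding card_n power_add[symmetric] by simp
  qed
  finally show ?thesis by simp
qed

text \<open>Orthogonality gives only the one-sided identity \<open>coord_map_coord_inv\<close>; an
  injective linear map between spaces of equal dimension is onto, which makes it two-sided.
  Surjectivity of \<open>rep\<close> rests on this.\<close>

lemma coord_inv_coord_map: "coord_inv idx (coord_map idx A) = A"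
proof -
  have "inj (coord_inv idx)" by (rule inj_on_inverseI[where g = "coord_map idx"]) (rule coord_map_coord_inv)
  then have "surj (coord_inv idx)"
    by (rule linear_injective_imp_surjective[OF linear_coord_inv]) (simp only: dim_UNIV dim_eq)
  then obtain v where "A = coord_inv idx v" by (rule surjE)
  then show ?thesis by (simp only: coord_map_coord_inv)
qed

lemma rep_surj: "\<exists>U\<in>carrier (gca m d). rep U = A"
proof -
  define u where "u j = coord_map idx A $ inv_into UNIV idx j" for j
  have u: "coord_map idx A $ i = u (idx i)" for i
    using idx by (simp add: u_def bij_betw_def inv_into_f_f)
  have "rep (G.lin_comb u) = coord_inv idx (coord_map idx A)"
    unfolding rep_lin_comb coord_inv_eq[OF u] ..
  then have "rep (G.lin_comb u) = A" by (simp only: coord_inv_coord_map)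
  then show ?thesis using lin_comb_closed by (intro bexI)
qed

lemma gca_coords_rep: "U \<in> carrier (gca m d) \<Longrightarrow> gca_coords m d idx U = coord_map idx (rep U)"
  using bij_betw_apply[OF idx] by (simp add: gca_coords_def coord_map_def gca_coeff_lin_comb(2))

text \<open>The image of a monomial is unitary, so its adjoint is its inverse. A preimage of that
  adjoint is a two-sided inverse in the algebra by injectivity of \<open>rep\<close>. This is the
  link between Hermitian conjugation and the conjugate transpose.\<close>

lemma rep_inv_basis: "inv\<^bsub>gca m d\<^esub> G.basis j \<in> carrier (gca m d) \<and>
  rep (inv\<^bsub>gca m d\<^esub> G.basis j) = conj_transpose (M.basis j)"
proof -
  obtain V where V: "V \<in> carrier (gca m d)" "rep V = conj_transpose (M.basis j)"
    using rep_surj by blast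
  note b = G.basis_closed[of j]
  have "M.basis j ** conj_transpose (M.basis j) = mat 1"
    by (rule iffD1[OF matrix_left_right_inverse basis_unitary])
  then have eq: "rep (G.basis j \<otimes>\<^bsub>gca m d\<^esub> V) = rep \<one>\<^bsub>gca m d\<^esub>" "rep (V \<otimes>\<^bsub>gca m d\<^esub> G.basis j) = rep \<one>\<^bsub>gca m d\<^esub>"
    using V b by (simp_all add: rep_simps rep_basis basis_unitary)
  have "G.basis j \<otimes>\<^bsub>gca m d\<^esub> V = \<one>\<^bsub>gca m d\<^esub>"
    by (rule inj_onD[OF rep_inj eq(1)]) (simp_all add: V b)
  moreover have "V \<otimes>\<^bsub>gca m d\<^esub> G.basis j = \<one>\<^bsub>gca m d\<^esub>"
    by (rule inj_onD[OF rep_inj eq(2)]) (simp_all add: V b)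
  ultimately have "inv\<^bsub>gca m d\<^esub> G.basis j = V" by (rule G.inv_char[OF b V(1)])
  with V show ?thesis by simp
qed

lemma conj_transpose_sum: "conj_transpose (\<Sum>j\<in>J. F j) = (\<Sum>j\<in>J. conj_transpose (F j))"
  by (rule linear_sum[OF linear_conj_transpose])

lemma rep_conj:
  assumes U: "U \<in> carrier (gca m d)"
  shows "gca_conj m d U \<in> carrier (gca m d)" "rep (gca_conj m d U) = conj_transpose (rep U)"
proof -
  let ?c = "gca_coeff m d U" and ?inv = "\<lambda>j. inv\<^bsub>gca m d\<^esub> G.basis j"
  have closed: "?inv j \<in> carrier (gca m d)" and rep_inv: "rep (?inv j) = conj_transpose (M.basis j)" for j
    using rep_inv_basis[of j] by simp_all
  have conj: "gca_conj m d U = (\<Oplus>\<^bsub>gca m d\<^esub>j\<in>gca_indices m d. gca_scalar m d (cnj (?c j)) \<otimes>\<^bsub>gca m d\<^esub> ?inv j)"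
    unfolding gca_conj_def gca_basis_eq ..
  show "gca_conj m d U \<in> carrier (gca m d)"
    unfolding conj by (intro G.finsum_closed) (auto simp: closed)
  have "rep (gca_conj m d U) = (\<Sum>j\<in>gca_indices m d. mat (cnj (?c j)) ** conj_transpose (M.basis j))"
    unfolding conj
    using ring_hom_finsum[OF ring_gca ring_matrix_ring rep_hom G.finite_gca_indices, of "\<lambda>j. gca_scalar m d (cnj (?c j)) \<otimes>\<^bsub>gca m d\<^esub> ?inv j"]
    by (simp add: closed rep_simps rep_inv matrix_ring_finsum G.finite_gca_indices)
  also have "\<dots> = (\<Sum>j\<in>gca_indices m d. conj_transpose (mat (?c j) ** M.basis j))"
  proof (rule sum.cong[OF refl])
    fix j
    show "mat (cnj (?c j)) ** conj_transpose (M.basis j) = conj_transpose (mat (?c j) ** M.basis j)"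
      unfolding conj_transpose_mult conj_transpose_mat by (rule mat_mult_commute[symmetric])
  qed
  also have "\<dots> = conj_transpose (rep (G.lin_comb ?c))"
    unfolding rep_lin_comb conj_transpose_sum ..
  also have "\<dots> = conj_transpose (rep U)"
    by (rule arg_cong[of _ _ "\<lambda>V. conj_transpose (rep V)"], rule sym, rule gca_coeff_lin_comb(1)[OF U])
  finally show "rep (gca_conj m d U) = conj_transpose (rep U)" .
qed

text \<open>Both defining conditions pass through \<open>rep\<close>: the determinant by
  \<open>Det_rep\<close>, the unitarity equation by injectivity. Closure of the group then comes
  from the matrix side.\<close>

lemma mem_SU_gca_iff: "U \<in> carrier (SU_gca m d) \<longleftrightarrow> U \<in> carrier (gca m d) \<and> rep U \<in> carrier SU_matrices"
proof (cases "U \<in> carrier (gca m d)")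
  case U: True
  have "gca_conj m d U \<otimes>\<^bsub>gca m d\<^esub> U = \<one>\<^bsub>gca m d\<^esub> \<longleftrightarrow>
      rep (gca_conj m d U \<otimes>\<^bsub>gca m d\<^esub> U) = rep \<one>\<^bsub>gca m d\<^esub>"
    using inj_on_eq_iff[OF rep_inj, of "gca_conj m d U \<otimes>\<^bsub>gca m d\<^esub> U" "\<one>\<^bsub>gca m d\<^esub>"] U rep_conj(1)[OF U] by simp
  also have "\<dots> \<longleftrightarrow> conj_transpose (rep U) ** rep U = mat 1"
    using U rep_conj[OF U] by (simp add: rep_simps)
  finally show ?thesis
    using U by (simp add: SU_gca_def mem_SU_iff Det_rep)
qed (simp add: SU_gca_def)

lemma group_SU_gca: "group (SU_gca m d)"
proof (rule groupI)
  fix U V assume UV: "U \<in> carrier (SU_gca m d)" "V \<in> carrier (SU_gca m d)"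
  then show "U \<otimes>\<^bsub>SU_gca m d\<^esub> V \<in> carrier (SU_gca m d)"
    unfolding mem_SU_gca_iff by (simp add: SU_gca_def rep_simps SU_mult)
next
  have "mat 1 \<in> carrier (SU_matrices :: (complex ^ 'n ^ 'n) monoid)"
    by (simp add: mem_SU_iff)
  then show "\<one>\<^bsub>SU_gca m d\<^esub> \<in> carrier (SU_gca m d)"
    unfolding mem_SU_gca_iff by (simp add: SU_gca_def rep_simps)
next
  fix U V W assume "U \<in> carrier (SU_gca m d)" "V \<in> carrier (SU_gca m d)" "W \<in> carrier (SU_gca m d)"
  then show "U \<otimes>\<^bsub>SU_gca m d\<^esub> V \<otimes>\<^bsub>SU_gca m d\<^esub> W = U \<otimes>\<^bsub>SU_gca m d\<^esub> (V \<otimes>\<^bsub>SU_gca m d\<^esub> W)"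
    unfolding mem_SU_gca_iff by (simp add: SU_gca_def G.m_assoc)
next
  fix U assume "U \<in> carrier (SU_gca m d)"
  then show "\<one>\<^bsub>SU_gca m d\<^esub> \<otimes>\<^bsub>SU_gca m d\<^esub> U = U"
    unfolding mem_SU_gca_iff by (simp add: SU_gca_def)
next
  fix U assume "U \<in> carrier (SU_gca m d)"
  then have U: "U \<in> carrier (gca m d)" "rep U \<in> carrier SU_matrices" by (simp_all add: mem_SU_gca_iff)
  have "gca_conj m d U \<in> carrier (SU_gca m d)"
    unfolding mem_SU_gca_iff using rep_conj[OF U(1)] SU_conj_transpose(3)[OF U(2)] by simp
  moreover have "gca_conj m d U \<otimes>\<^bsub>SU_gca m d\<^esub> U = \<one>\<^bsub>SU_gca m d\<^esub>"
    using \<open>U \<in> carrier (SU_gca m d)\<close> by (simp add: SU_gca_def)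
  ultimately show "\<exists>V\<in>carrier (SU_gca m d). V \<otimes>\<^bsub>SU_gca m d\<^esub> U = \<one>\<^bsub>SU_gca m d\<^esub>" by (rule bexI[rotated])
qed

lemma rep_iso: "rep \<in> iso (SU_gca m d) SU_matrices"
proof (rule isoI)
  show "rep \<in> hom (SU_gca m d) SU_matrices"
  proof (rule homI)
    show "rep U \<in> carrier SU_matrices" if "U \<in> carrier (SU_gca m d)" for U
      using that by (simp add: mem_SU_gca_iff)
    show "rep (U \<otimes>\<^bsub>SU_gca m d\<^esub> V) = rep U \<otimes>\<^bsub>SU_matrices\<^esub> rep V"
      if "U \<in> carrier (SU_gca m d)" "V \<in> carrier (SU_gca m d)" for U V
      using that unfolding mem_SU_gca_iff by (simp add: SU_gca_def SU_matrices_def rep_simps)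
  qed
  show "bij_betw rep (carrier (SU_gca m d)) (carrier SU_matrices)"
  proof (rule bij_betw_imageI)
    show "inj_on rep (carrier (SU_gca m d))"
      by (rule inj_on_subset[OF rep_inj]) (auto simp: mem_SU_gca_iff)
    show "rep ` carrier (SU_gca m d) = carrier SU_matrices"
    proof (intro subset_antisym subsetI)
      fix A :: "complex ^ 'n ^ 'n" assume A: "A \<in> carrier SU_matrices"
      obtain U where "U \<in> carrier (gca m d)" "rep U = A" using rep_surj by blast
      with A show "A \<in> rep ` carrier (SU_gca m d)"
        by (intro image_eqI[of _ _ U]) (simp_all add: mem_SU_gca_iff)
    qed (auto simp: mem_SU_gca_iff)
  qed
qed

lemma lie_isomorphic_SU:
  "lie_isomorphic (SU_gca m d) (gca_coords m d idx) (SU_matrices :: (complex ^ 'n ^ 'n) monoid) id"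
  unfolding lie_isomorphic_def
proof (rule exI[of _ rep], rule lie_group_iso_linear[OF lie_group_SU group_SU_gca rep_iso linear_coord_map linear_coord_inv])
  show "coord_inv idx (coord_map idx A) = A" for A by (rule coord_inv_coord_map)
  show "coord_map idx (coord_inv idx v) = v" for v by (rule coord_map_coord_inv)
  show "gca_coords m d idx U = coord_map idx (id (rep U))" if "U \<in> carrier (SU_gca m d)" for U
    using that by (simp add: mem_SU_gca_iff gca_coords_rep)
qed

end

end

theorem theorem8p1:
  fixes m d :: nat and idx :: "'i::finite \<Rightarrow> nat \<Rightarrow> nat"
  assumes "m \<ge> 2" and "d \<ge> 2" and "even d"
    and "CARD('n::finite) = m ^ (d div 2)"
    and "bij_betw idx UNIV (gca_indices m d)"
  shows "lie_isomorphic (SU_gca m d) (gca_coords m d idx)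
           (SU_matrices :: (complex ^ 'n ^ 'n) monoid) id"
proof -
  have m: "m > 0" using assms(1) by simp
  \<comment> \<open>The clock-and-shift construction gives 2r generators of size m^r; r = d div 2
    makes their number exactly d.\<close>
  have d: "2 * (d div 2) = d" using assms(3) by simp
  show ?thesis
  proof (rule clifford_matrices_exist[OF m assms(4), unfolded d])
    fix e :: "nat \<Rightarrow> complex ^ 'n ^ 'n"
    assume e: "\<And>j. conj_transpose (e j) ** e j = mat 1"
      "\<And>j. j \<in> {1..d} \<Longrightarrow> matrix_pow (e j) m = mat 1"
      "\<And>j l. \<lbrakk>j \<in> {1..d}; l \<in> {1..d}; j < l\<rbrakk> \<Longrightarrow> e j ** e l = mat (root_omega m) ** (e l ** e j)"
    interpret clifford_matrices e m d
      by unfold_locales (fact m assms(3,4) e)+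
    show ?thesis by (rule lie_isomorphic_SU[OF assms(5)])
  qed
qed

end
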